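(* Let $n\ge 2$ and $\varphi\in\Phi_2$. If $K$ and $L$ are compact sets in $\mathbb{R}^n$ with $V(K)V(L)>0$, then $$1\ge\varphi\left(\left(\frac{V(K)}{V(K+_\varphi L)}\right)^{1/n},\left(\frac{V(L)}{V(K+_\varphi L)}\right)^{1/n}\right).$$ When $\varphi$ is strictly convex, equality holds if and only if $K$ and $L$ are convex, contain the origin, and are dilatates of each other.
   Context: $V$ denotes $n$-dimensional Lebesgue measure. A dilatate of $X$ is a set $tX$ with $t>0$. $\Phi_m$ is the set of convex functions $\varphi:[0,\infty)^m\to[0,\infty)$ that are increasing (i.e. nondecreasing) in each variable and satisfy $\varphi(o)=0$ and $\varphi(e_j)=1$, $j=1,\dots,m$; $\Phi=\Phi_1$. The polar of $J\subset\mathbb{R}^2$ is $J^\circ=\{x:x\cdot y\le 1\text{ for all }y\in J\}$. Definition of $K+_\varphi L$ for arbitrary sets $K,L\subset\mathbb{R}^n$. Let $J_\varphi=\{(x_1,x_2)\in[-1,1]^2:\varphi(|x_1|,|x_2|)\le 1\}$, a convex body symmetric in both coordinate axes. (a) If $J_\varphi^\circ=[-1,1]^2$, put $K+_\varphi L=K+L=\{x+y:x\in K,y\in L\}$. (b) Otherwise there are $\psi_1,\psi_2\in\Phi$ such that $J_\varphi^\circ\cap[0,\infty)^2=\{(x_1,x_2)\in[0,1]^2:\psi_1(x_1)+\psi_2(x_2)\le 1\}$; fix such $\psi_1,\psi_2$. Let $\tau_j=\max\{t\ge 0:\psi_j(t)=0\}<1$ and let $\widehat{\psi_j}:[\tau_j,1]\to[0,1]$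 be the restriction of $\psi_j$ to $[\tau_j,1]$, which is a bijection. Then $$K+_\varphi L=\{\widehat{\psi_1}^{-1}(1-t)x+\widehat{\psi_2}^{-1}(t)y:x\in K,\ y\in L,\ 0\le t\le 1\}.$$ (When $K,L$ are compact convex sets containing the origin, this agrees with the set whose support function is $h_{K+_\varphi L}(x)=\inf\{\lambda>0:\varphi(h_K(x)/\lambda,h_L(x)/\lambda)\le 1\}$.) *)

theory Defs
  imports "HOL-Analysis.Analysis"
begin

definition orthant :: "'a::euclidean_space set" where
  "orthant = {x. \<forall>b\<in>Basis. 0 \<le> x \<bullet> b}"

text \<open>
  The class of functions on the nonnegative orthant, uniformly in the dimension \<open>m\<close>:
  \<open>\<Phi>\<^sub>1\<close> is the instance at \<^typ>\<open>real\<close>, \<open>\<Phi>\<^sub>2\<close> the instance at \<^typ>\<open>real \<times> real\<close>.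
  Values outside the orthant are unconstrained, and no definition below depends on them.
\<close>

definition Phi :: "('a::euclidean_space \<Rightarrow> real) set" where
  "Phi = {\<phi>. convex_on orthant \<phi> \<and>
              (\<forall>x\<in>orthant. 0 \<le> \<phi> x) \<and>
              (\<forall>x\<in>orthant. \<forall>b\<in>Basis. \<forall>s\<ge>0. \<phi> x \<le> \<phi> (x + s *\<^sub>R b)) \<and>
              \<phi> 0 = 0 \<and>
              (\<forall>b\<in>Basis. \<phi> b = 1)}"

definition strictly_convex_on :: "'a::real_vector set \<Rightarrow> ('a \<Rightarrow> real) \<Rightarrow> bool" where
  "strictly_convex_on S f \<longleftrightarrow> convex S \<and>
     (\<forall>x\<in>S. \<forall>y\<in>S. \<forall>u>0. \<forall>v>0. x \<noteq> y \<longrightarrow> u + v = 1 \<longrightarrow>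
        f (u *\<^sub>R x + v *\<^sub>R y) < u * f x + v * f y)"

definition polar :: "'a::real_inner set \<Rightarrow> 'a set" where
  "polar J = {x. \<forall>y\<in>J. x \<bullet> y \<le> 1}"

definition J_body :: "(real \<times> real \<Rightarrow> real) \<Rightarrow> (real \<times> real) set" where
  "J_body \<phi> = {(x1, x2). x1 \<in> {-1..1} \<and> x2 \<in> {-1..1} \<and> \<phi> (\<bar>x1\<bar>, \<bar>x2\<bar>) \<le> 1}"

definition represents_polar ::
  "(real \<times> real \<Rightarrow> real) \<Rightarrow> (real \<Rightarrow> real) \<Rightarrow> (real \<Rightarrow> real) \<Rightarrow> bool" where
  "represents_polar \<phi> \<psi>\<^sub>1 \<psi>\<^sub>2 \<longleftrightarrow> \<psi>\<^sub>1 \<in> Phi \<and> \<psi>\<^sub>2 \<in> Phi \<and>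
     polar (J_body \<phi>) \<inter> orthant =
       {(x1, x2). x1 \<in> {0..1} \<and> x2 \<in> {0..1} \<and> \<psi>\<^sub>1 x1 + \<psi>\<^sub>2 x2 \<le> 1}"

definition last_zero :: "(real \<Rightarrow> real) \<Rightarrow> real" where
  "last_zero \<psi> = (GREATEST t. 0 \<le> t \<and> \<psi> t = 0)"

definition hat_inv :: "(real \<Rightarrow> real) \<Rightarrow> real \<Rightarrow> real" where
  "hat_inv \<psi> = inv_into {last_zero \<psi>..1} \<psi>"

definition orlicz_comb ::
  "(real \<Rightarrow> real) \<Rightarrow> (real \<Rightarrow> real) \<Rightarrow> 'a::real_vector set \<Rightarrow> 'a set \<Rightarrow> 'a set" where
  "orlicz_comb \<psi>\<^sub>1 \<psi>\<^sub>2 K L =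
     {hat_inv \<psi>\<^sub>1 (1 - t) *\<^sub>R x + hat_inv \<psi>\<^sub>2 t *\<^sub>R y | x y t.
        x \<in> K \<and> y \<in> L \<and> 0 \<le> t \<and> t \<le> 1}"

text \<open>
  The representing pair is not unique, but the resulting set does not depend on it: as \<open>t\<close>
  runs through \<open>[0, 1]\<close>, the coefficient pairs trace the boundary arc of the polar from
  \<open>(1, \<tau>\<^sub>2)\<close> to \<open>(\<tau>\<^sub>1, 1)\<close>.
\<close>

definition orlicz_sum ::
  "(real \<times> real \<Rightarrow> real) \<Rightarrow> 'a::real_vector set \<Rightarrow> 'a set \<Rightarrow> 'a set" where
  "orlicz_sum \<phi> K L =
     (if polar (J_body \<phi>) = {-1..1} \<times> {-1..1} then {x + y | x y. x \<in> K \<and> y \<in> L}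
      else (let (\<psi>\<^sub>1, \<psi>\<^sub>2) = (SOME (\<psi>\<^sub>1, \<psi>\<^sub>2). represents_polar \<phi> \<psi>\<^sub>1 \<psi>\<^sub>2)
            in orlicz_comb \<psi>\<^sub>1 \<psi>\<^sub>2 K L))"

definition dilatates :: "'a::real_vector set \<Rightarrow> 'a set \<Rightarrow> bool" where
  "dilatates K L \<longleftrightarrow> (\<exists>t>0. L = (\<lambda>x. t *\<^sub>R x) ` K)"

end

theory Submission
  imports Defs
begin

text \<open>
  As the coefficients run through an upper boundary arc \<open>A\<close> of the polar of \<open>J_body \<phi>\<close>, the Orlicz sum is
  the union of the sets \<open>a K + b L\<close> with \<open>(a, b) \<in> A\<close>. Let \<open>k\<close>, \<open>l\<close>, \<open>v\<close> be the \<open>n\<close>-th roots of the volumes of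
  \<open>K\<close>, \<open>L\<close> and the sum. Brunn--Minkowski gives \<open>a k + b l \<le> v\<close> on the polar, which by the bipolar theorem says
  \<open>\<phi> (k / v, l / v) \<le> 1\<close>. In the equality case the maximising pair \<open>(a, b)\<close> makes \<open>a K\<close> and \<open>b L\<close> an equality
  case of Brunn--Minkowski, and strict convexity of \<open>\<phi>\<close> (smoothness of the polar) excludes translations.

  Equality in Brunn--Minkowski for compact sets \<open>A\<close>, \<open>B\<close> of size ratio \<open>r\<close> is inherited by the pieces cut off
  by parallel hyperplanes in equal volume proportion. Bonnesen's section inequality, applied to thin slabs,
  then shows that the marginal of \<open>B\<close> in every direction is an affine image of slope \<open>r\<close> of that of \<open>A\<close>. Hence
  \<open>B\<close> agrees with some \<open>z + r A\<close> almost everywhere, and \<open>A + r A\<close> having the volume of \<open>(1 + r) A\<close> forces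
  convexity.
\<close>

section \<open>One-dimensional sums and superlevel sets\<close>

text \<open>\<open>K\<close> and \<open>L\<close> are only compact, so the tools of convex geometry
  are not at hand, and the sum of two Borel sets need not be Borel; hence the volumes compared are
  those of compact sets. Two choices carry the equality case. Fixing the ratio \<open>r\<close> in
  place of roots makes the Brunn--Minkowski bound linear in the volume, so that it can be added over
  pieces on opposite sides of a hyperplane. And Bonnesen's lower bound, as a function of the ratio
  \<open>q\<close> of the roots of the largest sections, attains the Brunn--Minkowski value only at
  \<open>q = r\<close>. On a thin slab the largest section is hardly larger than the middle one, so
  matched sections have ratio \<open>r ^ (n - 1)\<close>, although section functions are merely
  upper semicontinuous. The map between heights of matched volume then has formal derivative
  \<open>r\<close>; since it need not be known to be differentiable, this relation is integrated
  instead. The resulting shift depends on the direction \<open>u\<close>, and first moments identify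
  it as the inner product of \<open>u\<close> with one vector \<open>z\<close>. On the coefficient
  side, \<open>orlicz_sum\<close> picks its pair by \<open>SOME\<close>, so a representing pair has
  to be constructed for an arbitrary polar.\<close>

lemma emeasure_lborel_affine_image:
  fixes S :: "'a::euclidean_space set"
  assumes S: "S \<in> sets borel" and m: "m \<noteq> 0"
  shows "emeasure lborel ((\<lambda>x. d + m *\<^sub>R x) ` S) = ennreal (\<bar>m\<bar> ^ DIM('a)) * emeasure lborel S"
    and "(\<lambda>x. d + m *\<^sub>R x) ` S \<in> sets borel"
proof -
  let ?T = "\<lambda>x. d + m *\<^sub>R x" and ?U = "\<lambda>x. (1/m) *\<^sub>R (x - d)"
  have img: "?T ` S = ?U -` S"
  proof (intro equalityI subsetI)
    fix y assume "y \<in> ?U -` S"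
    then have "?U y \<in> S" "y = ?T (?U y)" using m by auto
    then show "y \<in> ?T ` S" by blast
  qed (use m in auto)
  have "?U \<in> borel_measurable borel" by measurable
  from measurable_sets[OF this S] show B: "?T ` S \<in> sets borel"
    by (simp add: img)
  have vim: "?T -` (?T ` S) = S" using m by auto
  have "emeasure lborel (?T ` S)
      = emeasure (density (distr lborel borel ?T) (\<lambda>_. \<bar>m\<bar>^DIM('a))) (?T ` S)"
    using lborel_affine[OF m, of d] by simp
  also have "\<dots> = ennreal (\<bar>m\<bar> ^ DIM('a)) * emeasure lborel S"
    using B by (simp add: emeasure_density nn_integral_cmult emeasure_distr vim)
  finally show "emeasure lborel (?T ` S) = ennreal (\<bar>m\<bar> ^ DIM('a)) * emeasure lborel S" .
qed

lemma emeasure_lborel_inner_compact: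
  fixes S :: "'a::euclidean_space set"
  assumes S: "S \<in> sets borel" and c: "c < emeasure lborel S"
  obtains K where "compact K" "K \<subseteq> S" "c < emeasure lborel K"
proof -
  have "emeasure lborel S = (SUP k. emeasure lborel (S \<inter> cball 0 (real k)))"
  proof (subst SUP_emeasure_incseq)
    show "range (\<lambda>k. S \<inter> cball 0 (real k)) \<subseteq> sets lborel" using S by auto
    show "incseq (\<lambda>k. S \<inter> cball 0 (real k))"
      by (auto simp: incseq_def)
    have "(\<Union>k. S \<inter> cball 0 (real k)) = S"
      by (auto simp: real_arch_simple)
    then show "emeasure lborel S = emeasure lborel (\<Union>k. S \<inter> cball 0 (real k))" by simp
  qed
  then obtain k where k: "c < emeasure lborel (S \<inter> cball 0 (real k))"
    using c by (auto simp: less_SUP_iff)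
  \<comment> \<open>Inner regularity is applied to a finite measure: Lebesgue measure cut down to a
    ball that still leaves more than \<open>c\<close> of \<open>S\<close>.\<close>
  define M where "M = density lborel (indicator (cball (0::'a) (real k)))"
  have eM: "emeasure M B = emeasure lborel (B \<inter> cball 0 (real k))" if "B \<in> sets borel" for B
  proof -
    have "emeasure M B = (\<integral>\<^sup>+x. indicator (B \<inter> cball 0 (real k)) x \<partial>lborel)"
      using that unfolding M_def
      by (subst emeasure_density)
         (auto intro!: nn_integral_cong borel_measurable_indicator split: split_indicator simp del: nn_integral_indicator)
    then show ?thesis using that by (simp add: nn_integral_indicator)
  qed
  have "emeasure M (space M) \<noteq> \<infinity>"
    using eM[of UNIV] emeasure_lborel_cball_finite[of "0::'a" "real k"] by (simp add: M_def less_top)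
  from inner_regular[OF _ this S] 
  have "emeasure M S = (SUP K\<in>{K. K \<subseteq> S \<and> compact K}. emeasure M K)" by (simp add: M_def)
  then obtain K where K: "K \<subseteq> S" "compact K" "c < emeasure M K"
    using k eM[OF S] by (auto simp: less_SUP_iff)
  have "emeasure M K \<le> emeasure lborel K"
    using K by (auto simp: eM borel_compact intro!: emeasure_mono)
  with K that show thesis by (meson order.strict_trans2)
qed

text \<open>With \<open>x1\<close> the maximum of \<open>X\<close> and \<open>y0\<close> the minimum
  of \<open>Y\<close>, the translates \<open>y0 + X\<close> and \<open>x1 + Y\<close> both lie in
  \<open>Z\<close> and meet only in \<open>x1 + y0\<close>.\<close>

lemma emeasure_sum_ge_compact:
  fixes X Y Z :: "real set"
  assumes X: "compact X" "X \<noteq> {}" and Y: "compact Y" "Y \<noteq> {}" and Z: "Z \<in> sets borel"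
    and sum: "\<And>x y. x \<in> X \<Longrightarrow> y \<in> Y \<Longrightarrow> x + y \<in> Z"
  shows "emeasure lborel X + emeasure lborel Y \<le> emeasure lborel Z"
proof -
  obtain x1 where x1: "x1 \<in> X" "\<And>x. x \<in> X \<Longrightarrow> x \<le> x1" using compact_attains_sup[OF X] by blast
  obtain y0 where y0: "y0 \<in> Y" "\<And>y. y \<in> Y \<Longrightarrow> y0 \<le> y" using compact_attains_inf[OF Y] by blast
  define U where "U = (\<lambda>x. y0 + 1 *\<^sub>R x) ` X"
  define W where "W = (\<lambda>x. x1 + 1 *\<^sub>R x) ` Y"
  have m: "X \<in> sets borel" "Y \<in> sets borel" using X Y by (auto intro: borel_compact)
  note U = emeasure_lborel_affine_image[OF m(1), of 1 y0, folded U_def]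
  note W = emeasure_lborel_affine_image[OF m(2), of 1 x1, folded W_def]
  have sub: "U \<inter> W \<subseteq> {x1 + y0}"
    using x1 y0 by (auto simp: U_def W_def) (smt (verit))
  have null: "U \<inter> W \<in> null_sets lborel"
    by (rule null_sets_subset[OF _ _ sub]) (use U W in auto)
  have "emeasure lborel X + emeasure lborel Y = emeasure lborel U + emeasure lborel W"
    using U W by simp
  also have "\<dots> = emeasure lborel U + emeasure lborel (W - U \<inter> W)"
    using null W by (subst emeasure_Diff_null_set) auto
  also have "\<dots> = emeasure lborel (U \<union> (W - U \<inter> W))"
    using U W by (intro plus_emeasure) auto
  also have "\<dots> \<le> emeasure lborel Z"
  proof (rule emeasure_mono)
    have "y0 + x \<in> Z" if "x \<in> X" for x using sum[OF that y0(1)] by (simp add: add.commute)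
    moreover have "x1 + y \<in> Z" if "y \<in> Y" for y using sum[OF x1(1) that] .
    ultimately show "U \<union> (W - U \<inter> W) \<subseteq> Z" by (auto simp: U_def W_def)
  qed (use Z in simp)
  finally show ?thesis .
qed

text \<open>The compact case passes to Borel sets by inner regularity. Only nonempty compact subsets
  are used, since a missing summand would leave no translate of the other one.\<close>

lemma emeasure_sum_ge:
  fixes X Y Z :: "real set"
  assumes X: "X \<in> sets borel" "X \<noteq> {}" and Y: "Y \<in> sets borel" "Y \<noteq> {}" and Z: "Z \<in> sets borel"
    and sum: "\<And>x y. x \<in> X \<Longrightarrow> y \<in> Y \<Longrightarrow> x + y \<in> Z"
  shows "emeasure lborel X + emeasure lborel Y \<le> emeasure lborel Z"
proof -
  let ?C = "\<lambda>S. {K. K \<subseteq> S \<and> compact K \<and> K \<noteq> {}}"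
  have reg: "emeasure lborel S = (SUP K\<in>?C S. emeasure lborel K)"
    if S: "S \<in> sets borel" "S \<noteq> {}" for S :: "real set"
  proof (rule antisym)
    show "emeasure lborel S \<le> (SUP K\<in>?C S. emeasure lborel K)"
    proof (rule ccontr)
      assume "\<not> ?thesis"
      then have "(SUP K\<in>?C S. emeasure lborel K) < emeasure lborel S" by simp
      from emeasure_lborel_inner_compact[OF S(1) this] obtain K where
        K: "compact K" "K \<subseteq> S" "(SUP K\<in>?C S. emeasure lborel K) < emeasure lborel K" .
      then have "K \<noteq> {}" by auto
      then have "emeasure lborel K \<le> (SUP K\<in>?C S. emeasure lborel K)"
        using K by (intro SUP_upper) auto
      then show False using K(3) by simp
    qed
  qed (use S in \<open>auto intro!: SUP_least emeasure_mono\<close>)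
  have ne: "?C X \<noteq> {}" "?C Y \<noteq> {}"
    using X Y by (metis (mono_tags, lifting) Collect_empty_eq all_not_in_conv compact_sing empty_subsetI insert_not_empty insert_subset)+
  have "emeasure lborel X + emeasure lborel Y
     = (SUP K\<in>?C X. SUP L\<in>?C Y. emeasure lborel K + emeasure lborel L)"
    unfolding reg[OF X] reg[OF Y]
    by (subst ennreal_SUP_add_left[OF ne(1), symmetric], subst ennreal_SUP_add_right[OF ne(2), symmetric]) simp
  also have "\<dots> \<le> emeasure lborel Z"
  proof (intro SUP_least)
    fix K L assume "K \<in> ?C X" "L \<in> ?C Y"
    then show "emeasure lborel K + emeasure lborel L \<le> emeasure lborel Z"
      using Z sum by (intro emeasure_sum_ge_compact) auto
  qed
  finally show ?thesis .
qed

section \<open>The layer-cake formula in relative heights\<close>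

lemma measurable_superlevel:
  assumes "sigma_finite_measure M" and f[measurable]: "f \<in> borel_measurable M"
  shows "(\<lambda>t. emeasure M {x \<in> space M. ennreal (t * m) \<le> f x}) \<in> borel_measurable lborel"
proof -
  interpret sigma_finite_measure M by fact
  have "(\<lambda>t. emeasure M {x \<in> space M. ennreal (t * m) \<le> f x})
      = (\<lambda>t. \<integral>\<^sup>+x. indicator {x \<in> space M. ennreal (t * m) \<le> f x} x \<partial>M)" by simp
  also have "\<dots> = (\<lambda>t. \<integral>\<^sup>+x. (if ennreal (t * m) \<le> f x then 1 else 0) \<partial>M)"
    by (intro ext nn_integral_cong) (auto simp: indicator_def)
  also have "\<dots> \<in> borel_measurable lborel" by measurable
  finally show ?thesis .
qed

text \<open>Heights are measured as fractions \<open>t\<close> of the bound \<open>m\<close>.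
  Functions with different bounds can then be compared at the same relative height, which is what
  both applications below need.\<close>

lemma nn_integral_layer_cake:
  assumes "sigma_finite_measure M" and f[measurable]: "f \<in> borel_measurable M"
    and le: "\<And>x. x \<in> space M \<Longrightarrow> f x \<le> ennreal m" and m: "0 < m"
  shows "(\<integral>\<^sup>+x. f x \<partial>M) = ennreal m *
     (\<integral>\<^sup>+t\<in>{0<..<1}. emeasure M {x \<in> space M. ennreal (t * m) \<le> f x} \<partial>lborel)"
proof -
  interpret sigma_finite_measure M by fact
  interpret pair_sigma_finite M lborel ..
  define k where "k x t = (if 0 < t \<and> t < 1 \<and> ennreal (t * m) \<le> f x then 1 else 0 :: ennreal)" for x t
  have k_meas[measurable]: "case_prod k \<in> borel_measurable (M \<Otimes>\<^sub>M lborel)"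
    unfolding k_def by measurable
  have "f x = ennreal m * (\<integral>\<^sup>+t. k x t \<partial>lborel)" if x: "x \<in> space M" for x
  proof -
    obtain c where c: "f x = ennreal c" "0 \<le> c" "c \<le> m"
      using le[OF x] m by (cases "f x") (auto simp: top_unique)
    have "(\<integral>\<^sup>+t. k x t \<partial>lborel) = (\<integral>\<^sup>+t. indicator ({0<..c/m} \<inter> {..<1}) t \<partial>lborel)"
      using c m by (intro nn_integral_cong) (auto simp: k_def indicator_def field_simps ennreal_le_iff)
    also have "\<dots> = emeasure lborel ({0<..c/m} \<inter> {..<1})" by simp
    also have "\<dots> = ennreal (c/m)"
    proof (cases "c = m")
      case True
      then have "{0<..c/m} \<inter> {..<1} = {0<..<1::real}" using m by auto
      then show ?thesis using True m by simp
    next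
      case False
      then have "c / m < 1" using c m by simp
      then have "{0<..c/m} \<inter> {..<1} = {0<..c/m}" by auto
      then show ?thesis using c m by simp
    qed
    finally show ?thesis using c m by (simp flip: ennreal_mult)
  qed
  then have "(\<integral>\<^sup>+x. f x \<partial>M) = (\<integral>\<^sup>+x. ennreal m * (\<integral>\<^sup>+t. k x t \<partial>lborel) \<partial>M)"
    by (intro nn_integral_cong) auto
  also have "\<dots> = ennreal m * (\<integral>\<^sup>+x. (\<integral>\<^sup>+t. k x t \<partial>lborel) \<partial>M)"
    by (intro nn_integral_cmult) measurable
  also have "(\<integral>\<^sup>+x. (\<integral>\<^sup>+t. k x t \<partial>lborel) \<partial>M) = (\<integral>\<^sup>+t. (\<integral>\<^sup>+x. k x t \<partial>M) \<partial>lborel)"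
    by (rule Fubini'[symmetric]) measurable
  also have "\<dots> = (\<integral>\<^sup>+t\<in>{0<..<1}. emeasure M {x \<in> space M. ennreal (t * m) \<le> f x} \<partial>lborel)"
  proof (intro nn_integral_cong)
    fix t
    have "(\<integral>\<^sup>+x. k x t \<partial>M)
       = (\<integral>\<^sup>+x. indicator {x \<in> space M. ennreal (t * m) \<le> f x} x * indicator {0<..<1} t \<partial>M)"
      by (intro nn_integral_cong) (auto simp: k_def)
    then show "(\<integral>\<^sup>+x. k x t \<partial>M) = emeasure M {x \<in> space M. ennreal (t * m) \<le> f x} * indicator {0<..<1} t"
      by (simp add: nn_integral_multc)
  qed
  finally show ?thesis .
qed

text \<open>Truncating \<open>f\<close> at \<open>m\<close> keeps every superlevel set below height
  \<open>m\<close> and only lowers the integral.\<close>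

lemma nn_integral_layer_cake_ge:
  assumes "sigma_finite_measure M" and f[measurable]: "f \<in> borel_measurable M" and m: "0 < m"
  shows "ennreal m * (\<integral>\<^sup>+t\<in>{0<..<1}. emeasure M {x \<in> space M. ennreal (t * m) \<le> f x} \<partial>lborel)
     \<le> (\<integral>\<^sup>+x. f x \<partial>M)"
proof -
  have eq: "ennreal (t * m) \<le> min (f x) (ennreal m) \<longleftrightarrow> ennreal (t * m) \<le> f x" if "0 < t" "t < 1" for t x
  proof -
    have "ennreal (t * m) \<le> ennreal m" using that m by (intro ennreal_leI) auto
    then show ?thesis by simp
  qed
  have "ennreal m * (\<integral>\<^sup>+t\<in>{0<..<1}. emeasure M {x \<in> space M. ennreal (t * m) \<le> f x} \<partial>lborel)
     = ennreal m * (\<integral>\<^sup>+t\<in>{0<..<1}. emeasure M {x \<in> space M. ennreal (t * m) \<le> min (f x) (ennreal m)} \<partial>lborel)"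
    by (intro arg_cong[where f="\<lambda>x. ennreal m * x"] nn_integral_cong)
       (auto simp: indicator_def eq simp del: min.bounded_iff)
  also have "\<dots> = (\<integral>\<^sup>+x. min (f x) (ennreal m) \<partial>M)"
    by (rule nn_integral_layer_cake[symmetric]) (use assms in auto)
  also have "\<dots> \<le> (\<integral>\<^sup>+x. f x \<partial>M)" by (intro nn_integral_mono) auto
  finally show ?thesis .
qed

abbreviation superlevel :: "(real \<Rightarrow> ennreal) \<Rightarrow> real \<Rightarrow> real set" where
  "superlevel f t \<equiv> {x. ennreal t \<le> f x}"

text \<open>At each relative height the superlevel sets satisfy the one-dimensional sum inequality;
  integrating over the height gives the bound, and the factors \<open>m / a\<close> and
  \<open>m / b\<close> undo the normalisations. If the integrals agree and are finite, the
  nonnegative defect has integral zero and vanishes for almost every height. The lemma serves both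
  Prekopa--Leindler and Bonnesen, with different values of \<open>m\<close>.\<close>

lemma superlevel_sum:
  fixes f g h :: "real \<Rightarrow> ennreal"
  assumes [measurable]: "f \<in> borel_measurable borel" "g \<in> borel_measurable borel" "h \<in> borel_measurable borel"
    and pos: "0 < a" "0 < b" "0 < m"
    and le: "\<And>x. f x \<le> ennreal a" "\<And>x. g x \<le> ennreal b"
    and ne: "\<And>t. 0 < t \<Longrightarrow> t < 1 \<Longrightarrow> superlevel f (t * a) \<noteq> {}"
      "\<And>t. 0 < t \<Longrightarrow> t < 1 \<Longrightarrow> superlevel g (t * b) \<noteq> {}"
    and sum: "\<And>t x y. 0 < t \<Longrightarrow> t < 1 \<Longrightarrow> ennreal (t * a) \<le> f x \<Longrightarrow> ennreal (t * b) \<le> g y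
       \<Longrightarrow> ennreal (t * m) \<le> h (x + y)"
  shows superlevel_sum_integral:
     "ennreal (m / a) * (\<integral>\<^sup>+x. f x \<partial>lborel) + ennreal (m / b) * (\<integral>\<^sup>+x. g x \<partial>lborel) \<le> (\<integral>\<^sup>+x. h x \<partial>lborel)"
    and superlevel_sum_equality:
     "\<lbrakk>(\<integral>\<^sup>+x. h x \<partial>lborel) \<le> ennreal (m / a) * (\<integral>\<^sup>+x. f x \<partial>lborel) + ennreal (m / b) * (\<integral>\<^sup>+x. g x \<partial>lborel);
       (\<integral>\<^sup>+x. h x \<partial>lborel) < \<infinity>\<rbrakk>
      \<Longrightarrow> AE t in lborel. 0 < t \<longrightarrow> t < 1 \<longrightarrow> emeasure lborel (superlevel h (t * m))
           = emeasure lborel (superlevel f (t * a)) + emeasure lborel (superlevel g (t * b))"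
proof -
  let ?F = "\<lambda>t. emeasure lborel (superlevel f (t * a))"
  let ?G = "\<lambda>t. emeasure lborel (superlevel g (t * b))"
  let ?H = "\<lambda>t. emeasure lborel (superlevel h (t * m))"
  note [measurable] = measurable_superlevel[OF sigma_finite_lborel, of _ a, simplified]
    measurable_superlevel[OF sigma_finite_lborel, of _ b, simplified]
    measurable_superlevel[OF sigma_finite_lborel, of _ m, simplified]
  have fe: "(\<integral>\<^sup>+x. f x \<partial>lborel) = ennreal a * (\<integral>\<^sup>+t\<in>{0<..<1}. ?F t \<partial>lborel)"
    using nn_integral_layer_cake[OF sigma_finite_lborel, of f a] le pos by simp
  have ge: "(\<integral>\<^sup>+x. g x \<partial>lborel) = ennreal b * (\<integral>\<^sup>+t\<in>{0<..<1}. ?G t \<partial>lborel)"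
    using nn_integral_layer_cake[OF sigma_finite_lborel, of g b] le pos by simp
  have he: "ennreal m * (\<integral>\<^sup>+t\<in>{0<..<1}. ?H t \<partial>lborel) \<le> (\<integral>\<^sup>+x. h x \<partial>lborel)"
    using nn_integral_layer_cake_ge[OF sigma_finite_lborel, of h m] pos by simp
  have pt: "?F t + ?G t \<le> ?H t" if t: "0 < t" "t < 1" for t
    by (rule emeasure_sum_ge) (use ne[OF t] sum[OF t] in auto)
  have "ennreal (m / a) * (\<integral>\<^sup>+x. f x \<partial>lborel) = ennreal m * (\<integral>\<^sup>+t\<in>{0<..<1}. ?F t \<partial>lborel)"
    unfolding fe using pos by (simp flip: mult.assoc ennreal_mult)
  moreover have "ennreal (m / b) * (\<integral>\<^sup>+x. g x \<partial>lborel) = ennreal m * (\<integral>\<^sup>+t\<in>{0<..<1}. ?G t \<partial>lborel)"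
    unfolding ge using pos by (simp flip: mult.assoc ennreal_mult)
  ultimately have eq: "ennreal (m / a) * (\<integral>\<^sup>+x. f x \<partial>lborel) + ennreal (m / b) * (\<integral>\<^sup>+x. g x \<partial>lborel)
    = ennreal m * (\<integral>\<^sup>+t\<in>{0<..<1}. (?F t + ?G t) \<partial>lborel)"
    by (simp add: distrib_left distrib_right nn_integral_add)
  have mono: "(\<integral>\<^sup>+t\<in>{0<..<1}. (?F t + ?G t) \<partial>lborel) \<le> (\<integral>\<^sup>+t\<in>{0<..<1}. ?H t \<partial>lborel)"
    using pt by (intro nn_integral_mono) (auto simp: indicator_def)
  show "ennreal (m / a) * (\<integral>\<^sup>+x. f x \<partial>lborel) + ennreal (m / b) * (\<integral>\<^sup>+x. g x \<partial>lborel) \<le> (\<integral>\<^sup>+x. h x \<partial>lborel)"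
    unfolding eq by (rule order_trans[OF mult_left_mono[OF mono zero_le] he])
  assume up: "(\<integral>\<^sup>+x. h x \<partial>lborel) \<le> ennreal (m / a) * (\<integral>\<^sup>+x. f x \<partial>lborel) + ennreal (m / b) * (\<integral>\<^sup>+x. g x \<partial>lborel)"
    and fin: "(\<integral>\<^sup>+x. h x \<partial>lborel) < \<infinity>"
  have "ennreal m * (\<integral>\<^sup>+t\<in>{0<..<1}. ?H t \<partial>lborel) \<le> ennreal m * (\<integral>\<^sup>+t\<in>{0<..<1}. (?F t + ?G t) \<partial>lborel)"
    by (rule order_trans[OF he]) (use up eq in simp)
  then have HFG: "(\<integral>\<^sup>+t\<in>{0<..<1}. ?H t \<partial>lborel) \<le> (\<integral>\<^sup>+t\<in>{0<..<1}. (?F t + ?G t) \<partial>lborel)"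
    using ennreal_mult_le_mult_iff[of "ennreal m"] pos by simp
  have Hfin: "(\<integral>\<^sup>+t\<in>{0<..<1}. ?H t \<partial>lborel) < \<infinity>"
  proof (rule ccontr)
    assume "\<not> ?thesis"
    then have "(\<integral>\<^sup>+t\<in>{0<..<1}. ?H t \<partial>lborel) = top" by (simp add: less_top[symmetric])
    then have "ennreal m * top \<le> (\<integral>\<^sup>+x. h x \<partial>lborel)" using he by simp
    then show False using fin pos by (simp add: ennreal_mult_top top_unique)
  qed
  have "(\<integral>\<^sup>+t. (?H t * indicator {0<..<1} t - (?F t + ?G t) * indicator {0<..<1} t) \<partial>lborel)
     = (\<integral>\<^sup>+t\<in>{0<..<1}. ?H t \<partial>lborel) - (\<integral>\<^sup>+t\<in>{0<..<1}. (?F t + ?G t) \<partial>lborel)"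
  proof (rule nn_integral_diff)
    show "(\<integral>\<^sup>+t\<in>{0<..<1}. (?F t + ?G t) \<partial>lborel) \<noteq> \<infinity>"
      using order_le_less_trans[OF mono Hfin] by simp
    show "AE t in lborel. (?F t + ?G t) * indicator {0<..<1} t \<le> ?H t * indicator {0<..<1} t"
      using pt by (intro AE_I2) (auto simp: indicator_def)
  qed measurable
  also have "\<dots> = 0" using diff_eq_0_ennreal[OF _ HFG] Hfin by simp
  finally have "AE t in lborel. ?H t * indicator {0<..<1} t - (?F t + ?G t) * indicator {0<..<1} t = 0"
    by (subst (asm) nn_integral_0_iff_AE) auto
  moreover have "AE t in lborel. ?H t * indicator {0<..<1} t \<noteq> \<infinity>"
    by (rule nn_integral_PInf_AE) (use Hfin in auto)
  ultimately show "AE t in lborel. 0 < t \<longrightarrow> t < 1 \<longrightarrow> ?H t = ?F t + ?G t"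
  proof eventually_elim
    case (elim t)
    show ?case
    proof (intro impI)
      assume t: "0 < t" "t < 1"
      then have "?H t - (?F t + ?G t) = 0" "?H t \<noteq> \<infinity>" using elim by auto
      then have "?H t \<le> ?F t + ?G t" by (simp add: diff_eq_0_iff_ennreal)
      then show "?H t = ?F t + ?G t" using pt[OF t] by (rule antisym)
    qed
  qed
qed

section \<open>The Prekopa--Leindler inequality\<close>

text \<open>Truncation makes suprema finite, so that relative heights make sense; a strict lower
  bound for the integral survives some truncation level.\<close>

lemma nn_integral_truncated_less:
  fixes f :: "'a \<Rightarrow> ennreal"
  assumes [measurable]: "f \<in> borel_measurable M" and c: "c < (\<integral>\<^sup>+x. f x \<partial>M)"
  obtains N :: nat where "c < (\<integral>\<^sup>+x. min (f x) (of_nat N) \<partial>M)"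
proof -
  have "f x = (SUP N. min (f x) (of_nat N))" for x
  proof -
    have "(SUP N. inf (f x) (of_nat N)) = inf (f x) (SUP N::nat. of_nat N)"
      by (rule inf_SUP[symmetric])
    also have "\<dots> = f x" by (simp add: ennreal_SUP_of_nat_eq_top)
    finally show ?thesis by (simp add: inf_min)
  qed
  then have "(\<integral>\<^sup>+x. f x \<partial>M) = (\<integral>\<^sup>+x. (SUP N. min (f x) (of_nat N)) \<partial>M)" by simp
  also have "\<dots> = (SUP N. \<integral>\<^sup>+x. min (f x) (of_nat N) \<partial>M)"
    by (rule nn_integral_monotone_convergence_SUP)
       (auto simp: incseq_def le_fun_def min_le_iff_disj intro: min.mono)
  finally show thesis using c that by (auto simp: less_SUP_iff)
qed

text \<open>Weighted AM-GM for \<open>a / c\<close> and \<open>b / d\<close>. It turns the additive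
  bound of the layer-cake argument into a multiplicative one.\<close>

lemma powr_weighted_le:
  fixes a b c d l :: real
  assumes "0 < a" "0 < b" "0 < c" "0 < d" "0 < l" "l < 1"
  shows "a powr (1 - l) * b powr l \<le> c powr (1 - l) * d powr l * ((1 - l) * (a / c) + l * (b / d))"
proof -
  have "(a / c) powr (1 - l) * (b / d) powr l \<le> (1 - l) * (a / c) + l * (b / d)"
    using assms by (intro Youngs_inequality_0) auto
  then have "c powr (1 - l) * d powr l * ((a / c) powr (1 - l) * (b / d) powr l)
     \<le> c powr (1 - l) * d powr l * ((1 - l) * (a / c) + l * (b / d))"
    using assms by (intro mult_left_mono) auto
  moreover have "c powr (1 - l) * d powr l * ((a / c) powr (1 - l) * (b / d) powr l)
      = a powr (1 - l) * b powr l"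
    using assms by (simp add: powr_divide)
  ultimately show ?thesis by simp
qed

text \<open>The relation \<open>u\<^sup>1\<^sup>-\<^sup>l v\<^sup>l \<le> w\<close>, phrased through real lower bounds because there are no real powers on
  \<^typ>\<open>ennreal\<close>.\<close>

definition PL_dominates :: "real \<Rightarrow> ennreal \<Rightarrow> ennreal \<Rightarrow> ennreal \<Rightarrow> bool" where
  "PL_dominates l u v w \<longleftrightarrow> (\<forall>a>0. \<forall>b>0. ennreal a < u \<longrightarrow> ennreal b < v \<longrightarrow>
     ennreal (a powr (1 - l) * b powr l) \<le> w)"

lemma nn_integral_real_rescale:
  fixes f :: "real \<Rightarrow> ennreal"
  assumes [measurable]: "f \<in> borel_measurable borel" and c: "0 < c"
  shows "(\<integral>\<^sup>+x. f (x / c) \<partial>lborel) = ennreal c * (\<integral>\<^sup>+x. f x \<partial>lborel)"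
  using nn_integral_real_affine[of "\<lambda>x. f (x / c)" c 0] c by simp

lemma ennreal_le_of_dense:
  assumes t: "0 < t" and c: "0 \<le> c" and le: "\<And>s. 0 < s \<Longrightarrow> s < t \<Longrightarrow> ennreal (s * c) \<le> z"
  shows "ennreal (t * c) \<le> z"
proof (cases z)
  case (real r)
  have "t * c \<le> r"
  proof (rule field_le_mult_one_interval)
    fix x :: real assume "0 < x" "x < 1"
    then show "x * (t * c) \<le> r"
      using le[of "x * t"] t c real by (simp add: ennreal_le_iff mult.assoc)
  qed
  then show ?thesis using real by (simp add: ennreal_leI)
qed simp

lemma Prekopa_Leindler_real:
  fixes f g h :: "real \<Rightarrow> ennreal"
  assumes [measurable]: "f \<in> borel_measurable borel" "g \<in> borel_measurable borel" "h \<in> borel_measurable borel"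
    and l: "0 < l" "l < 1"
    and dom: "\<And>x y. PL_dominates l (f x) (g y) (h ((1 - l) * x + l * y))"
  shows "PL_dominates l (\<integral>\<^sup>+x. f x \<partial>lborel) (\<integral>\<^sup>+x. g x \<partial>lborel) (\<integral>\<^sup>+x. h x \<partial>lborel)"
  unfolding PL_dominates_def
proof (intro allI impI)
  fix a b :: real
  assume ab: "0 < a" "0 < b" and less: "ennreal a < (\<integral>\<^sup>+x. f x \<partial>lborel)" "ennreal b < (\<integral>\<^sup>+x. g x \<partial>lborel)"
  obtain N1 :: nat where N1: "ennreal a < (\<integral>\<^sup>+x. min (f x) (of_nat N1) \<partial>lborel)"
    using nn_integral_truncated_less[OF _ less(1)] by auto
  obtain N2 :: nat where N2: "ennreal b < (\<integral>\<^sup>+x. min (g x) (of_nat N2) \<partial>lborel)"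
    using nn_integral_truncated_less[OF _ less(2)] by auto
  \<comment> \<open>The constant is the supremum of the truncated function: finite by truncation,
    positive since the integral is, and approached by values of the function.\<close>
  have top_bound: "\<exists>c>0. (\<forall>x. k x \<le> ennreal c) \<and> (\<forall>t. 0 < t \<longrightarrow> t < 1 \<longrightarrow> (\<exists>x. ennreal (t * c) \<le> k x))"
    if k: "\<And>x. k x \<le> of_nat N" and d: "0 < d" "ennreal d < (\<integral>\<^sup>+x. k x \<partial>lborel)" for k :: "real \<Rightarrow> ennreal" and N d
  proof -
    define s where "s = (SUP x. k x)"
    have "s \<le> of_nat N" unfolding s_def using k by (intro SUP_least)
    then obtain c where c: "s = ennreal c" "0 \<le> c"
      by (metis ennreal_cases infinity_ennreal_def ennreal_of_nat_eq_real_of_nat ennreal_less_top top_unique less_irrefl)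
    have "c \<noteq> 0"
    proof
      assume "c = 0"
      then have "k x = 0" for x using c unfolding s_def by (metis SUP_upper UNIV_I ennreal_0 le_zero_eq)
      then show False using d by simp
    qed
    then have "0 < c" using c by simp
    moreover have "k x \<le> ennreal c" for x using c unfolding s_def by (metis SUP_upper UNIV_I)
    moreover have "\<exists>x. ennreal (t * c) \<le> k x" if t: "0 < t" "t < 1" for t
    proof -
      have "ennreal (t * c) < s" using c \<open>0 < c\<close> t by (simp add: ennreal_less_iff)
      then show ?thesis unfolding s_def by (auto simp: less_SUP_iff intro: less_imp_le)
    qed
    ultimately show ?thesis by blast
  qed
  let ?f = "\<lambda>x. min (f x) (of_nat N1)" and ?g = "\<lambda>x. min (g x) (of_nat N2)"
  obtain A where A: "A > 0" "\<And>x. ?f x \<le> ennreal A" "\<And>t. 0 < t \<Longrightarrow> t < 1 \<Longrightarrow> \<exists>x. ennreal (t * A) \<le> ?f x"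
    using top_bound[of ?f N1 a] N1 ab by auto
  obtain B where B: "B > 0" "\<And>x. ?g x \<le> ennreal B" "\<And>t. 0 < t \<Longrightarrow> t < 1 \<Longrightarrow> \<exists>x. ennreal (t * B) \<le> ?g x"
    using top_bound[of ?g N2 b] N2 ab by auto
  \<comment> \<open>The geometric mean of the two suprema: values \<open>s * A\<close> and
    \<open>s * B\<close> combine to exactly \<open>s * m\<close>.\<close>
  define m where "m = A powr (1 - l) * B powr l"
  have m: "0 < m" using A B by (simp add: m_def)
  \<comment> \<open>Rescaling the arguments by \<open>1 - l\<close> and \<open>l\<close> turns the
    convex combination in the hypothesis into a plain sum.\<close>
  have "ennreal (m / A) * (\<integral>\<^sup>+x. ?f (x / (1 - l)) \<partial>lborel) + ennreal (m / B) * (\<integral>\<^sup>+x. ?g (x / l) \<partial>lborel)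
     \<le> (\<integral>\<^sup>+x. h x \<partial>lborel)"
  proof (rule superlevel_sum_integral)
    fix t :: real assume t: "0 < t" "t < 1"
    obtain x where "ennreal (t * A) \<le> ?f x" using A t by blast
    then have "(1 - l) * x \<in> superlevel (\<lambda>x. ?f (x / (1 - l))) (t * A)" using l by simp
    then show "superlevel (\<lambda>x. ?f (x / (1 - l))) (t * A) \<noteq> {}" by blast
    obtain x where "ennreal (t * B) \<le> ?g x" using B t by blast
    then have "l * x \<in> superlevel (\<lambda>x. ?g (x / l)) (t * B)" using l by simp
    then show "superlevel (\<lambda>x. ?g (x / l)) (t * B) \<noteq> {}" by blast
    fix x y assume x: "ennreal (t * A) \<le> ?f (x / (1 - l))" and y: "ennreal (t * B) \<le> ?g (y / l)"
    show "ennreal (t * m) \<le> h (x + y)"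
    \<comment> \<open>\<open>PL_dominates\<close> only sees strict lower bounds, whereas superlevel
      sets are defined by weak ones; heights \<open>s < t\<close> bridge the difference.\<close>
    proof (rule ennreal_le_of_dense)
      fix s assume s: "0 < s" "s < t"
      have "ennreal (s * A) < ennreal (t * A)" "ennreal (s * B) < ennreal (t * B)"
        using s A(1) B(1) by (auto simp: ennreal_less_iff)
      then have "ennreal (s * A) < f (x / (1 - l))" "ennreal (s * B) < g (y / l)"
        using x y by (auto simp: min_le_iff_disj intro: order.strict_trans2)
      then have "ennreal ((s * A) powr (1 - l) * (s * B) powr l) \<le> h ((1 - l) * (x / (1 - l)) + l * (y / l))"
        using dom[of "x / (1 - l)" "y / l"] s A(1) B(1) by (simp add: PL_dominates_def)
      moreover have "(s * A) powr (1 - l) * (s * B) powr l = s * m"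
      proof -
        have "(s * A) powr (1 - l) * (s * B) powr l = s powr (1 - l) * s powr l * m"
          using s A(1) B(1) by (simp add: powr_mult m_def)
        also have "s powr (1 - l) * s powr l = s" using s by (simp flip: powr_add)
        finally show ?thesis .
      qed
      ultimately show "ennreal (s * m) \<le> h (x + y)" using l by simp
    qed (use t m in auto)
  qed (use A B m in auto)
  moreover have "(\<integral>\<^sup>+x. ?f (x / (1 - l)) \<partial>lborel) = ennreal (1 - l) * (\<integral>\<^sup>+x. ?f x \<partial>lborel)"
    using l by (intro nn_integral_real_rescale) auto
  moreover have "(\<integral>\<^sup>+x. ?g (x / l) \<partial>lborel) = ennreal l * (\<integral>\<^sup>+x. ?g x \<partial>lborel)"
    using l by (intro nn_integral_real_rescale) auto
  moreover have "ennreal (m / A) * (ennreal (1 - l) * ennreal a) + ennreal (m / B) * (ennreal l * ennreal b)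
     \<le> ennreal (m / A) * (ennreal (1 - l) * (\<integral>\<^sup>+x. ?f x \<partial>lborel)) + ennreal (m / B) * (ennreal l * (\<integral>\<^sup>+x. ?g x \<partial>lborel))"
    using N1 N2 by (intro add_mono mult_left_mono) auto
  moreover have "ennreal (m / A) * (ennreal (1 - l) * ennreal a) + ennreal (m / B) * (ennreal l * ennreal b)
     = ennreal (m * ((1 - l) * (a / A) + l * (b / B)))"
  proof -
    have "ennreal (m / A) * (ennreal (1 - l) * ennreal a) + ennreal (m / B) * (ennreal l * ennreal b)
       = ennreal (m / A * ((1 - l) * a) + m / B * (l * b))"
      using m A(1) B(1) l ab
      by (subst ennreal_plus) (auto simp: ennreal_mult simp del: times_divide_eq_left times_divide_eq_right)
    also have "m / A * ((1 - l) * a) + m / B * (l * b) = m * ((1 - l) * (a / A) + l * (b / B))"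
      by (simp add: distrib_left)
    finally show ?thesis .
  qed
  moreover have "a powr (1 - l) * b powr l \<le> m * ((1 - l) * (a / A) + l * (b / B))"
    unfolding m_def using ab A B l by (intro powr_weighted_le) auto
  ultimately show "ennreal (a powr (1 - l) * b powr l) \<le> (\<integral>\<^sup>+x. h x \<partial>lborel)"
    by (metis (no_types, lifting) ennreal_leI order_trans)
qed

text \<open>Tensorisation: integrating out one coordinate keeps the relation
  \<open>PL_dominates\<close> between the resulting functions of the other coordinates, so the
  one-dimensional case is all that the induction step needs. The arguments are confined to
  \<open>extensional I\<close>, the carrier of the product space.\<close>

lemma Prekopa_Leindler_PiM:
  fixes f g h :: "('i \<Rightarrow> real) \<Rightarrow> ennreal"
  assumes "finite I" and l: "0 < l" "l < 1"
    and "f \<in> borel_measurable (Pi\<^sub>M I (\<lambda>_. lborel))" "g \<in> borel_measurable (Pi\<^sub>M I (\<lambda>_. lborel))"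
      "h \<in> borel_measurable (Pi\<^sub>M I (\<lambda>_. lborel))"
    and "\<And>x y. x \<in> extensional I \<Longrightarrow> y \<in> extensional I \<Longrightarrow>
       PL_dominates l (f x) (g y) (h (\<lambda>i\<in>I. (1 - l) * x i + l * y i))"
  shows "PL_dominates l (\<integral>\<^sup>+x. f x \<partial>Pi\<^sub>M I (\<lambda>_. lborel)) (\<integral>\<^sup>+x. g x \<partial>Pi\<^sub>M I (\<lambda>_. lborel))
     (\<integral>\<^sup>+x. h x \<partial>Pi\<^sub>M I (\<lambda>_. lborel))"
  using assms(1,4-)
proof (induction I arbitrary: f g h rule: finite_induct)
  case empty
  interpret product_sigma_finite "\<lambda>_::'i. lborel :: real measure" ..
  show ?case
    using empty(4)[of "\<lambda>_. undefined" "\<lambda>_. undefined"]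
    by (simp add: nn_integral_empty restrict_def)
next
  case (insert i I)
  interpret product_sigma_finite "\<lambda>_::'i. lborel :: real measure" ..
  note [measurable] = insert.prems(1-3)
  let ?M = "Pi\<^sub>M I (\<lambda>_. lborel :: real measure)"
  have upd: "(\<lambda>(x, y). k (x(i := y))) \<in> borel_measurable (?M \<Otimes>\<^sub>M lborel)"
    if [measurable]: "k \<in> borel_measurable (Pi\<^sub>M (insert i I) (\<lambda>_. lborel :: real measure))" for k :: "('i \<Rightarrow> real) \<Rightarrow> ennreal"
    by measurable
  have upd1: "(\<lambda>y. k (x(i := y))) \<in> borel_measurable borel"
    if k: "k \<in> borel_measurable (Pi\<^sub>M (insert i I) (\<lambda>_. lborel :: real measure))" and x: "x \<in> extensional I"
    for k :: "('i \<Rightarrow> real) \<Rightarrow> ennreal" and x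
    using measurable_Pair2[OF upd[OF k], of x] x by (simp add: space_PiM PiE_def)
  have int: "(\<integral>\<^sup>+x. k x \<partial>Pi\<^sub>M (insert i I) (\<lambda>_. lborel)) = (\<integral>\<^sup>+x. (\<integral>\<^sup>+y. k (x(i := y)) \<partial>lborel) \<partial>?M)"
    if "k \<in> borel_measurable (Pi\<^sub>M (insert i I) (\<lambda>_. lborel :: real measure))" for k :: "('i \<Rightarrow> real) \<Rightarrow> ennreal"
    using product_nn_integral_insert[OF insert.hyps that] .
  have meas: "(\<lambda>x. \<integral>\<^sup>+y. k (x(i := y)) \<partial>lborel) \<in> borel_measurable ?M"
    if "k \<in> borel_measurable (Pi\<^sub>M (insert i I) (\<lambda>_. lborel :: real measure))" for k :: "('i \<Rightarrow> real) \<Rightarrow> ennreal"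
    using lborel.borel_measurable_nn_integral[OF upd[OF that]] .
  show ?case
    unfolding int[OF insert.prems(1)] int[OF insert.prems(2)] int[OF insert.prems(3)]
  proof (rule insert.IH)
    fix x y :: "'i \<Rightarrow> real" assume xy: "x \<in> extensional I" "y \<in> extensional I"
    let ?z = "\<lambda>i\<in>I. (1 - l) * x i + l * y i"
    show "PL_dominates l (\<integral>\<^sup>+ s. f (x(i := s)) \<partial>lborel) (\<integral>\<^sup>+ s. g (y(i := s)) \<partial>lborel) (\<integral>\<^sup>+ s. h (?z(i := s)) \<partial>lborel)"
    proof (rule Prekopa_Leindler_real[OF _ _ _ l])
      fix s t :: real
      have "(\<lambda>j\<in>insert i I. (1 - l) * (x(i := s)) j + l * (y(i := t)) j) = ?z(i := (1 - l) * s + l * t)"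
        using insert.hyps by (auto simp: restrict_def fun_eq_iff)
      moreover have "x(i := s) \<in> extensional (insert i I)" "y(i := t) \<in> extensional (insert i I)"
        using xy by (auto simp: extensional_def)
      ultimately show "PL_dominates l (f (x(i := s))) (g (y(i := t))) (h (?z(i := (1 - l) * s + l * t)))"
        using insert.prems(4) by metis
    qed (auto intro!: upd1 insert.prems xy)
  qed (fact meas[OF insert.prems(1)] meas[OF insert.prems(2)] meas[OF insert.prems(3)])+
qed

lemma emeasure_lborel_compact:
  "compact (S :: 'a::euclidean_space set) \<Longrightarrow> emeasure lborel S = ennreal (measure lborel S)"
  using emeasure_compact_finite[of S] by (simp add: emeasure_eq_ennreal_measure)

text \<open>Prekopa--Leindler for the three indicator functions.\<close>

lemma Brunn_Minkowski_multiplicative: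
  fixes A B C :: "'a::euclidean_space set"
  assumes A: "compact A" and B: "compact B" and C: "compact C"
    and pos: "0 < measure lborel A" "0 < measure lborel B" and l: "0 < l" "l < 1"
    and sub: "\<And>x y. x \<in> A \<Longrightarrow> y \<in> B \<Longrightarrow> (1 - l) *\<^sub>R x + l *\<^sub>R y \<in> C"
  shows "measure lborel A powr (1 - l) * measure lborel B powr l \<le> measure lborel C"
proof -
  let ?P = "Pi\<^sub>M Basis (\<lambda>_::'a. lborel :: real measure)" and ?e = "\<lambda>f. \<Sum>b\<in>Basis. f b *\<^sub>R b :: 'a"
  have [measurable]: "?e \<in> measurable ?P borel" by measurable
  have em: "emeasure lborel S = (\<integral>\<^sup>+x. indicator S (?e x) \<partial>?P)" if S[measurable]: "S \<in> sets borel" for S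
  proof -
    have "emeasure lborel S = (\<integral>\<^sup>+x. indicator S x \<partial>lborel)" using S by simp
    also have "\<dots> = (\<integral>\<^sup>+x. indicator S (?e x) \<partial>?P)"
      by (subst lborel_eq, subst nn_integral_distr) auto
    finally show ?thesis .
  qed
  have ABC[measurable]: "A \<in> sets borel" "B \<in> sets borel" "C \<in> sets borel"
    using A B C by (auto intro: borel_compact)
  have "PL_dominates l (emeasure lborel A) (emeasure lborel B) (emeasure lborel C)"
    unfolding em[OF ABC(1)] em[OF ABC(2)] em[OF ABC(3)]
  proof (rule Prekopa_Leindler_PiM[OF finite_Basis l])
    fix x y :: "'a \<Rightarrow> real"
    have e: "?e (\<lambda>b\<in>Basis. (1 - l) * x b + l * y b) = (1 - l) *\<^sub>R ?e x + l *\<^sub>R ?e y"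
      by (simp add: scaleR_sum_right scaleR_add_left sum.distrib)
    have "a powr (1 - l) * b powr l \<le> 1" if "0 < a" "a < 1" "0 < b" "b < 1" for a b :: real
      using that l by (intro mult_le_one powr_le1) auto
    then show "PL_dominates l (indicator A (?e x)) (indicator B (?e y))
        (indicator C (?e (\<lambda>b\<in>Basis. (1 - l) * x b + l * y b)))"
      unfolding e PL_dominates_def using sub
      by (auto simp: indicator_def ennreal_less_one_iff intro!: ennreal_leI[where y=1, simplified])
  qed auto
  then have dom: "a powr (1 - l) * b powr l \<le> measure lborel C"
    if "0 < a" "0 < b" "a < measure lborel A" "b < measure lborel B" for a b
    using that unfolding PL_dominates_def emeasure_lborel_compact[OF A] emeasure_lborel_compact[OF B]
      emeasure_lborel_compact[OF C]
    by (simp add: ennreal_less_iff)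
  let ?a = "measure lborel A" and ?b = "measure lborel B"
  \<comment> \<open>Shrinking both volumes by \<open>s < 1\<close> makes the bounds strict; since
    the exponents add up to one, exactly one factor \<open>s\<close> comes out.\<close>
  have "s * (?a powr (1 - l) * ?b powr l) \<le> measure lborel C" if s: "0 < s" "s < 1" for s
  proof -
    have "(s * ?a) powr (1 - l) * (s * ?b) powr l = s powr (1 - l) * s powr l * (?a powr (1 - l) * ?b powr l)"
      using s pos by (simp add: powr_mult)
    also have "s powr (1 - l) * s powr l = s" using s by (simp flip: powr_add)
    finally show ?thesis using dom[of "s * ?a" "s * ?b"] s pos by simp
  qed
  then show ?thesis by (rule field_le_mult_one_interval)
qed

section \<open>The Brunn--Minkowski inequality and sections\<close>

abbreviation msum :: "'a::plus set \<Rightarrow> 'a set \<Rightarrow> 'a set" where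
  "msum A B \<equiv> {x + y |x y. x \<in> A \<and> y \<in> B}"

lemma measure_lborel_affine_image:
  fixes S :: "'a::euclidean_space set"
  assumes "compact S" "m \<noteq> 0"
  shows "measure lborel ((\<lambda>x. d + m *\<^sub>R x) ` S) = \<bar>m\<bar> ^ DIM('a) * measure lborel S"
  using emeasure_lborel_affine_image(1)[of S m d] assms
  by (simp add: measure_def enn2real_mult borel_compact)

lemma measure_lborel_mono:
  fixes A B :: "'a::euclidean_space set"
  assumes "compact A" "compact B" "A \<subseteq> B"
  shows "measure lborel A \<le> measure lborel B"
  using assms by (intro measure_mono_fmeasurable) (auto simp: borel_compact fmeasurable_compact)

text \<open>Both sets are scaled to unit volume, and the weight \<open>l = b / (a + b)\<close> turns
  the convex combination of the scaled sets into the sum scaled by \<open>1 / (a + b)\<close>. If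
  one of the numbers vanishes, a translate of the other set inside \<open>C\<close>
  suffices.\<close>

theorem Brunn_Minkowski:
  fixes A B C :: "'a::euclidean_space set"
  assumes A: "compact A" "A \<noteq> {}" and B: "compact B" "B \<noteq> {}" and C: "compact C"
    and vol: "measure lborel A = a ^ DIM('a)" "measure lborel B = b ^ DIM('a)" and ab: "0 \<le> a" "0 \<le> b"
    and sub: "\<And>x y. x \<in> A \<Longrightarrow> y \<in> B \<Longrightarrow> x + y \<in> C"
  shows "(a + b) ^ DIM('a) \<le> measure lborel C"
proof -
  consider "a = 0" | "b = 0" | "0 < a" "0 < b" using ab by linarith
  then show ?thesis
  proof cases
    case 1
    obtain x where "x \<in> A" using A by blast
    then have "(\<lambda>y. x + 1 *\<^sub>R y) ` B \<subseteq> C" using sub by auto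
    then have "measure lborel ((\<lambda>y. x + 1 *\<^sub>R y) ` B) \<le> measure lborel C"
      by (intro measure_lborel_mono C compact_continuous_image B continuous_intros)
    then show ?thesis using 1 vol measure_lborel_affine_image[OF B(1), of 1 x] by simp
  next
    case 2
    obtain y where "y \<in> B" using B by blast
    then have "(\<lambda>x. y + 1 *\<^sub>R x) ` A \<subseteq> C" using sub by (auto simp: add.commute[of y])
    then have "measure lborel ((\<lambda>x. y + 1 *\<^sub>R x) ` A) \<le> measure lborel C"
      by (intro measure_lborel_mono C compact_continuous_image A continuous_intros)
    then show ?thesis using 2 vol measure_lborel_affine_image[OF A(1), of 1 y] by simp
  next
    case 3
    define l where "l = b / (a + b)"
    have l: "0 < l" "l < 1" "1 - l = a / (a + b)" using 3 by (auto simp: l_def field_simps)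
    let ?s = "\<lambda>c S. (\<lambda>x. 0 + (1 / c) *\<^sub>R x) ` S :: 'a set"
    have cpt: "compact (?s c S)" if "compact S" for c S
      by (intro compact_continuous_image that continuous_intros)
    have vol': "measure lborel (?s c S) = measure lborel S / c ^ DIM('a)" if "compact S" "0 < c" for c S
      using measure_lborel_affine_image[OF that(1), of "1 / c" 0] that by (simp add: power_divide)
    have "measure lborel (?s a A) powr (1 - l) * measure lborel (?s b B) powr l \<le> measure lborel (?s (a + b) C)"
    proof (rule Brunn_Minkowski_multiplicative[OF cpt cpt cpt _ _ l(1,2)])
      show "0 < measure lborel (?s a A)" "0 < measure lborel (?s b B)"
        using vol'[OF A(1) 3(1)] vol'[OF B(1) 3(2)] vol 3 by simp_all
      fix x y assume "x \<in> ?s a A" "y \<in> ?s b B"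
      then obtain x' y' where xy: "x' \<in> A" "y' \<in> B" "x = (1 / a) *\<^sub>R x'" "y = (1 / b) *\<^sub>R y'" by auto
      have "(1 - l) *\<^sub>R x + l *\<^sub>R y = (1 / (a + b)) *\<^sub>R (x' + y')"
        using 3 xy unfolding l(3) by (simp add: l_def scaleR_add_right)
      then show "(1 - l) *\<^sub>R x + l *\<^sub>R y \<in> ?s (a + b) C" using sub xy by auto
    qed (use A B C in auto)
    then show ?thesis
      using vol'[OF A(1) 3(1)] vol'[OF B(1) 3(2)] vol'[OF C, of "a + b"] vol 3
      by (simp add: pos_le_divide_eq)
  qed
qed

text \<open>For a fixed ratio the lower bound is linear in the volume of \<open>A\<close>, so the
  bounds for several pieces can be added. This form also admits empty and null pieces.\<close>

lemma Brunn_Minkowski_ratio: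
  fixes A B C :: "'a::euclidean_space set"
  assumes "compact A" "compact B" "compact C" "0 < r"
    and vol: "measure lborel B = r ^ DIM('a) * measure lborel A"
    and sub: "msum A B \<subseteq> C"
  shows "(1 + r) ^ DIM('a) * measure lborel A \<le> measure lborel C"
proof (cases "measure lborel A = 0 \<or> A = {} \<or> B = {}")
  case True
  then have "measure lborel A = 0"
    using vol \<open>0 < r\<close> by (cases "B = {}") auto
  then show ?thesis by simp
next
  case False
  define a where "a = root DIM('a) (measure lborel A)"
  have a: "a ^ DIM('a) = measure lborel A" "0 \<le> a"
    by (simp_all add: a_def)
  have "(a + r * a) ^ DIM('a) \<le> measure lborel C"
    by (rule Brunn_Minkowski[of A B]) (use assms False a sub in \<open>auto simp: power_mult_distrib\<close>)
  also have "a + r * a = (1 + r) * a" by (simp add: algebra_simps)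
  finally show ?thesis using a by (simp add: power_mult_distrib)
qed

text \<open>Equality in Brunn--Minkowski, written without roots: \<open>r\<close> is the quotient of
  the \<open>n\<close>-th roots of the volumes of \<open>B\<close> and \<open>A\<close>. It does not
  change when both sets are cut in equal volume proportion.\<close>

definition BM_equal :: "real \<Rightarrow> 'a::euclidean_space set \<Rightarrow> 'a set \<Rightarrow> bool" where
  "BM_equal r A B \<longleftrightarrow> compact A \<and> compact B \<and> 0 < r \<and> 0 < measure lborel A \<and>
     measure lborel B = r ^ DIM('a) * measure lborel A \<and>
     measure lborel (msum A B) = (1 + r) ^ DIM('a) * measure lborel A"

section \<open>Cutting an equality case by parallel hyperplanes\<close>

lemma hyperplane_null_sets_lborel:
  fixes u :: "'a::euclidean_space"
  assumes "u \<noteq> 0"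
  shows "{x. x \<bullet> u = s} \<in> null_sets lborel"
proof -
  have "negligible {x. u \<bullet> x = s}" using assms by (intro negligible_hyperplane) auto
  then show ?thesis
    by (simp add: inner_commute negligible_iff_null_sets null_sets_completion_iff)
qed

lemma measure_lborel_halfspaces:
  fixes u :: "'a::euclidean_space"
  assumes A: "compact A" and u: "u \<noteq> 0"
  shows "measure lborel (A \<inter> {x. x \<bullet> u \<le> s}) + measure lborel (A \<inter> {x. s \<le> x \<bullet> u}) = measure lborel A"
proof -
  let ?P = "A \<inter> {x. x \<bullet> u \<le> s}" and ?Q = "A \<inter> {x. s \<le> x \<bullet> u}"
  have c: "compact ?P" "compact ?Q"
    using A by (auto intro!: compact_Int_closed closed_Collect_le continuous_intros)
  have "measure lborel (?P \<union> ?Q) = measure lborel ?P + measure lborel ?Q"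
  proof (rule measure_Un_AE)
    show "AE x in lborel. x \<notin> ?P \<or> x \<notin> ?Q"
      using hyperplane_null_sets_lborel[OF u, of s] by (rule AE_I') auto
  qed (use c fmeasurable_compact in auto)
  moreover have "?P \<union> ?Q = A" by auto
  ultimately show ?thesis by simp
qed

text \<open>The sum of the two lower pieces lies below height \<open>s + s'\<close> and that of the
  upper pieces above it, so their volumes add up to at most the volume of the whole sum. The
  Brunn--Minkowski bounds of the two pairs already add up to that volume, hence both are
  equalities.\<close>

lemma BM_equal_halfspace:
  fixes A B :: "'a::euclidean_space set"
  assumes eq: "BM_equal r A B" and u: "u \<noteq> 0"
    and match: "measure lborel (B \<inter> {x. x \<bullet> u \<le> s'}) = r ^ DIM('a) * measure lborel (A \<inter> {x. x \<bullet> u \<le> s})"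
  shows "0 < measure lborel (A \<inter> {x. x \<bullet> u \<le> s}) \<Longrightarrow> BM_equal r (A \<inter> {x. x \<bullet> u \<le> s}) (B \<inter> {x. x \<bullet> u \<le> s'})"
    and "0 < measure lborel (A \<inter> {x. s \<le> x \<bullet> u}) \<Longrightarrow> BM_equal r (A \<inter> {x. s \<le> x \<bullet> u}) (B \<inter> {x. s' \<le> x \<bullet> u})"
    and "measure lborel (B \<inter> {x. s' \<le> x \<bullet> u}) = r ^ DIM('a) * measure lborel (A \<inter> {x. s \<le> x \<bullet> u})"
proof -
  let ?P = "A \<inter> {x. x \<bullet> u \<le> s}" and ?Q = "A \<inter> {x. s \<le> x \<bullet> u}"
  let ?P' = "B \<inter> {x. x \<bullet> u \<le> s'}" and ?Q' = "B \<inter> {x. s' \<le> x \<bullet> u}"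
  note e = eq[unfolded BM_equal_def]
  have c: "compact ?P" "compact ?Q" "compact ?P'" "compact ?Q'" "compact (msum A B)"
    using e by (auto intro!: compact_Int_closed closed_Collect_le continuous_intros compact_sums)
  have hA: "measure lborel ?P + measure lborel ?Q = measure lborel A"
    using e u by (intro measure_lborel_halfspaces) auto
  have hB: "measure lborel ?P' + measure lborel ?Q' = measure lborel B"
    using e u by (intro measure_lborel_halfspaces) auto
  have hC: "measure lborel (msum A B \<inter> {x. x \<bullet> u \<le> s + s'}) + measure lborel (msum A B \<inter> {x. s + s' \<le> x \<bullet> u})
     = measure lborel (msum A B)"
    using c u by (intro measure_lborel_halfspaces) auto
  show match': "measure lborel ?Q' = r ^ DIM('a) * measure lborel ?Q"
  proof -
    have "measure lborel ?Q' = r ^ DIM('a) * (measure lborel A - measure lborel ?P)"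
      using hB match e by (simp add: algebra_simps)
    then show ?thesis by (simp add: hA[symmetric])
  qed
  have s: "compact (msum ?P ?P')" "compact (msum ?Q ?Q')" by (rule compact_sums[OF c(1,3)], rule compact_sums[OF c(2,4)])
  have P: "(1 + r) ^ DIM('a) * measure lborel ?P \<le> measure lborel (msum ?P ?P')"
    by (rule Brunn_Minkowski_ratio) (use c s match e in auto)
  have Q: "(1 + r) ^ DIM('a) * measure lborel ?Q \<le> measure lborel (msum ?Q ?Q')"
    by (rule Brunn_Minkowski_ratio) (use c s match' e in auto)
  have P2: "measure lborel (msum ?P ?P') \<le> measure lborel (msum A B \<inter> {x. x \<bullet> u \<le> s + s'})"
    using s c by (intro measure_lborel_mono compact_Int_closed closed_Collect_le continuous_intros)
      (force simp: inner_add_left)+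
  have Q2: "measure lborel (msum ?Q ?Q') \<le> measure lborel (msum A B \<inter> {x. s + s' \<le> x \<bullet> u})"
    using s c by (intro measure_lborel_mono compact_Int_closed closed_Collect_le continuous_intros)
      (force simp: inner_add_left)+
  have "(1 + r) ^ DIM('a) * measure lborel ?P + (1 + r) ^ DIM('a) * measure lborel ?Q
     = measure lborel (msum A B)"
    using hA e by (simp flip: distrib_left)
  with P Q P2 Q2 hC
  have "measure lborel (msum ?P ?P') = (1 + r) ^ DIM('a) * measure lborel ?P"
    "measure lborel (msum ?Q ?Q') = (1 + r) ^ DIM('a) * measure lborel ?Q" by linarith+
  then show "0 < measure lborel ?P \<Longrightarrow> BM_equal r ?P ?P'" "0 < measure lborel ?Q \<Longrightarrow> BM_equal r ?Q ?Q'"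
    using c e match match' by (auto simp: BM_equal_def)
qed

lemma msum_commute: "msum A B = msum B (A :: 'a::ab_semigroup_add set)"
  by (metis (no_types, opaque_lifting) add.commute)

lemma BM_equal_sym:
  fixes A B :: "'a::euclidean_space set"
  assumes "BM_equal r A B"
  shows "BM_equal (1 / r) B A"
  using assms unfolding BM_equal_def msum_commute[of B A]
  by (auto simp: field_simps simp flip: power_mult_distrib)

text \<open>The section of \<open>A\<close> at height \<open>s\<close> is thickened along the unit vector \<open>u\<close>: its \<open>(n - 1)\<close>-dimensional
  volume becomes an \<open>n\<close>-dimensional one, and Brunn--Minkowski for sections follows from the \<open>n\<close>-dimensional
  statement.\<close>

definition cylinder :: "'a::euclidean_space \<Rightarrow> real \<Rightarrow> 'a set \<Rightarrow> real \<Rightarrow> 'a set" where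
  "cylinder u h A s = {x. 0 \<le> x \<bullet> u \<and> x \<bullet> u \<le> h \<and> x + (s - x \<bullet> u) *\<^sub>R u \<in> A}"

definition section_vol :: "'a::euclidean_space \<Rightarrow> 'a set \<Rightarrow> real \<Rightarrow> real" where
  "section_vol u A s = measure lborel (cylinder u 1 A s)"

section \<open>Fubini along a unit vector\<close>

lemma nn_integral_lborel_translate:
  fixes f :: "'a::euclidean_space \<Rightarrow> ennreal"
  assumes [measurable]: "f \<in> borel_measurable borel"
  shows "(\<integral>\<^sup>+x. f (c + x) \<partial>lborel) = (\<integral>\<^sup>+x. f x \<partial>lborel)"
  by (subst (2) lborel_distr_plus[of c, symmetric], subst nn_integral_distr) auto

lemma cylinder_borel [measurable]:
  assumes [measurable]: "W \<in> sets borel"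
  shows "cylinder u h W s \<in> sets borel"
  unfolding cylinder_def by measurable

text \<open>Fubini in direction \<open>u\<close> without a change of coordinates: after exchanging
  the integrals and translating, first in \<open>s\<close> and then in \<open>x\<close> along
  \<open>u\<close>, each point of \<open>W\<close> is weighted by the length of the interval of
  \<open>s\<close> with \<open>x \<bullet> u - s\<close> in \<open>[0, 1]\<close>, which is
  one.\<close>

lemma emeasure_eq_nn_integral_sections:
  fixes u :: "'a::euclidean_space"
  assumes u: "norm u = 1" and W[measurable]: "W \<in> sets borel"
  shows "emeasure lborel W = (\<integral>\<^sup>+s. emeasure lborel (cylinder u 1 W s) \<partial>lborel)"
    and "(\<lambda>s. emeasure lborel (cylinder u 1 W s)) \<in> borel_measurable borel"
proof -
  have uu: "u \<bullet> u = 1" using u by (simp add: dot_square_norm)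
  let ?I = "indicator {0..1} :: real \<Rightarrow> ennreal" and ?W = "indicator W :: 'a \<Rightarrow> ennreal"
  have cyl: "emeasure lborel (cylinder u 1 W s) = (\<integral>\<^sup>+x. ?I (x \<bullet> u) * ?W (x + (s - x \<bullet> u) *\<^sub>R u) \<partial>lborel)" for s
  proof -
    have "emeasure lborel (cylinder u 1 W s) = (\<integral>\<^sup>+x. indicator (cylinder u 1 W s) x \<partial>lborel)" by simp
    also have "\<dots> = (\<integral>\<^sup>+x. ?I (x \<bullet> u) * ?W (x + (s - x \<bullet> u) *\<^sub>R u) \<partial>lborel)"
      by (intro nn_integral_cong) (auto simp: cylinder_def indicator_def)
    finally show ?thesis .
  qed
  show "(\<lambda>s. emeasure lborel (cylinder u 1 W s)) \<in> borel_measurable borel"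
    unfolding cyl by measurable
  have "(\<integral>\<^sup>+s. emeasure lborel (cylinder u 1 W s) \<partial>lborel)
     = (\<integral>\<^sup>+s. (\<integral>\<^sup>+x. ?I (x \<bullet> u) * ?W (x + (s - x \<bullet> u) *\<^sub>R u) \<partial>lborel) \<partial>lborel)"
    by (simp add: cyl)
  also have "\<dots> = (\<integral>\<^sup>+x. (\<integral>\<^sup>+s. ?I (x \<bullet> u) * ?W (x + (s - x \<bullet> u) *\<^sub>R u) \<partial>lborel) \<partial>lborel)"
    by (rule lborel_pair.Fubini') measurable
  also have "\<dots> = (\<integral>\<^sup>+x. (\<integral>\<^sup>+s. ?I (x \<bullet> u) * ?W (x + s *\<^sub>R u) \<partial>lborel) \<partial>lborel)"
  proof (rule nn_integral_cong)
    fix x :: 'a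
    have "(\<integral>\<^sup>+s. ?I (x \<bullet> u) * ?W (x + s *\<^sub>R u) \<partial>lborel) 
        = (\<integral>\<^sup>+s. ?I (x \<bullet> u) * ?W (x + (- (x \<bullet> u) + s) *\<^sub>R u) \<partial>lborel)"
      by (rule nn_integral_lborel_translate[symmetric]) measurable
    then show "(\<integral>\<^sup>+s. ?I (x \<bullet> u) * ?W (x + (s - x \<bullet> u) *\<^sub>R u) \<partial>lborel) = (\<integral>\<^sup>+s. ?I (x \<bullet> u) * ?W (x + s *\<^sub>R u) \<partial>lborel)"
      by simp
  qed
  also have "\<dots> = (\<integral>\<^sup>+s. (\<integral>\<^sup>+x. ?I (x \<bullet> u) * ?W (x + s *\<^sub>R u) \<partial>lborel) \<partial>lborel)"
    by (rule lborel_pair.Fubini') measurable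
  also have "\<dots> = (\<integral>\<^sup>+s. (\<integral>\<^sup>+x. ?I (x \<bullet> u - s) * ?W x \<partial>lborel) \<partial>lborel)"
  proof (rule nn_integral_cong)
    fix s :: real
    have "(\<integral>\<^sup>+x. ?I ((s *\<^sub>R u + x) \<bullet> u - s) * ?W (s *\<^sub>R u + x) \<partial>lborel) = (\<integral>\<^sup>+x. ?I (x \<bullet> u - s) * ?W x \<partial>lborel)"
      by (rule nn_integral_lborel_translate) measurable
    then show "(\<integral>\<^sup>+x. ?I (x \<bullet> u) * ?W (x + s *\<^sub>R u) \<partial>lborel) = (\<integral>\<^sup>+x. ?I (x \<bullet> u - s) * ?W x \<partial>lborel)"
      by (simp add: inner_add_left uu add.commute)
  qed
  also have "\<dots> = (\<integral>\<^sup>+x. (\<integral>\<^sup>+s. ?I (x \<bullet> u - s) * ?W x \<partial>lborel) \<partial>lborel)"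
    by (rule lborel_pair.Fubini') measurable
  also have "\<dots> = (\<integral>\<^sup>+x. ?W x \<partial>lborel)"
  proof (rule nn_integral_cong)
    fix x :: 'a
    have "(\<integral>\<^sup>+s. ?I (x \<bullet> u - s) \<partial>lborel) = (\<integral>\<^sup>+s. indicator {x \<bullet> u - 1..x \<bullet> u} s \<partial>lborel)"
      by (intro nn_integral_cong) (auto simp: indicator_def)
    also have "\<dots> = 1" by simp
    finally show "(\<integral>\<^sup>+s. ?I (x \<bullet> u - s) * ?W x \<partial>lborel) = ?W x"
      by (simp add: nn_integral_multc)
  qed
  finally show "emeasure lborel W = (\<integral>\<^sup>+s. emeasure lborel (cylinder u 1 W s) \<partial>lborel)" by simp
qed

lemma compact_cylinder:
  fixes u :: "'a::euclidean_space"
  assumes A: "compact A" and u: "norm u = 1"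
  shows "compact (cylinder u h A s)"
proof -
  obtain K where K: "\<And>x. x \<in> A \<Longrightarrow> norm x \<le> K"
    using compact_imp_bounded[OF A] by (auto simp: bounded_iff)
  have "norm x \<le> K + \<bar>s\<bar> + \<bar>h\<bar>" if "x \<in> cylinder u h A s" for x
  proof -
    have "norm (x + (s - x \<bullet> u) *\<^sub>R u) \<le> K" "\<bar>s - x \<bullet> u\<bar> \<le> \<bar>s\<bar> + \<bar>h\<bar>"
      using that K by (auto simp: cylinder_def)
    moreover have "norm x \<le> norm (x + (s - x \<bullet> u) *\<^sub>R u) + norm ((s - x \<bullet> u) *\<^sub>R u)"
      using norm_triangle_ineq4[of "x + (s - x \<bullet> u) *\<^sub>R u" "(s - x \<bullet> u) *\<^sub>R u"] by simp
    ultimately show ?thesis using u by simp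
  qed
  then have "bounded (cylinder u h A s)" by (auto simp: bounded_iff)
  moreover have "closed (cylinder u h A s)"
  proof -
    have "closed ((\<lambda>x. x + (s - x \<bullet> u) *\<^sub>R u) -` A)"
      by (intro closed_vimage compact_imp_closed A continuous_intros)
    moreover have "closed {x. 0 \<le> x \<bullet> u}" "closed {x. x \<bullet> u \<le> h}"
      by (auto intro!: closed_Collect_le continuous_intros)
    moreover have "cylinder u h A s = {x. 0 \<le> x \<bullet> u} \<inter> {x. x \<bullet> u \<le> h} \<inter> (\<lambda>x. x + (s - x \<bullet> u) *\<^sub>R u) -` A"
      by (auto simp: cylinder_def)
    ultimately show ?thesis by auto
  qed
  ultimately show ?thesis by (simp add: compact_eq_bounded_closed)
qed

lemma emeasure_cylinder:
  fixes u :: "'a::euclidean_space"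
  assumes A: "compact A" and u: "norm u = 1"
  shows "emeasure lborel (cylinder u 1 A s) = ennreal (section_vol u A s)"
  unfolding section_vol_def by (rule emeasure_lborel_compact[OF compact_cylinder[OF A u]])

lemma section_vol_nonneg: "0 \<le> section_vol u A s" by (simp add: section_vol_def)

lemma section_vol_measurable:
  assumes A: "compact A" and u: "norm u = 1"
  shows "(\<lambda>s. ennreal (section_vol u A s)) \<in> borel_measurable borel"
  using emeasure_eq_nn_integral_sections(2)[OF u borel_compact[OF A]] emeasure_cylinder[OF A u] by simp

lemma nn_integral_section_vol:
  fixes u :: "'a::euclidean_space"
  assumes A: "compact A" and u: "norm u = 1"
  shows "(\<integral>\<^sup>+s. ennreal (section_vol u A s) \<partial>lborel) = ennreal (measure lborel A)"
  using emeasure_eq_nn_integral_sections(1)[OF u borel_compact[OF A]]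
  by (simp add: emeasure_cylinder[OF A u] emeasure_lborel_compact[OF A])

text \<open>Fubini is applied to the cylinder itself: its section at any height in
  \<open>[0, h]\<close> is the original section, and it is empty elsewhere.\<close>

lemma measure_cylinder:
  fixes u :: "'a::euclidean_space"
  assumes A: "compact A" and u: "norm u = 1" and h: "0 \<le> h"
  shows "measure lborel (cylinder u h A s) = h * section_vol u A s"
proof -
  have uu: "u \<bullet> u = 1" using u by (simp add: dot_square_norm)
  have "cylinder u 1 (cylinder u h A s) \<sigma> = (if \<sigma> \<in> {0..h} then cylinder u 1 A s else {})" for \<sigma>
    by (auto simp: cylinder_def inner_add_left inner_diff_left uu algebra_simps)
  then have "emeasure lborel (cylinder u h A s) = (\<integral>\<^sup>+\<sigma>. ennreal (section_vol u A s) * indicator {0..h} \<sigma> \<partial>lborel)"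
    unfolding emeasure_eq_nn_integral_sections(1)[OF u borel_compact[OF compact_cylinder[OF A u]], of h s]
    by (intro nn_integral_cong) (auto simp: emeasure_cylinder[OF A u])
  also have "\<dots> = ennreal (section_vol u A s) * ennreal h"
    using h by (simp add: nn_integral_cmult)
  finally show ?thesis
    using h section_vol_nonneg[of u A s] by (simp add: measure_def enn2real_mult)
qed

text \<open>The heights of the cylinders are chosen as the \<open>m\<close>-th roots
  \<open>P\<close> and \<open>Q\<close> of the section volumes. The cylinders then have
  \<open>n\<close>-volumes \<open>P ^ n\<close> and \<open>Q ^ n\<close>, their sum lies in the
  cylinder of height \<open>P + Q\<close> over the section of the sum, and one factor
  \<open>P + Q\<close> cancels.\<close>

lemma section_vol_msum:
  fixes u :: "'a::euclidean_space"
  assumes A: "compact A" and B: "compact B" and u: "norm u = 1" and n: "DIM('a) = Suc m" "0 < m"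
    and p: "0 < p" "p ^ m \<le> section_vol u A s" and q: "0 < q" "q ^ m \<le> section_vol u B t"
  shows "(p + q) ^ m \<le> section_vol u (msum A B) (s + t)"
proof -
  define P where "P = root m (section_vol u A s)"
  define Q where "Q = root m (section_vol u B t)"
  have P: "P ^ m = section_vol u A s" "p \<le> P" and Q: "Q ^ m = section_vol u B t" "q \<le> Q"
    using n p q real_root_le_mono[OF n(2) p(2)] real_root_le_mono[OF n(2) q(2)]
    by (auto simp: P_def Q_def section_vol_nonneg real_root_pow_pos2 real_root_power_cancel)
  have pos: "0 < P" "0 < Q" using P Q p q by auto
  have vA: "measure lborel (cylinder u P A s) = P ^ DIM('a)"
    using pos P by (subst measure_cylinder[OF A u]) (auto simp: n)
  have vB: "measure lborel (cylinder u Q B t) = Q ^ DIM('a)"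
    using pos Q by (subst measure_cylinder[OF B u]) (auto simp: n)
  note C = compact_sums[OF A B]
  have "(P + Q) ^ DIM('a) \<le> measure lborel (cylinder u (P + Q) (msum A B) (s + t))"
  proof (rule Brunn_Minkowski[OF _ _ _ _ _ vA vB])
    show "cylinder u P A s \<noteq> {}" using vA pos by auto
    show "cylinder u Q B t \<noteq> {}" using vB pos by auto
    fix x y assume "x \<in> cylinder u P A s" "y \<in> cylinder u Q B t"
    moreover have "x + y + (s + t - (x + y) \<bullet> u) *\<^sub>R u = (x + (s - x \<bullet> u) *\<^sub>R u) + (y + (t - y \<bullet> u) *\<^sub>R u)"
      by (simp add: inner_add_left algebra_simps)
    ultimately have "x + y + (s + t - (x + y) \<bullet> u) *\<^sub>R u \<in> msum A B"
      unfolding cylinder_def by blast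
    then show "x + y \<in> cylinder u (P + Q) (msum A B) (s + t)"
      using \<open>x \<in> _\<close> \<open>y \<in> _\<close> unfolding cylinder_def by (auto simp: inner_add_left)
  qed (use A B C u pos in \<open>auto intro: compact_cylinder\<close>)
  then have "(P + Q) * (P + Q) ^ m \<le> (P + Q) * section_vol u (msum A B) (s + t)"
    using pos by (subst (asm) measure_cylinder[OF C u]) (auto simp: n)
  then have "(P + Q) ^ m \<le> section_vol u (msum A B) (s + t)" using pos by simp
  moreover have "(p + q) ^ m \<le> (P + Q) ^ m" using P Q p q by (intro power_mono) auto
  ultimately show ?thesis by simp
qed

text \<open>Since \<open>A\<close> is closed, a point outside the limiting cylinder leaves the
  cylinders along the sequence eventually. The reverse Fatou lemma applies because they all lie in
  one ball.\<close>

lemma section_vol_usc: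
  fixes u :: "'a::euclidean_space"
  assumes A: "compact A" and u: "norm u = 1"
    and lim: "\<sigma> \<longlonglongrightarrow> s" and ge: "\<And>k::nat. c \<le> section_vol u A (\<sigma> k)"
  shows "c \<le> section_vol u A s"
proof -
  obtain K where K: "\<And>x. x \<in> A \<Longrightarrow> norm x \<le> K"
    using compact_imp_bounded[OF A] by (auto simp: bounded_iff)
  obtain S where S: "\<And>k. \<bar>\<sigma> k\<bar> \<le> S"
    using convergent_imp_bounded[OF lim] by (auto simp: bounded_iff)
  let ?B = "cball (0::'a) (K + S + 1)"
  have sub: "cylinder u 1 A (\<sigma> k) \<subseteq> ?B" for k
  proof
    fix x assume x: "x \<in> cylinder u 1 A (\<sigma> k)"
    have "norm (x + (\<sigma> k - x \<bullet> u) *\<^sub>R u) \<le> K" "\<bar>\<sigma> k - x \<bullet> u\<bar> \<le> S + 1"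
      using x K S[of k] by (auto simp: cylinder_def)
    moreover have "norm x \<le> norm (x + (\<sigma> k - x \<bullet> u) *\<^sub>R u) + norm ((\<sigma> k - x \<bullet> u) *\<^sub>R u)"
      using norm_triangle_ineq4[of "x + (\<sigma> k - x \<bullet> u) *\<^sub>R u" "(\<sigma> k - x \<bullet> u) *\<^sub>R u"] by simp
    ultimately show "x \<in> ?B" using u by simp
  qed
  have [measurable]: "cylinder u 1 A t \<in> sets borel" for t
    using borel_compact[OF A] by simp
  let ?i = "\<lambda>k x. indicator (cylinder u 1 A (\<sigma> k)) x :: ennreal"
  have pt: "limsup (\<lambda>k. ?i k x) \<le> indicator (cylinder u 1 A s) x" for x
  proof (cases "x \<in> cylinder u 1 A s")
    case True
    have "limsup (\<lambda>k. ?i k x) \<le> 1"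
      by (intro Limsup_bounded always_eventually) (auto simp: indicator_def)
    then show ?thesis using True by simp
  next
    case False
    have "eventually (\<lambda>k. x \<notin> cylinder u 1 A (\<sigma> k)) sequentially"
    proof (cases "0 \<le> x \<bullet> u \<and> x \<bullet> u \<le> 1")
      case True
      then have "x + (s - x \<bullet> u) *\<^sub>R u \<in> - A" using False by (auto simp: cylinder_def)
      moreover have "(\<lambda>k. x + (\<sigma> k - x \<bullet> u) *\<^sub>R u) \<longlonglongrightarrow> x + (s - x \<bullet> u) *\<^sub>R u"
        by (intro tendsto_intros lim)
      ultimately have "eventually (\<lambda>k. x + (\<sigma> k - x \<bullet> u) *\<^sub>R u \<in> - A) sequentially"
        using A by (intro topological_tendstoD) (auto intro: compact_imp_closed)
      then show ?thesis by eventually_elim (auto simp: cylinder_def)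
    qed (auto simp: cylinder_def)
    then have "eventually (\<lambda>k. ?i k x \<le> 0) sequentially" by eventually_elim auto
    then have "limsup (\<lambda>k. ?i k x) \<le> 0" by (rule Limsup_bounded)
    then show ?thesis by simp
  qed
  have "ennreal c \<le> limsup (\<lambda>k. \<integral>\<^sup>+x. ?i k x \<partial>lborel)"
  proof (rule le_Limsup)
    show "eventually (\<lambda>k. ennreal c \<le> (\<integral>\<^sup>+x. ?i k x \<partial>lborel)) sequentially"
      using ge by (intro always_eventually) (simp add: emeasure_cylinder[OF A u] ennreal_leI)
  qed simp
  also have "limsup (\<lambda>k. \<integral>\<^sup>+x. ?i k x \<partial>lborel) \<le> (\<integral>\<^sup>+x. limsup (\<lambda>k. ?i k x) \<partial>lborel)"
  proof (rule nn_integral_limsup[where w="indicator ?B"])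
    show "AE x in lborel. ?i k x \<le> indicator ?B x" for k
      using sub[of k] by (intro AE_I2) (auto simp: indicator_def)
  next
    show "(\<integral>\<^sup>+x. indicator ?B x \<partial>lborel) < \<infinity>"
      using emeasure_lborel_cball_finite[of "0::'a" "K + S + 1"] by (subst nn_integral_indicator) auto
  qed (auto intro!: borel_measurable_indicator)
  also have "\<dots> \<le> (\<integral>\<^sup>+x. indicator (cylinder u 1 A s) x \<partial>lborel)"
    by (intro nn_integral_mono pt)
  also have "\<dots> = ennreal (section_vol u A s)" by (simp add: emeasure_cylinder[OF A u])
  finally show ?thesis using section_vol_nonneg[of u A s] by (simp add: ennreal_le_iff)
qed

section \<open>Equality in Bonnesen's section inequality\<close>

lemma power_gt_tangent:
  fixes x t :: real
  assumes "0 < x" "0 < t" "x \<noteq> t" "2 \<le> n"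
  shows "t ^ n + real n * t ^ (n - 1) * (x - t) < x ^ n"
  using assms(4)
proof (induction n rule: dec_induct)
  case base
  have "0 < (x - t)\<^sup>2" using assms by simp
  then show ?case by (simp add: power2_eq_square algebra_simps)
next
  case (step n)
  then obtain k where n: "n = Suc k" by (metis Suc_le_D numeral_2_eq_2)
  have "x * (t ^ n + real n * t ^ k * (x - t)) < x * x ^ n"
    using step assms n by (intro mult_strict_left_mono) auto
  moreover have "x * (t ^ n + real n * t ^ k * (x - t))
     = t ^ Suc n + real (Suc n) * t ^ n * (x - t) + real n * t ^ k * (x - t)\<^sup>2"
    by (simp add: n power2_eq_square algebra_simps)
  moreover have "0 \<le> real n * t ^ k * (x - t)\<^sup>2" using assms by simp
  ultimately show ?case by simp
qed

text \<open>Strict Jensen for the power function at the points \<open>1\<close> and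
  \<open>r / q\<close> with weights \<open>1\<close> and \<open>q\<close>. Their weighted mean is
  \<open>t = (1 + r) / (1 + q)\<close>, so the linear terms of the two tangent bounds at
  \<open>t\<close> cancel; if \<open>q\<close> differs from \<open>r\<close>, both points differ
  from \<open>t\<close> and the bounds are strict.\<close>

lemma Bonnesen_ratio:
  fixes q r :: real
  assumes pos: "0 < q" "0 < r" "0 < m"
    and le: "(1 + q) ^ m * (1 + r ^ Suc m / q ^ m) \<le> (1 + r) ^ Suc m"
  shows "q = r"
proof (rule ccontr)
  assume ne: "q \<noteq> r"
  define t where "t = (1 + r) / (1 + q)"
  have t: "0 < t" using pos by (simp add: t_def)
  have n: "2 \<le> Suc m" using pos by simp
  have "1 \<noteq> t" using ne pos by (simp add: t_def field_simps)
  then have a: "t ^ Suc m + real (Suc m) * t ^ m * (1 - t) < 1"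
    using power_gt_tangent[OF _ t _ n, of 1] by simp
  have "r / q \<noteq> t" using ne pos by (simp add: t_def field_simps)
  then have b: "t ^ Suc m + real (Suc m) * t ^ m * (r / q - t) < (r / q) ^ Suc m"
    using power_gt_tangent[OF _ t _ n, of "r / q"] pos by simp
  have "(1 + q) * t ^ Suc m + real (Suc m) * t ^ m * ((1 - t) + q * (r / q - t)) < 1 + q * (r / q) ^ Suc m"
  proof -
    have "(1 + q) * w + z * ((1 - t) + q * (v - t)) < 1 + q * y"
      if "w + z * (1 - t) < 1" "w + z * (v - t) < y" for w z v y
      using that(1) mult_strict_left_mono[OF that(2) pos(1)] by (simp add: algebra_simps)
    from this[OF a b] show ?thesis .
  qed
  moreover have "(1 - t) + q * (r / q - t) = 0"
  proof -
    have "(1 + q) * t = 1 + r" using pos by (simp add: t_def)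
    moreover have "(1 - t) + q * (r / q - t) = 1 + r - (1 + q) * t" using pos by (simp add: algebra_simps)
    ultimately show ?thesis by simp
  qed
  moreover have "q * (r / q) ^ Suc m = r ^ Suc m / q ^ m" using pos by (simp add: field_simps)
  ultimately have "(1 + q) * t ^ Suc m < 1 + r ^ Suc m / q ^ m" by simp
  then have "(1 + q) ^ m * ((1 + q) * t ^ Suc m) < (1 + q) ^ m * (1 + r ^ Suc m / q ^ m)"
    using pos by (intro mult_strict_left_mono) auto
  moreover have "(1 + q) ^ m * ((1 + q) * t ^ Suc m) = (1 + r) ^ Suc m"
  proof -
    have "(1 + q) ^ m * ((1 + q) * t ^ Suc m) = ((1 + q) * t) ^ Suc m" by (simp add: power_mult_distrib)
    also have "(1 + q) * t = 1 + r" using pos by (simp add: t_def)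
    finally show ?thesis .
  qed
  ultimately show False using le by simp
qed

section \<open>Equality in the one-dimensional sum inequality\<close>

lemma measure_lborel_Un_separated:
  fixes S T :: "real set"
  assumes "S \<in> fmeasurable lborel" "T \<in> fmeasurable lborel" "S \<subseteq> {..c}" "T \<subseteq> {c..}"
  shows "measure lborel (S \<union> T) = measure lborel S + measure lborel T"
proof (rule measure_Un_AE)
  show "AE x in lborel. x \<notin> S \<or> x \<notin> T"
  proof (rule AE_I'[of "{c}"])
    show "{x \<in> space lborel. \<not> (x \<notin> S \<or> x \<notin> T)} \<subseteq> {c}"
      using assms(3,4) by (auto simp: subset_iff intro: antisym)
  qed (simp add: finite_imp_null_set_lborel)
qed (use assms in auto)

text \<open>The true maximum of \<open>Y\<close> may be isolated up to null sets. The essential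
  maximum has positive measure immediately to its left, and this mass fills the gap in the next
  proof.\<close>

lemma essential_Sup_exists:
  fixes Y :: "real set"
  assumes Y: "compact Y" and pos: "0 < measure lborel Y"
  obtains e where "e \<in> Y" "measure lborel (Y \<inter> {..e}) = measure lborel Y"
    "\<And>d. d < e \<Longrightarrow> 0 < measure lborel (Y \<inter> {d<..<e})"
proof -
  have fm: "Y \<inter> S \<in> fmeasurable lborel" if "S \<in> sets borel" for S
    using that fmeasurable_compact[OF Y] by (intro fmeasurable_Int_fmeasurable) auto
  define S where "S = {y. 0 < measure lborel (Y \<inter> {y..})}"
  obtain lo where lo: "\<And>y. y \<in> Y \<Longrightarrow> lo \<le> y" using compact_imp_bounded[OF Y] bounded_has_Inf(1) by (metis bounded_imp_bdd_below bdd_below.E)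
  obtain hi where hi: "\<And>y. y \<in> Y \<Longrightarrow> y \<le> hi" using compact_imp_bounded[OF Y] by (metis bounded_imp_bdd_above bdd_above.E)
  have "Y \<inter> {lo..} = Y" using lo by auto
  then have "lo \<in> S" using pos by (simp add: S_def)
  have up: "y \<le> hi" if "y \<in> S" for y
  proof (rule ccontr)
    assume "\<not> y \<le> hi"
    then have "Y \<inter> {y..} = {}" using hi by force
    then show False using that by (simp add: S_def)
  qed
  then have bdd: "bdd_above S" by (auto simp: bdd_above_def)
  define e where "e = Sup S"
  have null: "Y \<inter> {e<..} \<in> null_sets lborel"
  proof -
    have "Y \<inter> {e + 1 / Suc k..} \<in> null_sets lborel" for k
    proof -
      have "e + 1 / Suc k \<notin> S" using cSup_upper[OF _ bdd, of "e + 1 / Suc k"] by (auto simp: e_def)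
      then have "measure lborel (Y \<inter> {e + 1 / Suc k..}) = 0"
        by (simp add: S_def zero_less_measure_iff)
      then show ?thesis
        using fm[of "{e + 1 / Suc k..}"]
        by (intro null_setsI) (auto simp: emeasure_eq_measure2 fmeasurableD)
    qed
    then have "(\<Union>k. Y \<inter> {e + 1 / Suc k..}) \<in> null_sets lborel" by (rule null_sets_UN)
    moreover have "Y \<inter> {e<..} \<subseteq> (\<Union>k. Y \<inter> {e + 1 / Suc k..})"
    proof
      fix y assume y: "y \<in> Y \<inter> {e<..}"
      then obtain k where "inverse (real (Suc k)) < y - e" using reals_Archimedean[of "y - e"] by auto
      then have "y \<in> Y \<inter> {e + 1 / Suc k..}" using y by (auto simp: inverse_eq_divide)
      then show "y \<in> (\<Union>k. Y \<inter> {e + 1 / Suc k..})" by blast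
    qed
    ultimately show ?thesis using fm[of "{e<..}"] by (auto intro: null_sets_subset simp del: UN_simps dest: fmeasurableD)
  qed
  have top: "measure lborel (Y \<inter> {..e}) = measure lborel Y"
  proof -
    have "Y \<inter> {..e} = Y - (Y \<inter> {e<..})" by auto
    then show ?thesis using null Y borel_compact[of Y] by (simp add: measure_Diff_null_set)
  qed
  have near: "0 < measure lborel (Y \<inter> {d<..<e})" if "d < e" for d
  proof -
    obtain y where y: "y \<in> S" "d < y" using less_cSupE[of d S] \<open>d < e\<close> \<open>lo \<in> S\<close> unfolding e_def by blast
    have "Y \<inter> {y..} \<subseteq> (Y \<inter> {d<..<e}) \<union> ({e} \<union> (Y \<inter> {e<..}))" using y by auto
    then have "measure lborel (Y \<inter> {y..}) \<le> measure lborel ((Y \<inter> {d<..<e}) \<union> ({e} \<union> (Y \<inter> {e<..})))"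
    proof (rule measure_mono_fmeasurable)
      show "Y \<inter> {d<..<e} \<union> ({e} \<union> Y \<inter> {e<..}) \<in> fmeasurable lborel"
        by (intro fmeasurable.Un fm fmeasurable_compact) auto
    qed (use fm[of "{y..}"] in \<open>auto dest: fmeasurableD\<close>)
    also have "\<dots> = measure lborel (Y \<inter> {d<..<e})"
      using null fm[of "{d<..<e}"] by (intro measure_Un_null_set null_sets.Un) (auto dest: fmeasurableD)
    finally show ?thesis using y by (simp add: S_def)
  qed
  have "e \<in> Y"
  proof (rule ccontr)
    assume "e \<notin> Y"
    then obtain d where d: "0 < d" "ball e d \<inter> Y = {}"
      using compact_imp_closed[OF Y] openE[of "- Y" e] by (metis ComplI disjoint_eq_subset_Compl open_Compl)
    then have "Y \<inter> {e - d<..<e} = {}" by (force simp: dist_real_def)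
    then show False using near[of "e - d"] d by simp
  qed
  then show thesis using top near by (rule that)
qed

text \<open>If \<open>X\<close> has a gap \<open>(p, q)\<close>, there is room in \<open>Z\<close>
  for a part of \<open>Y\<close> beyond the translates whose measures make up those of
  \<open>X\<close> and \<open>Y\<close>, so the sum is too large.\<close>

lemma convex_of_measure_sum_le:
  fixes X Y Z :: "real set"
  assumes X: "compact X" and Y: "compact Y" "0 < measure lborel Y"
    and Z: "Z \<in> fmeasurable lborel" and sum: "\<And>x y. x \<in> X \<Longrightarrow> y \<in> Y \<Longrightarrow> x + y \<in> Z"
    and le: "measure lborel Z \<le> measure lborel X + measure lborel Y"
  shows "convex X"
proof (rule ccontr)
  assume "\<not> convex X"
  then obtain a b c where abc: "a \<in> X" "b \<in> X" "a < c" "c < b" "c \<notin> X"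
    unfolding is_interval_convex_1[symmetric] is_interval_1 by (metis order_le_less)
  let ?L = "X \<inter> {..c}" and ?R = "X \<inter> {c..}"
  have cLR: "compact ?L" "compact ?R" using X by (auto intro: compact_Int_closed)
  obtain p where p: "p \<in> ?L" "\<And>x. x \<in> ?L \<Longrightarrow> x \<le> p"
    using compact_attains_sup[OF cLR(1)] abc by fastforce
  obtain q where q: "q \<in> ?R" "\<And>x. x \<in> ?R \<Longrightarrow> q \<le> x"
    using compact_attains_inf[OF cLR(2)] abc by fastforce
  have pq: "p < q" using p q abc by (metis IntD1 IntD2 atLeast_iff atMost_iff order_le_less order_less_le_trans)
  obtain e where e: "e \<in> Y" "measure lborel (Y \<inter> {..e}) = measure lborel Y"
    "\<And>d. d < e \<Longrightarrow> 0 < measure lborel (Y \<inter> {d<..<e})"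
    using essential_Sup_exists[OF Y] by metis
  obtain y0 where y0: "y0 \<in> Y" "\<And>y. y \<in> Y \<Longrightarrow> y0 \<le> y"
    using compact_attains_inf[OF Y(1)] e(1) by blast
  let ?P = "Y \<inter> {e - (q - p)<..<e}"
  have bor: "X \<in> sets borel" "Y \<in> sets borel" using X Y by (auto intro: borel_compact)
  have fm: "Y \<inter> S \<in> fmeasurable lborel" "X \<inter> S \<in> fmeasurable lborel" if "S \<in> sets borel" for S
    using that fmeasurable_compact[OF Y(1)] fmeasurable_compact[OF X] by (auto intro: fmeasurable_Int_fmeasurable)
  define T where "T d S = (\<lambda>x. d + 1 *\<^sub>R x) ` S" for d :: real and S
  have T: "measure lborel (T d S) = measure lborel S" "T d S \<in> fmeasurable lborel"
    if "S \<in> fmeasurable lborel" for d S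
    using that emeasure_lborel_affine_image[of S 1 d]
    by (auto simp: T_def fmeasurable_def measure_def)
  note F = fm(2)[of "{..c}"] fm(1)[of "{..e}"] fm(1)[of "{e - (q - p)<..<e}"] fm(2)[of "{c..}"]
  \<comment> \<open>From left to right: the part of \<open>X\<close> before the gap shifted by the
    minimum of \<open>Y\<close>, then \<open>Y\<close> shifted by \<open>p\<close>, then the end
    piece of \<open>Y\<close> of length at most \<open>q - p\<close> shifted by \<open>q\<close>,
    then the rest of \<open>X\<close> shifted by \<open>e\<close>. They are separated by
    \<open>p + y0\<close>, \<open>p + e\<close> and \<open>q + e\<close>; the third is the
    surplus.\<close>
  let ?U1 = "T y0 ?L" and ?U2 = "T p (Y \<inter> {..e})" and ?U3 = "T q ?P" and ?U4 = "T e ?R"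
  have U: "?U1 \<in> fmeasurable lborel" "?U2 \<in> fmeasurable lborel" "?U3 \<in> fmeasurable lborel" "?U4 \<in> fmeasurable lborel"
    using F by (auto intro: T)
  have "measure lborel (?U1 \<union> (?U2 \<union> (?U3 \<union> ?U4)))
     = measure lborel ?U1 + (measure lborel ?U2 + (measure lborel ?U3 + measure lborel ?U4))"
  proof (subst measure_lborel_Un_separated[where c="p + y0"])
    show "?U1 \<subseteq> {..p + y0}" using p by (auto simp: T_def)
    show "?U2 \<union> (?U3 \<union> ?U4) \<subseteq> {p + y0..}" using y0 q e pq by (fastforce simp: T_def)
    show "measure lborel ?U1 + measure lborel (?U2 \<union> (?U3 \<union> ?U4)) = measure lborel ?U1 + (measure lborel ?U2 + (measure lborel ?U3 + measure lborel ?U4))"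
    proof (subst measure_lborel_Un_separated[where c="p + e"])
      show "?U2 \<subseteq> {..p + e}" by (auto simp: T_def)
      show "?U3 \<union> ?U4 \<subseteq> {p + e..}" using q pq by (fastforce simp: T_def)
      show "measure lborel ?U1 + (measure lborel ?U2 + measure lborel (?U3 \<union> ?U4)) = measure lborel ?U1 + (measure lborel ?U2 + (measure lborel ?U3 + measure lborel ?U4))"
      proof (subst measure_lborel_Un_separated[where c="q + e"])
        show "?U3 \<subseteq> {..q + e}" by (auto simp: T_def)
        show "?U4 \<subseteq> {q + e..}" using q by (auto simp: T_def)
      qed (use U in auto)
    qed (use U in auto)
  qed (use U in auto)
  also have "\<dots> = measure lborel X + measure lborel Y + measure lborel ?P"
  proof -
    have "X = ?L \<union> ?R" by auto
    then have "measure lborel X = measure lborel ?L + measure lborel ?R"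
      using measure_lborel_Un_separated[OF F(1,4), of c] by auto
    then show ?thesis using e(2) by (simp add: T F)
  qed
  finally have "measure lborel (?U1 \<union> (?U2 \<union> (?U3 \<union> ?U4))) > measure lborel Z"
    using le e(3)[of "e - (q - p)"] pq by simp
  moreover have "?U1 \<union> (?U2 \<union> (?U3 \<union> ?U4)) \<subseteq> Z"
    using sum y0(1) e(1) p(1) q(1) by (auto simp: T_def add.commute[of y0] add.commute[of e])
  then have "measure lborel (?U1 \<union> (?U2 \<union> (?U3 \<union> ?U4))) \<le> measure lborel Z"
    by (rule measure_mono_fmeasurable) (use U Z in \<open>auto dest!: fmeasurableD\<close>)
  ultimately show False by simp
qed

section \<open>Superlevel sets of section functions\<close>

lemma section_vol_bounded:
  fixes u :: "'a::euclidean_space"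
  assumes A: "compact A" and u: "norm u = 1"
  obtains K c where "0 < K" "\<And>s. K < \<bar>s\<bar> \<Longrightarrow> section_vol u A s = 0" "\<And>s. section_vol u A s \<le> c"
proof -
  obtain K where K: "0 < K" "\<And>x. x \<in> A \<Longrightarrow> norm x \<le> K"
    using compact_imp_bounded[OF A] by (auto simp: bounded_pos)
  have uu: "u \<bullet> u = 1" using u by (simp add: dot_square_norm)
  have s_le: "\<bar>s\<bar> \<le> K" if "x \<in> cylinder u 1 A s" for x s
  proof -
    have "x + (s - x \<bullet> u) *\<^sub>R u \<in> A" using that by (simp add: cylinder_def)
    then have "\<bar>(x + (s - x \<bullet> u) *\<^sub>R u) \<bullet> u\<bar> \<le> K"
      using Cauchy_Schwarz_ineq2[of "x + (s - x \<bullet> u) *\<^sub>R u" u] K(2) u by fastforce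
    then show ?thesis by (simp add: inner_add_left uu)
  qed
  have "section_vol u A s = 0" if "K < \<bar>s\<bar>" for s
  proof -
    have "cylinder u 1 A s = {}" using s_le[of _ s] that by force
    then show ?thesis by (simp add: section_vol_def)
  qed
  moreover have "section_vol u A s \<le> measure lborel (cball (0::'a) (2 * K + 1))" for s
    unfolding section_vol_def
  proof (rule measure_lborel_mono)
    show "cylinder u 1 A s \<subseteq> cball 0 (2 * K + 1)"
    proof
      fix x assume x: "x \<in> cylinder u 1 A s"
      have "norm (x + (s - x \<bullet> u) *\<^sub>R u) \<le> K" "\<bar>s - x \<bullet> u\<bar> \<le> K + 1"
        using x K s_le[OF x] by (auto simp: cylinder_def)
      moreover have "norm x \<le> norm (x + (s - x \<bullet> u) *\<^sub>R u) + norm ((s - x \<bullet> u) *\<^sub>R u)"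
        using norm_triangle_ineq4[of "x + (s - x \<bullet> u) *\<^sub>R u" "(s - x \<bullet> u) *\<^sub>R u"] by simp
      ultimately show "x \<in> cball 0 (2 * K + 1)" using u by simp
    qed
  qed (use compact_cylinder[OF A u] in auto)
  ultimately show thesis using K(1) that by blast
qed

lemma compact_section_superlevel:
  fixes u :: "'a::euclidean_space"
  assumes A: "compact A" and u: "norm u = 1" and c: "0 < c"
  shows "compact {s. c \<le> section_vol u A s}"
proof -
  obtain K d where K: "0 < K" "\<And>s. K < \<bar>s\<bar> \<Longrightarrow> section_vol u A s = 0" "\<And>s. section_vol u A s \<le> d"
    using section_vol_bounded[OF A u] by blast
  have "bounded {s. c \<le> section_vol u A s}"
    unfolding bounded_iff
  proof (intro exI[of _ K] ballI)
    fix s assume "s \<in> {s. c \<le> section_vol u A s}"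
    then show "norm s \<le> K" using K(2)[of s] c by (cases "K < \<bar>s\<bar>") auto
  qed
  moreover have "closed {s. c \<le> section_vol u A s}"
    using section_vol_usc[OF A u] by (auto simp: closed_sequential_limits)
  ultimately show ?thesis by (simp add: compact_eq_bounded_closed)
qed

text \<open>If every level \<open>1 / Suc k\<close> were reached only on a null set, the section
  function would vanish almost everywhere, although its integral is the volume of
  \<open>A\<close>.\<close>

lemma section_superlevel_pos:
  fixes u :: "'a::euclidean_space"
  assumes A: "compact A" and u: "norm u = 1" and pos: "0 < measure lborel A"
  obtains \<tau> where "0 < \<tau>" "\<And>t. 0 < t \<Longrightarrow> t \<le> \<tau> \<Longrightarrow> 0 < measure lborel {s. t \<le> section_vol u A s}"
proof -
  let ?S = "\<lambda>t. {s. t \<le> section_vol u A s}"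
  have fm: "?S t \<in> fmeasurable lborel" if "0 < t" for t
    using compact_section_superlevel[OF A u that] by (rule fmeasurable_compact)
  have "\<exists>k. 0 < measure lborel (?S (1 / Suc k))"
  proof (rule ccontr)
    assume "\<not> ?thesis"
    then have "measure lborel (?S (1 / Suc k)) = 0" for k by (simp add: zero_less_measure_iff)
    then have "?S (1 / Suc k) \<in> null_sets lborel" for k
      using fm[of "1 / Suc k"] by (intro null_setsI) (auto simp: emeasure_eq_measure2 dest: fmeasurableD)
    then have N: "(\<Union>k. ?S (1 / Suc k)) \<in> null_sets lborel" by (rule null_sets_UN)
    have "AE s in lborel. ennreal (section_vol u A s) = 0"
    proof (rule AE_I'[OF N], rule subsetI)
      fix s assume "s \<in> {s \<in> space lborel. ennreal (section_vol u A s) \<noteq> 0}"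
      then have "0 < section_vol u A s" using section_vol_nonneg[of u A s] by (auto simp: less_le)
      then obtain k where "inverse (real (Suc k)) < section_vol u A s" using reals_Archimedean by auto
      then have "s \<in> ?S (1 / Suc k)" by (simp add: inverse_eq_divide)
      then show "s \<in> (\<Union>k. ?S (1 / Suc k))" by blast
    qed
    then have "(\<integral>\<^sup>+s. ennreal (section_vol u A s) \<partial>lborel) = 0"
      using section_vol_measurable[OF A u] by (subst nn_integral_0_iff_AE) auto
    then show False using pos by (simp add: nn_integral_section_vol[OF A u])
  qed
  then obtain k where k: "0 < measure lborel (?S (1 / Suc k))" by blast
  have "0 < measure lborel (?S t)" if "0 < t" "t \<le> 1 / Suc k" for t
  proof -
    have "measure lborel (?S (1 / Suc k)) \<le> measure lborel (?S t)"
      using fm[OF \<open>0 < t\<close>] fm[of "1 / Suc k"] \<open>t \<le> _\<close> by (intro measure_mono_fmeasurable) (auto dest: fmeasurableD)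
    then show ?thesis using k by linarith
  qed
  then show thesis using that[of "1 / Suc k"] by simp
qed

lemma AE_lborel_exists_small:
  fixes \<tau> :: real
  assumes "AE t in lborel. P t" "0 < \<tau>"
  obtains t where "0 < t" "t < \<tau>" "P t"
proof -
  have "\<exists>t. 0 < t \<and> t < \<tau> \<and> P t"
  proof (rule ccontr)
    assume "\<not> ?thesis"
    then have "AE t in lborel. t \<notin> {0<..<\<tau>}"
      using assms(1) by (auto elim!: eventually_mono)
    then have "emeasure lborel {0<..<\<tau>} = 0" by (subst (asm) AE_iff_measurable[where N="{0<..<\<tau>}"]) auto
    then show False using assms(2) by simp
  qed
  then show thesis using that by blast
qed

text \<open>Superlevel sets of the section functions at the same relative height add up. With the
  one-dimensional inequality and the layer-cake formula this is Bonnesen's inequality, which is at least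
  as strong as Brunn--Minkowski; the pair being an equality case fixes the ratio of the largest sections
  and forces equality, hence convexity, for almost all superlevel sets.\<close>

lemma BM_equal_sections:
  fixes A B :: "'a::euclidean_space set"
  assumes eq: "BM_equal r A B" and u: "norm u = 1" and n: "DIM('a) = Suc m" "0 < m"
  shows BM_equal_section_bound: "(\<And>s. section_vol u A s \<le> c) \<Longrightarrow> section_vol u B t \<le> r ^ m * c"
    and BM_equal_section_convex: "convex {s. 0 < section_vol u A s}"
proof -
  let ?A = "section_vol u A" and ?B = "section_vol u B" and ?C = "section_vol u (msum A B)"
  note e = eq[unfolded BM_equal_def]
  have cA: "compact A" and cB: "compact B" and r: "0 < r" and pA: "0 < measure lborel A" using e by auto
  have vB: "measure lborel B = r ^ Suc m * measure lborel A"
    and vC: "measure lborel (msum A B) = (1 + r) ^ Suc m * measure lborel A" using e n by auto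
  have pB: "0 < measure lborel B" using vB r pA by simp
  note cC = compact_sums[OF cA cB]
  have sup: "\<exists>a>0. (\<forall>s. section_vol u D s \<le> a) \<and> (\<forall>t. t < a \<longrightarrow> (\<exists>s. t < section_vol u D s))"
    if D: "compact D" "0 < measure lborel D" for D
  proof -
    obtain d where d: "\<And>s. section_vol u D s \<le> d" using section_vol_bounded[OF D(1) u] by metis
    have bdd: "bdd_above (range (section_vol u D))" using d by (auto simp: bdd_above_def)
    have le: "section_vol u D s \<le> (SUP s. section_vol u D s)" for s by (rule cSUP_upper[OF _ bdd]) simp
    obtain \<tau> where \<tau>: "0 < \<tau>" "\<And>t. 0 < t \<Longrightarrow> t \<le> \<tau> \<Longrightarrow> 0 < measure lborel {s. t \<le> section_vol u D s}"
      using section_superlevel_pos[OF D(1) u D(2)] by blast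
    have "{s. \<tau> \<le> section_vol u D s} \<noteq> {}"
    proof
      assume "{s. \<tau> \<le> section_vol u D s} = {}"
      then show False using \<tau>(2)[OF \<tau>(1) order_refl] by simp
    qed
    then obtain s where "\<tau> \<le> section_vol u D s" by blast
    then have "0 < (SUP s. section_vol u D s)" using le[of s] \<tau>(1) by linarith
    moreover have "\<exists>s. t < section_vol u D s" if "t < (SUP s. section_vol u D s)" for t
      using that less_cSUP_iff[OF _ bdd] by auto
    ultimately show ?thesis using le by blast
  qed
  obtain a where a: "0 < a" "\<And>s. ?A s \<le> a" "\<And>t. t < a \<Longrightarrow> \<exists>s. t < ?A s" using sup[OF cA pA] by blast
  obtain b where b: "0 < b" "\<And>s. ?B s \<le> b" "\<And>t. t < b \<Longrightarrow> \<exists>s. t < ?B s" using sup[OF cB pB] by blast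
  \<comment> \<open>Here \<open>a\<close> and \<open>b\<close> are the suprema of the section
    volumes; their roots are the linear sizes that add in Brunn--Minkowski.\<close>
  define \<alpha> where "\<alpha> = root m a"
  define \<beta> where "\<beta> = root m b"
  have \<alpha>: "0 < \<alpha>" "\<alpha> ^ m = a" and \<beta>: "0 < \<beta>" "\<beta> ^ m = b"
    using a b n by (simp_all add: \<alpha>_def \<beta>_def real_root_pow_pos2)
  \<comment> \<open>Sections of relative height \<open>t\<close> have linear sizes at least
    \<open>\<rho> * \<alpha>\<close> and \<open>\<rho> * \<beta>\<close> with
    \<open>\<rho> ^ m = t\<close>, so the sections of the sum have volume at least
    \<open>t * M\<close>.\<close>
  define M where "M = (\<alpha> + \<beta>) ^ m"
  have M: "0 < M" using \<alpha> \<beta> by (simp add: M_def)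
  let ?f = "\<lambda>s. ennreal (?A s)" and ?g = "\<lambda>s. ennreal (?B s)" and ?h = "\<lambda>s. ennreal (?C s)"
  have level: "superlevel ?f t = {s. t \<le> ?A s}" "superlevel ?g t = {s. t \<le> ?B s}" "superlevel ?h t = {s. t \<le> ?C s}"
    if "0 < t" for t
    by (auto simp: ennreal_le_iff[OF section_vol_nonneg])
  have ne: "superlevel ?f (t * a) \<noteq> {}" "superlevel ?g (t * b) \<noteq> {}" if t: "0 < t" "t < 1" for t
  proof -
    have "t * a < a" "t * b < b" using t a(1) b(1) by simp_all
    with a(3) b(3) obtain x y where "t * a < ?A x" "t * b < ?B y" by blast
    then have "x \<in> superlevel ?f (t * a)" "y \<in> superlevel ?g (t * b)" by (auto intro: ennreal_leI)
    then show "superlevel ?f (t * a) \<noteq> {}" "superlevel ?g (t * b) \<noteq> {}" by blast+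
  qed
  have sum: "ennreal (t * M) \<le> ?h (x + y)"
    if t: "0 < t" "t < 1" and x: "ennreal (t * a) \<le> ?f x" and y: "ennreal (t * b) \<le> ?g y" for t x y
  proof -
    define \<rho> where "\<rho> = root m t"
    have \<rho>: "0 < \<rho>" "\<rho> ^ m = t" using t n by (simp_all add: \<rho>_def real_root_pow_pos2)
    have "t * a \<le> ?A x" "t * b \<le> ?B y"
      using x y by (simp_all add: ennreal_le_iff section_vol_nonneg)
    then have "(\<rho> * \<alpha> + \<rho> * \<beta>) ^ m \<le> ?C (x + y)"
      using \<alpha> \<beta> \<rho> by (intro section_vol_msum[OF cA cB u n]) (auto simp: power_mult_distrib)
    also have "(\<rho> * \<alpha> + \<rho> * \<beta>) ^ m = t * M"
      unfolding M_def \<rho>(2)[symmetric] power_mult_distrib[symmetric] distrib_left ..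
    finally show ?thesis by (rule ennreal_leI)
  qed
  have le: "?f s \<le> ennreal a" "?g s \<le> ennreal b" for s using a b by (auto intro: ennreal_leI)
  note SS = section_vol_measurable[OF cA u] section_vol_measurable[OF cB u] section_vol_measurable[OF cC u]
    a(1) b(1) M le ne sum
  have "ennreal (M / a) * ennreal (measure lborel A) + ennreal (M / b) * ennreal (measure lborel B)
     \<le> ennreal (measure lborel (msum A B))"
    using superlevel_sum_integral[of ?f ?g ?h a b M, OF SS] 
    by (simp add: nn_integral_section_vol[OF cA u] nn_integral_section_vol[OF cB u] nn_integral_section_vol[OF cC u])
  also have "ennreal (M / a) * ennreal (measure lborel A) + ennreal (M / b) * ennreal (measure lborel B)
     = ennreal (M / a * measure lborel A + M / b * measure lborel B)"
    using M a(1) b(1) by (subst ennreal_plus) (auto simp: ennreal_mult simp del: times_divide_eq_left times_divide_eq_right)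
  finally have "M / a * measure lborel A + M / b * measure lborel B \<le> measure lborel (msum A B)"
    by (simp add: ennreal_le_iff)
  then have "(M / a + M / b * r ^ Suc m) * measure lborel A \<le> (1 + r) ^ Suc m * measure lborel A"
    unfolding vB vC by (simp add: algebra_simps)
  then have ineq: "M / a + M / b * r ^ Suc m \<le> (1 + r) ^ Suc m" using pA by simp
  define q where "q = \<beta> / \<alpha>"
  have q: "0 < q" "\<beta> = q * \<alpha>" using \<alpha> \<beta> by (simp_all add: q_def)
  have Ma: "M / a = (1 + q) ^ m"
  proof -
    have "M = ((1 + q) * \<alpha>) ^ m" unfolding M_def q(2) by (simp add: algebra_simps)
    then show ?thesis using \<alpha> a(1) by (simp add: power_mult_distrib)
  qed
  have ba: "b = q ^ m * a" using \<alpha> \<beta> q 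
    by (metis power_mult_distrib)
  have Mb: "M / b = (1 + q) ^ m / q ^ m" using Ma ba a(1) q(1) by (simp add: field_simps)
  \<comment> \<open>The volume of the sum is the Brunn--Minkowski minimum, so Bonnesen's bound
    cannot exceed it and the ratio of the largest sections is forced.\<close>
  have qr: "q = r"
  proof (rule Bonnesen_ratio[OF q(1) r n(2)])
    show "(1 + q) ^ m * (1 + r ^ Suc m / q ^ m) \<le> (1 + r) ^ Suc m"
      using ineq unfolding Ma Mb by (simp add: algebra_simps)
  qed
  show "?B t \<le> r ^ m * c" if c: "\<And>s. ?A s \<le> c"
  proof -
    have "a \<le> c"
    proof (rule ccontr)
      assume "\<not> a \<le> c"
      then obtain s where "c < ?A s" using a(3)[of c] by auto
      then show False using c[of s] by simp
    qed
    then have "r ^ m * a \<le> r ^ m * c" using r by simp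
    then show ?thesis using b(2)[of t] ba qr by simp
  qed
  have "AE t in lborel. 0 < t \<longrightarrow> t < 1 \<longrightarrow> emeasure lborel (superlevel ?h (t * M))
           = emeasure lborel (superlevel ?f (t * a)) + emeasure lborel (superlevel ?g (t * b))"
  proof (rule superlevel_sum_equality[of ?f ?g ?h a b M, OF SS])
    have "M / a * measure lborel A + M / b * measure lborel B = (1 + r) ^ Suc m * measure lborel A"
      unfolding Ma Mb vB qr using r by (simp add: algebra_simps)
    then have "ennreal (measure lborel (msum A B))
       = ennreal (M / a * measure lborel A + M / b * measure lborel B)" using vC by simp
    also have "\<dots> = ennreal (M / a) * ennreal (measure lborel A) + ennreal (M / b) * ennreal (measure lborel B)"
      using M a(1) b(1) by (subst ennreal_plus) (auto simp: ennreal_mult simp del: times_divide_eq_left times_divide_eq_right)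
    finally show "(\<integral>\<^sup>+ s. ?h s \<partial>lborel) \<le> ennreal (M / a) * (\<integral>\<^sup>+ s. ?f s \<partial>lborel) + ennreal (M / b) * (\<integral>\<^sup>+ s. ?g s \<partial>lborel)"
      by (simp add: nn_integral_section_vol[OF cA u] nn_integral_section_vol[OF cB u] nn_integral_section_vol[OF cC u])
    show "(\<integral>\<^sup>+ s. ?h s \<partial>lborel) < \<infinity>" by (simp add: nn_integral_section_vol[OF cC u])
  qed auto
  note AE = this
  show "convex {s. 0 < ?A s}"
    unfolding is_interval_convex_1[symmetric] is_interval_1
  proof (intro ballI allI impI)
    fix x y z assume "x \<in> {s. 0 < ?A s}" "y \<in> {s. 0 < ?A s}" "x \<le> z \<and> z \<le> y"
    then have xyz: "0 < ?A x" "0 < ?A y" "x \<le> z" "z \<le> y" by auto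
    obtain \<tau>A where \<tau>A: "0 < \<tau>A" "\<And>t. 0 < t \<Longrightarrow> t \<le> \<tau>A \<Longrightarrow> 0 < measure lborel {s. t \<le> ?A s}"
      using section_superlevel_pos[OF cA u pA] by blast
    obtain \<tau>B where \<tau>B: "0 < \<tau>B" "\<And>t. 0 < t \<Longrightarrow> t \<le> \<tau>B \<Longrightarrow> 0 < measure lborel {s. t \<le> ?B s}"
      using section_superlevel_pos[OF cB u pB] by blast
    \<comment> \<open>Below this height the superlevel set of \<open>A\<close> contains both
      \<open>x\<close> and \<open>y\<close>, and that of \<open>B\<close> has positive measure, as
      the convexity criterion requires.\<close>
    let ?\<tau> = "Min {1, ?A x / a, ?A y / a, \<tau>A / a, \<tau>B / b}"
    have "0 < ?\<tau>" using xyz \<tau>A \<tau>B a(1) b(1) by simp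
    from AE_lborel_exists_small[OF AE this]
    obtain t where t: "0 < t" "t < ?\<tau>" and tt: "0 < t \<longrightarrow> t < 1 \<longrightarrow> emeasure lborel (superlevel ?h (t * M))
           = emeasure lborel (superlevel ?f (t * a)) + emeasure lborel (superlevel ?g (t * b))" .
    have t1: "t < 1" "t * a \<le> ?A x" "t * a \<le> ?A y" "t * a \<le> \<tau>A" "t * b \<le> \<tau>B"
      using t(2) a(1) b(1) by (auto simp: pos_less_divide_eq)
    have pos: "0 < t * a" "0 < t * b" "0 < t * M" using t a b M by auto
    let ?F = "{s. t * a \<le> ?A s}" and ?G = "{s. t * b \<le> ?B s}" and ?H = "{s. t * M \<le> ?C s}"
    have cpt: "compact ?F" "compact ?G" "compact ?H"
      using compact_section_superlevel u cA cB cC pos by blast+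
    have "emeasure lborel ?H = emeasure lborel ?F + emeasure lborel ?G"
      using tt t(1) t1(1) level pos by simp
    then have "measure lborel ?H = measure lborel ?F + measure lborel ?G"
      using cpt by (simp add: emeasure_lborel_compact flip: ennreal_plus)
    moreover have "x + y \<in> ?H" if "x \<in> ?F" "y \<in> ?G" for x y
    proof -
      have "ennreal (t * M) \<le> ?h (x + y)" using that by (intro sum[OF t(1) t1(1)]) (auto intro: ennreal_leI)
      then show ?thesis by (simp add: ennreal_le_iff section_vol_nonneg)
    qed
    ultimately have "convex ?F"
      using \<tau>B(2)[OF pos(2) t1(5)] cpt by (intro convex_of_measure_sum_le[of ?F ?G ?H]) (auto intro: fmeasurable_compact)
    then have "z \<in> ?F" using t1 xyz unfolding is_interval_convex_1[symmetric] is_interval_1 by blast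
    then show "z \<in> {s. 0 < ?A s}" using pos by simp
  qed
qed

section \<open>Matched marginals\<close>

lemma section_vol_borel:
  assumes A: "compact A" and u: "norm u = 1"
  shows "section_vol u A \<in> borel_measurable borel"
proof -
  have "(\<lambda>s. enn2real (ennreal (section_vol u A s))) \<in> borel_measurable borel"
    using section_vol_measurable[OF A u] by measurable
  then show ?thesis by (simp add: section_vol_nonneg)
qed

text \<open>The distribution function of the marginal of \<open>A\<close> in direction
  \<open>u\<close>; its density is the section function.\<close>

definition lower_vol :: "'a::euclidean_space \<Rightarrow> 'a set \<Rightarrow> real \<Rightarrow> real" where
  "lower_vol u A s = measure lborel (A \<inter> {x. x \<bullet> u \<le> s})"

text \<open>The two cuts are kept as successive intersections because the cutting lemma is applied
  twice, first to the lower and then to the upper face.\<close>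

abbreviation slab :: "'a::euclidean_space \<Rightarrow> real \<Rightarrow> real \<Rightarrow> 'a set \<Rightarrow> 'a set" where
  "slab u p q A \<equiv> (A \<inter> {x. p \<le> x \<bullet> u}) \<inter> {x. x \<bullet> u \<le> q}"

lemma compact_halfspaces:
  fixes u :: "'a::euclidean_space"
  assumes "compact A"
  shows "compact (A \<inter> {x. p \<le> x \<bullet> u})" "compact (A \<inter> {x. x \<bullet> u \<le> q})"
  using assms by (auto intro!: compact_Int_closed closed_Collect_le continuous_intros)

lemma section_vol_slab:
  fixes u :: "'a::euclidean_space"
  assumes u: "norm u = 1"
  shows "section_vol u (slab u p q A) s = section_vol u A s * indicator {p..q} s"
proof -
  have uu: "u \<bullet> u = 1" using u by (simp add: dot_square_norm)
  have "cylinder u 1 (slab u p q A) s = (if s \<in> {p..q} then cylinder u 1 A s else {})"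
    by (auto simp: cylinder_def inner_add_left uu)
  then show ?thesis by (simp add: section_vol_def)
qed

lemma measure_slab:
  fixes u :: "'a::euclidean_space" and p q :: real
  assumes A: "compact A" and u: "norm u = 1" and "p \<le> q"
  shows "measure lborel (slab u p q A) = lower_vol u A q - lower_vol u A p"
proof -
  have "u \<noteq> 0" using u by auto
  have eq: "(A \<inter> {x. x \<bullet> u \<le> q}) \<inter> {x. x \<bullet> u \<le> p} = A \<inter> {x. x \<bullet> u \<le> p}" using \<open>p \<le> q\<close> by auto
  have eq2: "(A \<inter> {x. x \<bullet> u \<le> q}) \<inter> {x. p \<le> x \<bullet> u} = slab u p q A" by auto
  show ?thesis
    using measure_lborel_halfspaces[OF compact_halfspaces(2)[OF A, of u q] \<open>u \<noteq> 0\<close>, of p]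
    unfolding lower_vol_def eq eq2 by simp
qed

lemma integral_section_vol:
  fixes u :: "'a::euclidean_space"
  assumes A: "compact A" and u: "norm u = 1" and "p \<le> q"
  shows "(\<integral>\<^sup>+s\<in>{p..q}. ennreal (section_vol u A s) \<partial>lborel) = ennreal (lower_vol u A q - lower_vol u A p)"
proof -
  have c: "compact (slab u p q A)" by (intro compact_halfspaces A)
  have "(\<integral>\<^sup>+s. ennreal (section_vol u (slab u p q A) s) \<partial>lborel)
      = (\<integral>\<^sup>+s\<in>{p..q}. ennreal (section_vol u A s) \<partial>lborel)"
    unfolding section_vol_slab[OF u]
    by (intro nn_integral_cong) (auto simp: indicator_def)
  then show ?thesis using nn_integral_section_vol[OF c u] measure_slab[OF A u \<open>p \<le> q\<close>] by simp
qed

lemma lower_vol_mono: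
  fixes u :: "'a::euclidean_space"
  assumes A: "compact A" and u: "norm u = 1" and "p \<le> q"
  shows "lower_vol u A p \<le> lower_vol u A q"
  using measure_slab[OF assms] measure_nonneg[of lborel "slab u p q A"] by linarith

lemma lower_vol_continuous:
  fixes u :: "'a::euclidean_space"
  assumes A: "compact A" and u: "norm u = 1"
  shows "continuous_on UNIV (lower_vol u A)"
proof -
  obtain c where c: "\<And>s. section_vol u A s \<le> c" using section_vol_bounded[OF A u] by metis
  have "0 \<le> c" using c[of 0] section_vol_nonneg[of u A 0] by linarith
  have lip: "lower_vol u A q - lower_vol u A p \<le> c * (q - p)" if "p \<le> q" for p q
  proof -
    have "ennreal (lower_vol u A q - lower_vol u A p) \<le> (\<integral>\<^sup>+s\<in>{p..q}. ennreal c \<partial>lborel)"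
      unfolding integral_section_vol[OF A u that, symmetric]
      by (intro nn_integral_mono) (auto simp: indicator_def intro: ennreal_leI c)
    also have "\<dots> = ennreal (c * (q - p))" using that \<open>0 \<le> c\<close> by (simp add: nn_integral_cmult ennreal_mult)
    finally show ?thesis using that \<open>0 \<le> c\<close> by (simp add: ennreal_le_iff)
  qed
  have "c-lipschitz_on UNIV (lower_vol u A)"
  proof (rule lipschitz_onI)
    fix p q
    have "\<bar>lower_vol u A p - lower_vol u A q\<bar> \<le> c * \<bar>p - q\<bar>"
      using lip[of p q] lip[of q p] lower_vol_mono[OF A u, of p q] lower_vol_mono[OF A u, of q p]
      by (cases "p \<le> q") auto
    then show "dist (lower_vol u A p) (lower_vol u A q) \<le> c * dist p q" by (simp add: dist_real_def)
  qed (rule \<open>0 \<le> c\<close>)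
  then show ?thesis by (rule lipschitz_on_continuous_on)
qed

lemma lower_vol_far:
  fixes u :: "'a::euclidean_space"
  assumes A: "compact A" and u: "norm u = 1"
  obtains K where "lower_vol u A (- K) = 0" "lower_vol u A K = measure lborel A" "0 < K"
    "\<And>s. s \<le> - K \<Longrightarrow> lower_vol u A s = 0" "\<And>s. K \<le> s \<Longrightarrow> lower_vol u A s = measure lborel A"
proof -
  obtain K where K: "0 < K" "\<And>x. x \<in> A \<Longrightarrow> norm x \<le> K"
    using compact_imp_bounded[OF A] by (auto simp: bounded_pos)
  have b: "\<bar>x \<bullet> u\<bar> \<le> K" if "x \<in> A" for x
    using Cauchy_Schwarz_ineq2[of x u] K(2)[OF that] u by simp
  have lo: "lower_vol u A s = 0" if "s \<le> - (K + 1)" for s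
  proof -
    have "A \<inter> {x. x \<bullet> u \<le> s} = {}" using b that by fastforce
    then show ?thesis by (simp add: lower_vol_def)
  qed
  have hi: "lower_vol u A s = measure lborel A" if "K + 1 \<le> s" for s
  proof -
    have "A \<inter> {x. x \<bullet> u \<le> s} = A" using b that by fastforce
    then show ?thesis by (simp add: lower_vol_def)
  qed
  show thesis using that[of "K + 1"] lo hi K(1) by force
qed

lemma lower_vol_bounds:
  fixes u :: "'a::euclidean_space"
  assumes A: "compact A" and u: "norm u = 1"
  shows "0 \<le> lower_vol u A s" "lower_vol u A s \<le> measure lborel A"
  using measure_lborel_mono[OF compact_halfspaces(2)[OF A] A, of u s] by (auto simp: lower_vol_def)

lemma lower_vol_IVT:
  fixes u :: "'a::euclidean_space"
  assumes A: "compact A" and u: "norm u = 1" and v: "0 < v" "v < measure lborel A"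
  obtains s where "lower_vol u A s = v"
proof -
  obtain K where K: "lower_vol u A (- K) = 0" "lower_vol u A K = measure lborel A" "0 < K"
    using lower_vol_far[OF A u] by metis
  have "continuous_on {- K..K} (lower_vol u A)"
    using lower_vol_continuous[OF A u] by (rule continuous_on_subset) auto
  from IVT'[of "lower_vol u A" "- K" v K, OF _ _ _ this] K v show thesis using that by auto
qed

context
  fixes A B :: "'a::euclidean_space set" and r :: real and u :: 'a and m :: nat
  assumes eq: "BM_equal r A B" and u: "norm u = 1" and n: "DIM('a) = Suc m" "0 < m"
begin

lemma BM_equalD: "compact A" "compact B" "0 < r" "0 < measure lborel A"
  "measure lborel B = r ^ DIM('a) * measure lborel A" "0 < measure lborel B"
  using eq by (auto simp: BM_equal_def)

text \<open>There is positive volume below \<open>s1\<close> and above \<open>s2\<close>, hence a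
  nonempty section on either side of \<open>s\<close> with positive volume, and the set of such
  heights is convex.\<close>

lemma BM_equal_section_pos:
  assumes s1: "0 < lower_vol u A s1" and s2: "lower_vol u A s2 < measure lborel A" and s: "s1 \<le> s" "s \<le> s2"
  shows "0 < section_vol u A s"
proof -
  note A = BM_equalD(1)
  obtain K where K: "0 < K" "\<And>s. s \<le> - K \<Longrightarrow> lower_vol u A s = 0" "\<And>s. K \<le> s \<Longrightarrow> lower_vol u A s = measure lborel A"
    using lower_vol_far[OF A u] by metis
  have ex: "\<exists>\<sigma>\<in>{p..q}. 0 < section_vol u A \<sigma>" if "p \<le> q" "lower_vol u A p < lower_vol u A q" for p q
  proof (rule ccontr)
    assume "\<not> ?thesis"
    then have "section_vol u A \<sigma> = 0" if "\<sigma> \<in> {p..q}" for \<sigma>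
      using that section_vol_nonneg[of u A \<sigma>] order_le_less[of 0 "section_vol u A \<sigma>"] by auto
    then have "(\<integral>\<^sup>+s\<in>{p..q}. ennreal (section_vol u A s) \<partial>lborel) = (\<integral>\<^sup>+s. 0 \<partial>(lborel :: real measure))"
      by (intro nn_integral_cong) (auto simp: indicator_def)
    then show False using integral_section_vol[OF A u \<open>p \<le> q\<close>] that by simp
  qed
  have "- K \<le> s1" using K(2)[of s1] s1 by (cases "s1 \<le> - K") auto
  then obtain \<sigma> where \<sigma>: "\<sigma> \<le> s1" "0 < section_vol u A \<sigma>" using ex[of "- K" s1] K(2)[of "- K"] s1 by auto
  have "s2 \<le> K" using K(3)[of s2] s2 by (cases "K \<le> s2") auto
  then obtain \<rho> where \<rho>: "s2 \<le> \<rho>" "0 < section_vol u A \<rho>" using ex[of s2 K] K(3)[of K] s2 by auto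
  have "is_interval {s. 0 < section_vol u A s}"
    unfolding is_interval_convex_1 by (rule BM_equal_section_convex[OF eq u n])
  then have "s \<in> {s. 0 < section_vol u A s}"
    by (rule mem_is_interval_1_I[of _ \<sigma> \<rho>]) (use \<sigma> \<rho> s in auto)
  then show ?thesis by simp
qed

text \<open>A positive density makes the distribution function strictly increasing. This makes
  matched heights unique.\<close>

lemma BM_equal_lower_vol_strict:
  assumes s1: "0 < lower_vol u A s1" and s2: "lower_vol u A s2 < measure lborel A" and s: "s1 < s2"
  shows "lower_vol u A s1 < lower_vol u A s2"
proof (rule ccontr)
  note A = BM_equalD(1)
  assume "\<not> ?thesis"
  then have "(\<integral>\<^sup>+s\<in>{s1..s2}. ennreal (section_vol u A s) \<partial>lborel) = 0"
    using integral_section_vol[OF A u] s by (simp add: ennreal_eq_0_iff)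
  then have "AE s in lborel. ennreal (section_vol u A s) * indicator {s1..s2} s = 0"
    using section_vol_measurable[OF A u] by (subst (asm) nn_integral_0_iff_AE) auto
  then have "AE s in lborel. s \<notin> {s1..s2}"
  proof eventually_elim
    case (elim s)
    then show ?case using BM_equal_section_pos[OF s1 s2, of s] by (auto simp: indicator_def split: if_splits)
  qed
  then have "emeasure lborel {s1..s2} = 0" by (subst (asm) AE_iff_measurable[where N="{s1..s2}"]) auto
  then show False using s by simp
qed

text \<open>Two successive cuts; after the first one the volumes at the second still match, being
  differences of matched volumes.\<close>

lemma BM_equal_slab:
  assumes p: "lower_vol u B p' = r ^ DIM('a) * lower_vol u A p" and q: "lower_vol u B q' = r ^ DIM('a) * lower_vol u A q"
    and le: "p \<le> q" "p' \<le> q'" and pos: "lower_vol u A p < lower_vol u A q"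
  shows "BM_equal r (slab u p q A) (slab u p' q' B)"
proof (rule BM_equal_halfspace(1))
  note AB = BM_equalD
  show u0: "u \<noteq> 0" using u by auto
  have "0 < measure lborel (slab u p q A)" using measure_slab[OF AB(1) u le(1)] pos by simp
  then show "0 < measure lborel (A \<inter> {x. p \<le> x \<bullet> u} \<inter> {x. x \<bullet> u \<le> q})" .
  also have "\<dots> \<le> measure lborel (A \<inter> {x. p \<le> x \<bullet> u})"
    by (intro measure_lborel_mono compact_halfspaces AB) auto
  finally show "BM_equal r (A \<inter> {x. p \<le> x \<bullet> u}) (B \<inter> {x. p' \<le> x \<bullet> u})"
    using p by (intro BM_equal_halfspace(2)[OF eq u0]) (auto simp: lower_vol_def)
  show "measure lborel (slab u p' q' B) = r ^ DIM('a) * measure lborel (slab u p q A)"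
    unfolding measure_slab[OF AB(1) u le(1)] measure_slab[OF AB(2) u le(2)] p q right_diff_distrib ..
qed

text \<open>The bound on the largest sections is applied to thin matched slabs around \<open>s\<close>.\<close>

lemma BM_equal_section_le:
  assumes s: "lower_vol u B s' = r ^ DIM('a) * lower_vol u A s" "0 < lower_vol u A s" "lower_vol u A s < measure lborel A"
  shows "section_vol u B s' \<le> r ^ m * section_vol u A s"
proof (rule ccontr)
  note AB = BM_equalD
  note A = AB(1) and B = AB(2)
  assume "\<not> ?thesis"
  moreover have rm: "0 < r ^ m" using AB(3) by simp
  ultimately have "section_vol u A s < section_vol u B s' / r ^ m" by (simp add: pos_less_divide_eq mult.commute)
  then obtain c where c: "section_vol u A s < c" "c < section_vol u B s' / r ^ m" using dense by blast
  have "0 < c" using c(1) section_vol_nonneg[of u A s] by linarith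
  \<comment> \<open>Upper semicontinuity: sections near \<open>s\<close> stay below
    \<open>c\<close>. Lower semicontinuity is not at hand, so only this one-sided bound is drawn;
    the opposite one comes from exchanging \<open>A\<close> and \<open>B\<close>.\<close>
  have "open (- {\<sigma>. c \<le> section_vol u A \<sigma>})"
    using compact_section_superlevel[OF A u \<open>0 < c\<close>] by (simp add: compact_imp_closed open_Compl)
  moreover have "open (lower_vol u A -` {0<..<measure lborel A})"
    using lower_vol_continuous[OF A u] by (simp add: continuous_on_open_vimage)
  ultimately have "open (- {\<sigma>. c \<le> section_vol u A \<sigma>} \<inter> lower_vol u A -` {0<..<measure lborel A})" (is "open ?U")
    by (rule open_Int)
  moreover have "s \<in> ?U" using c s by auto
  ultimately obtain \<delta> where \<delta>: "0 < \<delta>" "\<And>\<sigma>. \<bar>\<sigma> - s\<bar> \<le> \<delta> \<Longrightarrow> \<sigma> \<in> ?U"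
    unfolding open_contains_cball by (force simp: dist_real_def abs_minus_commute)
  define p where "p = s - \<delta>"
  define q where "q = s + \<delta>"
  have pq: "p \<in> ?U" "q \<in> ?U" using \<delta>(2)[of p] \<delta>(2)[of q] \<delta>(1) by (auto simp: p_def q_def)
  have "p < s" "s < q" using \<delta>(1) by (auto simp: p_def q_def)
  have Ap: "lower_vol u A p < lower_vol u A s" by (rule BM_equal_lower_vol_strict) (use pq s \<open>p < s\<close> in auto)
  have Aq: "lower_vol u A s < lower_vol u A q" by (rule BM_equal_lower_vol_strict) (use pq s \<open>s < q\<close> in auto)
  have r: "0 < r ^ DIM('a)" using AB(3) by simp
  \<comment> \<open>\<open>B\<close> is cut at heights that leave the same volume proportion below
    them as \<open>p\<close> and \<open>q\<close> do in \<open>A\<close>; these enclose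
    \<open>s'\<close>.\<close>
  obtain p' where p': "lower_vol u B p' = r ^ DIM('a) * lower_vol u A p"
    using lower_vol_IVT[OF B u, of "r ^ DIM('a) * lower_vol u A p"] pq r AB(5) by auto
  obtain q' where q': "lower_vol u B q' = r ^ DIM('a) * lower_vol u A q"
    using lower_vol_IVT[OF B u, of "r ^ DIM('a) * lower_vol u A q"] pq r AB(5) by auto
  have "lower_vol u B p' < lower_vol u B s'" "lower_vol u B s' < lower_vol u B q'"
    using p' q' s Ap Aq r by simp_all
  then have le': "p' \<le> s'" "s' \<le> q'"
    using lower_vol_mono[OF B u, of s' p'] lower_vol_mono[OF B u, of q' s'] by force+
  have "BM_equal r (slab u p q A) (slab u p' q' B)"
    using p' q' le' \<open>p < s\<close> \<open>s < q\<close> Ap Aq by (intro BM_equal_slab) auto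
  moreover have "section_vol u (slab u p q A) \<sigma> \<le> c" for \<sigma>
  proof (cases "\<sigma> \<in> {p..q}")
    case True
    then have "\<sigma> \<in> ?U" by (intro \<delta>(2)) (auto simp: p_def q_def)
    then show ?thesis using True by (simp add: section_vol_slab[OF u])
  qed (use \<open>0 < c\<close> in \<open>simp add: section_vol_slab[OF u]\<close>)
  ultimately have "section_vol u (slab u p' q' B) s' \<le> r ^ m * c"
    by (rule BM_equal_section_bound[OF _ u n])
  then have "section_vol u B s' \<le> r ^ m * c" using le' unfolding section_vol_slab[OF u] by simp
  then show False using c(2) rm by (simp add: pos_less_divide_eq mult.commute)
qed

end

text \<open>\<open>F\<close> transports the measure with density \<open>k * f\<close> to the one
  with density \<open>g\<close>. Differentiating would give \<open>F' = k * f / g (F) = r\<close>,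
  but the densities are only measurable. Instead \<open>1 / g\<close> is integrated against the
  transported measure: on one side this is the length \<open>q' - p'\<close>, on the other the
  integral of the constant \<open>r\<close> over \<open>[p, q]\<close>.\<close>

lemma transport_affine:
  fixes f g \<Phi> \<Psi> F :: "real \<Rightarrow> real"
  assumes [measurable]: "f \<in> borel_measurable borel" "g \<in> borel_measurable borel"
    and pos: "\<And>x. x \<in> {p..q} \<Longrightarrow> 0 < f x" "\<And>x. x \<in> {p'..q'} \<Longrightarrow> 0 < g x" "0 < k" "0 < r"
    and \<Phi>: "\<And>x y. p \<le> x \<Longrightarrow> x \<le> y \<Longrightarrow> y \<le> q \<Longrightarrow> (\<integral>\<^sup>+s\<in>{x..y}. ennreal (f s) \<partial>lborel) = ennreal (\<Phi> y - \<Phi> x)"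
    and \<Psi>: "\<And>x y. p' \<le> x \<Longrightarrow> x \<le> y \<Longrightarrow> y \<le> q' \<Longrightarrow> (\<integral>\<^sup>+s\<in>{x..y}. ennreal (g s) \<partial>lborel) = ennreal (\<Psi> y - \<Psi> x)"
    and F: "strict_mono_on {p..q} F" "F p = p'" "F q = q'" "{p'..q'} \<subseteq> F ` {p..q}"
    and F\<Phi>: "\<And>x. x \<in> {p..q} \<Longrightarrow> \<Psi> (F x) = k * \<Phi> x"
    and Fg: "\<And>x. x \<in> {p..q} \<Longrightarrow> r * g (F x) = k * f x"
    and "p \<le> q"
  shows "q' - p' = r * (q - p)"
proof -
  have Fm: "F x < F y \<longleftrightarrow> x < y" if "x \<in> {p..q}" "y \<in> {p..q}" for x y
    using F(1) that by (rule strict_mono_on_less)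
  have Fr: "F x \<in> {p'..q'}" if "x \<in> {p..q}" for x
    using Fm[of x p] Fm[of q x] that F(2,3) \<open>p \<le> q\<close> by force
  have "p' \<le> q'" using Fr[of p] F(2) \<open>p \<le> q\<close> by simp
  \<comment> \<open>A monotone extension of \<open>F\<close> to the whole line, hence Borel
    measurable.\<close>
  define G where "G x = (if x < p then p' else if q < x then q' else F x)" for x
  have "mono G"
  proof (rule monoI)
    fix x y :: real assume "x \<le> y"
    show "G x \<le> G y"
    proof (cases "x \<in> {p..q} \<and> y \<in> {p..q}")
      case True
      then show ?thesis using Fm[of y x] \<open>x \<le> y\<close> by (simp add: G_def)
    next
      case False
      then show ?thesis using Fr[of x] Fr[of y] \<open>x \<le> y\<close> \<open>p' \<le> q'\<close> by (auto simp: G_def)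
    qed
  qed
  then have [measurable]: "G \<in> borel_measurable borel" by (rule borel_measurable_mono)
  define M where "M = density lborel (\<lambda>x. ennreal (k * f x) * indicator {p..q} x)"
  define N where "N = density lborel (\<lambda>x. ennreal (g x) * indicator {p'..q'} x)"
  \<comment> \<open>The mass of a set that agrees on \<open>[p, q]\<close> with the ray above
    \<open>z\<close>, up to the point \<open>z\<close> itself; preimages of rays under
    \<open>G\<close> are of this kind.\<close>
  have f_int: "(\<integral>\<^sup>+s. ennreal (k * f s) * indicator {p..q} s * indicator S s \<partial>lborel) = ennreal (k * (\<Phi> q - \<Phi> z))"
    if "p \<le> z" "z \<le> q" and S: "\<And>s. s \<in> {p..q} \<Longrightarrow> s \<noteq> z \<Longrightarrow> s \<in> S \<longleftrightarrow> z < s" for z S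
  proof -
    have "(\<integral>\<^sup>+s. ennreal (k * f s) * indicator {p..q} s * indicator S s \<partial>lborel)
       = (\<integral>\<^sup>+s. ennreal k * (ennreal (f s) * indicator {z..q} s) \<partial>lborel)"
    proof (rule nn_integral_cong_AE, rule AE_I'[of "{z}"], simp add: finite_imp_null_set_lborel, rule subsetI)
      fix s assume s: "s \<in> {s \<in> space lborel. ennreal (k * f s) * indicator {p..q} s * indicator S s
          \<noteq> ennreal k * (ennreal (f s) * indicator {z..q} s)}"
      show "s \<in> {z}"
      proof (rule ccontr)
        assume "s \<notin> {z}"
        then show False using s S[of s] pos(1)[of s] pos(3) that(1,2)
          by (cases "s \<in> {p..q}") (auto simp: indicator_def ennreal_mult split: if_splits)
      qed
    qed
    also have "\<dots> = ennreal k * ennreal (\<Phi> q - \<Phi> z)"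
      using \<Phi>[OF that(1,2)] by (simp add: nn_integral_cmult)
    finally show ?thesis using pos(3) by (simp add: ennreal_mult')
  qed
  have g_int: "(\<integral>\<^sup>+s. ennreal (g s) * indicator {p'..q'} s * indicator S s \<partial>lborel) = ennreal (\<Psi> q' - \<Psi> z)"
    if "p' \<le> z" "z \<le> q'" and S: "\<And>s. s \<in> {p'..q'} \<Longrightarrow> s \<noteq> z \<Longrightarrow> s \<in> S \<longleftrightarrow> z < s" for z S
  proof -
    have "(\<integral>\<^sup>+s. ennreal (g s) * indicator {p'..q'} s * indicator S s \<partial>lborel)
       = (\<integral>\<^sup>+s. ennreal (g s) * indicator {z..q'} s \<partial>lborel)"
    proof (rule nn_integral_cong_AE, rule AE_I'[of "{z}"], simp add: finite_imp_null_set_lborel, rule subsetI)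
      fix s assume s: "s \<in> {s \<in> space lborel. ennreal (g s) * indicator {p'..q'} s * indicator S s
          \<noteq> ennreal (g s) * indicator {z..q'} s}"
      show "s \<in> {z}"
      proof (rule ccontr)
        assume "s \<notin> {z}"
        then show False using s S[of s] that(1,2)
          by (cases "s \<in> {p'..q'}") (auto simp: indicator_def split: if_splits)
      qed
    qed
    then show ?thesis using \<Psi>[OF that(1,2)] by simp
  qed
  have eM: "emeasure (distr M borel G) {x<..} = (\<integral>\<^sup>+s. ennreal (k * f s) * indicator {p..q} s * indicator {s. x < G s} s \<partial>lborel)" for x
  proof -
    have "G -` {x<..} = {s. x < G s}" by auto
    then show ?thesis by (simp add: M_def emeasure_distr emeasure_density)
  qed
  have eN: "emeasure N {x<..} = (\<integral>\<^sup>+s. ennreal (g s) * indicator {p'..q'} s * indicator {x<..} s \<partial>lborel)" for x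
    by (simp add: N_def emeasure_density)
  have "distr M borel G = N"
  proof (rule measure_eqI_lessThan)
    fix x
    consider "x < p'" | "q' \<le> x" | "p' \<le> x" "x < q'" by linarith
    then have "emeasure (distr M borel G) {x<..} = emeasure N {x<..} \<and> emeasure N {x<..} < \<infinity>"
    proof cases
      case 1
      have "emeasure (distr M borel G) {x<..} = ennreal (k * (\<Phi> q - \<Phi> p))"
        unfolding eM
      proof (rule f_int)
        fix s assume s: "s \<in> {p..q}" "s \<noteq> p"
        then have "x < F s" using Fr[of s] 1 by simp
        then show "s \<in> {s. x < G s} \<longleftrightarrow> p < s" using s by (simp add: G_def)
      qed (use \<open>p \<le> q\<close> in auto)
      moreover have "emeasure N {x<..} = ennreal (\<Psi> q' - \<Psi> p')"
        unfolding eN using 1 by (intro g_int) (use \<open>p' \<le> q'\<close> in auto)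
      ultimately show ?thesis using F\<Phi>[of p] F\<Phi>[of q] F(2,3) \<open>p \<le> q\<close> by (simp add: algebra_simps)
    next
      case 2
      have "emeasure (distr M borel G) {x<..} = ennreal (k * (\<Phi> q - \<Phi> q))"
        unfolding eM
      proof (rule f_int)
        fix s assume s: "s \<in> {p..q}"
        then have "\<not> x < F s" using Fr[of s] 2 by simp
        then show "s \<in> {s. x < G s} \<longleftrightarrow> q < s" using s by (simp add: G_def)
      qed (use \<open>p \<le> q\<close> in auto)
      moreover have "emeasure N {x<..} = ennreal (\<Psi> q' - \<Psi> q')"
        unfolding eN using 2 by (intro g_int) (use \<open>p' \<le> q'\<close> in auto)
      ultimately show ?thesis by simp
    next
      case 3
      then obtain z where z: "z \<in> {p..q}" "F z = x" using F(4) by force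
      have "emeasure (distr M borel G) {x<..} = ennreal (k * (\<Phi> q - \<Phi> z))"
        unfolding eM
      proof (rule f_int)
        fix s assume "s \<in> {p..q}"
        then show "s \<in> {s. x < G s} \<longleftrightarrow> z < s" using Fm[OF z(1), of s] z(2) by (simp add: G_def)
      qed (use z in auto)
      moreover have "emeasure N {x<..} = ennreal (\<Psi> q' - \<Psi> x)"
        unfolding eN using 3 by (intro g_int) auto
      ultimately show ?thesis using F\<Phi>[of z] F\<Phi>[of q] F(2,3) z \<open>p \<le> q\<close> by (simp add: algebra_simps)
    qed
    then show "emeasure (distr M borel G) {x<..} = emeasure N {x<..}" "emeasure (distr M borel G) {x<..} < \<infinity>" by auto
  qed (simp_all add: N_def)
  have "ennreal (q' - p') = (\<integral>\<^sup>+s. indicator {p'..q'} s \<partial>lborel)" using \<open>p' \<le> q'\<close> by simp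
  also have "\<dots> = (\<integral>\<^sup>+s. ennreal (g s) * indicator {p'..q'} s * ennreal (1 / g s) \<partial>lborel)"
  proof (rule nn_integral_cong)
    fix s show "indicator {p'..q'} s = ennreal (g s) * indicator {p'..q'} s * ennreal (1 / g s)"
      using pos(2)[of s] by (cases "s \<in> {p'..q'}") (auto simp flip: ennreal_mult)
  qed
  also have "\<dots> = (\<integral>\<^sup>+s. ennreal (1 / g s) \<partial>N)"
    by (simp add: N_def nn_integral_density)
  also have "\<dots> = (\<integral>\<^sup>+s. ennreal (1 / g s) \<partial>distr M borel G)" by (simp add: \<open>distr M borel G = N\<close>)
  also have "\<dots> = (\<integral>\<^sup>+s. ennreal (1 / g (G s)) \<partial>M)" by (simp add: nn_integral_distr M_def)
  also have "\<dots> = (\<integral>\<^sup>+s. ennreal (k * f s) * indicator {p..q} s * ennreal (1 / g (G s)) \<partial>lborel)"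
    by (simp add: M_def nn_integral_density)
  also have "\<dots> = (\<integral>\<^sup>+s. ennreal r * indicator {p..q} s \<partial>lborel)"
  proof (rule nn_integral_cong)
    fix s show "ennreal (k * f s) * indicator {p..q} s * ennreal (1 / g (G s)) = ennreal r * indicator {p..q} s"
    proof (cases "s \<in> {p..q}")
      case True
      then have "0 < g (F s)" using Fr pos(2) by blast
      then have "k * f s * (1 / g (F s)) = r" using Fg[OF True] by (simp add: field_simps)
      moreover have "G s = F s" using True by (simp add: G_def)
      ultimately show ?thesis using True pos(1)[OF True] pos(3) \<open>0 < g (F s)\<close> by (simp flip: ennreal_mult)
    qed simp
  qed
  also have "\<dots> = ennreal (r * (q - p))" using pos(4) \<open>p \<le> q\<close> by (simp add: nn_integral_cmult ennreal_mult)
  finally show ?thesis using pos(4) \<open>p \<le> q\<close> \<open>p' \<le> q'\<close> by simp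
qed

text \<open>At matched heights the section volumes have ratio exactly \<open>r ^ m\<close>, while
  the volumes have ratio \<open>k = r * r ^ m\<close>. The height map therefore meets the transport
  lemma with slope \<open>r\<close> and is affine on \<open>D\<close>; the two ends follow by
  monotonicity.\<close>

lemma BM_equal_lower_vol_affine:
  fixes A B :: "'a::euclidean_space set"
  assumes eq: "BM_equal r A B" and u: "norm u = 1" and n: "DIM('a) = Suc m" "0 < m"
  obtains c where "\<And>s. lower_vol u B (r * s + c) = r ^ DIM('a) * lower_vol u A s"
proof -
  note AB = BM_equalD[OF eq u n]
  note A = AB(1) and B = AB(2)
  note eq' = BM_equal_sym[OF eq]
  define k where "k = r ^ DIM('a)"
  have k: "0 < k" "k = r * r ^ m" using AB(3) n by (simp_all add: k_def)
  have vB: "measure lborel B = k * measure lborel A" using AB(5) by (simp add: k_def)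
  define D where "D = {s. 0 < lower_vol u A s \<and> lower_vol u A s < measure lborel A}"
  \<comment> \<open>The matched height, which exists by the intermediate value theorem.\<close>
  define F where "F s = (SOME s'. lower_vol u B s' = k * lower_vol u A s)" for s
  have F: "lower_vol u B (F s) = k * lower_vol u A s" if "s \<in> D" for s
  proof -
    have "0 < k * lower_vol u A s" "k * lower_vol u A s < measure lborel B" using that k(1) vB by (auto simp: D_def)
    then obtain s' where "lower_vol u B s' = k * lower_vol u A s" using lower_vol_IVT[OF B u] by metis
    then show ?thesis unfolding F_def by (rule someI)
  qed
  have FB: "0 < lower_vol u B (F s)" "lower_vol u B (F s) < measure lborel B" if "s \<in> D" for s
    using F[OF that] that k(1) vB by (auto simp: D_def)
  have strictA: "lower_vol u A s < lower_vol u A t" if "s \<in> D" "t \<in> D" "s < t" for s t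
    using BM_equal_lower_vol_strict[OF eq u n] that by (auto simp: D_def)
  have strictB: "lower_vol u B s < lower_vol u B t"
    if "0 < lower_vol u B s" "lower_vol u B t < measure lborel B" "s < t" for s t
    using BM_equal_lower_vol_strict[OF eq' u n] that by auto
  have Fmono: "F s < F t" if "s \<in> D" "t \<in> D" "s < t" for s t
  proof -
    have "lower_vol u B (F s) < lower_vol u B (F t)" using strictA[OF that] F[OF that(1)] F[OF that(2)] k(1) by simp
    then show ?thesis using lower_vol_mono[OF B u, of "F t" "F s"] by force
  qed
  have D_between: "s \<in> D" if "p \<in> D" "q \<in> D" "s \<in> {p..q}" for p q s
    using that lower_vol_mono[OF A u, of p s] lower_vol_mono[OF A u, of s q] by (auto simp: D_def)
  have sec: "section_vol u B (F s) = r ^ m * section_vol u A s" if s: "s \<in> D" for s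
  proof (rule antisym)
    show "section_vol u B (F s) \<le> r ^ m * section_vol u A s"
      using BM_equal_section_le[OF eq u n] F[OF s] s by (simp add: D_def k_def)
    \<comment> \<open>The reverse inequality is the same lemma for the exchanged pair, whose ratio
      is \<open>1 / r\<close>.\<close>
    have "section_vol u A s \<le> (1 / r) ^ m * section_vol u B (F s)"
      using F[OF s] FB[OF s] AB(3) by (intro BM_equal_section_le[OF eq' u n]) (auto simp: k_def power_divide)
    then show "r ^ m * section_vol u A s \<le> section_vol u B (F s)" using AB(3) by (simp add: field_simps)
  qed
  have affine: "F q - F p = r * (q - p)" if pq: "p \<in> D" "q \<in> D" "p \<le> q" for p q
  proof (rule transport_affine[where f="section_vol u A" and g="section_vol u B" and k=k
        and \<Phi>="lower_vol u A" and \<Psi>="lower_vol u B" and F=F])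
    show "0 < section_vol u A x" if "x \<in> {p..q}" for x
      using BM_equal_section_pos[OF eq u n, of p q x] pq that by (auto simp: D_def)
    show "0 < section_vol u B x" if "x \<in> {F p..F q}" for x
      using BM_equal_section_pos[OF eq' u n, of "F p" "F q" x] that FB(1)[OF pq(1)] FB(2)[OF pq(2)] by simp
    show "strict_mono_on {p..q} F" 
      by (rule strict_mono_onI, rule Fmono[OF D_between[OF pq(1,2)] D_between[OF pq(1,2)]])
    show "{F p..F q} \<subseteq> F ` {p..q}"
    proof
      fix x assume x: "x \<in> {F p..F q}"
      have bx: "k * lower_vol u A p \<le> lower_vol u B x" "lower_vol u B x \<le> k * lower_vol u A q"
        using x lower_vol_mono[OF B u, of "F p" x] lower_vol_mono[OF B u, of x "F q"] F[OF pq(1)] F[OF pq(2)] by auto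
      have "continuous_on {p..q} (lower_vol u A)"
        using lower_vol_continuous[OF A u] by (rule continuous_on_subset) auto
      moreover have "lower_vol u A p \<le> lower_vol u B x / k" "lower_vol u B x / k \<le> lower_vol u A q"
        using bx k(1) by (simp_all add: field_simps)
      ultimately obtain z where z: "p \<le> z" "z \<le> q" "lower_vol u A z = lower_vol u B x / k"
        using IVT'[of "lower_vol u A" p "lower_vol u B x / k" q] pq(3) by blast
      then have zD: "z \<in> D" using D_between[OF pq(1,2), of z] by auto
      have eqz: "lower_vol u B (F z) = lower_vol u B x" using F[OF zD] z(3) k(1) by simp
      have "F z = x"
      proof (rule ccontr)
        assume "F z \<noteq> x"
        then show False using strictB[of "F z" x] strictB[of x "F z"] FB[OF zD] eqz by (cases "F z < x") auto
      qed
      then show "x \<in> F ` {p..q}" using z by auto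
    qed
    show "lower_vol u B (F x) = k * lower_vol u A x" if "x \<in> {p..q}" for x
      by (rule F[OF D_between[OF pq(1,2) that]])
    show "r * section_vol u B (F x) = k * section_vol u A x" if "x \<in> {p..q}" for x
      using sec D_between[OF pq(1,2) that] k(2) by simp
  qed (use A B u AB(3) k(1) pq in \<open>auto intro: section_vol_borel integral_section_vol\<close>)
  \<comment> \<open>Halving the volume shows that \<open>D\<close> is nonempty; its matched height
    fixes the constant of the affine map.\<close>
  obtain s0 where "lower_vol u A s0 = measure lborel A / 2" 
    using lower_vol_IVT[OF A u, of "measure lborel A / 2"] AB(4) by auto
  then have s0: "s0 \<in> D" using AB(4) by (simp add: D_def)
  define c where "c = F s0 - r * s0"
  have Fc: "F s = r * s + c" if "s \<in> D" for s
    using affine[OF s0 that] affine[OF that s0] by (cases "s0 \<le> s") (auto simp: c_def algebra_simps)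
  have onD: "lower_vol u B (r * s + c) = k * lower_vol u A s" if "s \<in> D" for s
    using F[OF that] Fc[OF that] by simp
  have "lower_vol u B (r * s + c) = k * lower_vol u A s" for s
  proof -
    consider "s \<in> D" | "lower_vol u A s = 0" | "lower_vol u A s = measure lborel A"
      using lower_vol_bounds[OF A u, of s] unfolding D_def by fastforce
    then show ?thesis
    proof cases
      case 2
      have "\<not> 0 < lower_vol u B (r * s + c)"
      proof
        assume v: "0 < lower_vol u B (r * s + c)" (is "0 < ?v")
        \<comment> \<open>A volume in the open range that is smaller than \<open>?v / k\<close>: the
          height \<open>t\<close> that has it lies above \<open>s\<close>, yet its image would carry
          less volume than the image of \<open>s\<close>.\<close>
        define w where "w = min (?v / k) (measure lborel A) / 2"
        have "0 < ?v / k" using v k(1) by simp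
        moreover have "0 < min x y / 2 \<and> min x y / 2 < x \<and> min x y / 2 < y" if "0 < x" "0 < y" for x y :: real
          using that by (auto simp: min_def)
        ultimately have w: "0 < w" "w < ?v / k" "w < measure lborel A" using AB(4) unfolding w_def by blast+
        have wk: "w * k < ?v" using w(2) k(1) by (simp only: pos_less_divide_eq)
        obtain t where t: "lower_vol u A t = w" using lower_vol_IVT[OF A u w(1,3)] .
        then have "t \<in> D" using w by (simp add: D_def)
        have "s \<le> t" using lower_vol_mono[OF A u, of t s] t w 2 by force
        then have "r * s + c \<le> r * t + c" using AB(3) by simp
        then have "?v \<le> lower_vol u B (r * t + c)" by (rule lower_vol_mono[OF B u])
        then show False using onD[OF \<open>t \<in> D\<close>] t wk by (simp add: mult.commute)
      qed
      then show ?thesis using 2 lower_vol_bounds[OF B u, of "r * s + c"] by simp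
    next
      case 3
      have "\<not> lower_vol u B (r * s + c) < measure lborel B"
      proof
        assume v: "lower_vol u B (r * s + c) < measure lborel B" (is "?v < _")
        \<comment> \<open>The mirror image: a volume between \<open>?v / k\<close> and the total
          one, attained at a height below \<open>s\<close> whose image would carry more than
          \<open>?v\<close>.\<close>
        define w where "w = (?v / k + measure lborel A) / 2"
        have "?v < measure lborel A * k" using v vB by (simp only: mult.commute)
        then have "?v / k < measure lborel A" using k(1) by (simp only: pos_divide_less_eq)
        moreover have "0 \<le> ?v / k" using lower_vol_bounds[OF B u] k(1) by simp
        moreover have "0 < (x + y) / 2 \<and> x < (x + y) / 2 \<and> (x + y) / 2 < y" if "x < y" "0 \<le> x" for x y :: real
          using that by auto
        ultimately have w: "0 < w" "?v / k < w" "w < measure lborel A" unfolding w_def by blast+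
        obtain t where t: "lower_vol u A t = w" using lower_vol_IVT[OF A u w(1,3)] .
        then have "t \<in> D" using w by (simp add: D_def)
        have "t \<le> s" using lower_vol_mono[OF A u, of s t] t w 3 by force
        then have "r * t + c \<le> r * s + c" using AB(3) by simp
        then have "lower_vol u B (r * t + c) \<le> ?v" by (rule lower_vol_mono[OF B u])
        moreover have "?v < w * k" using w(2) k(1) by (simp only: pos_divide_less_eq)
        ultimately show False using onD[OF \<open>t \<in> D\<close>] t by (simp add: mult.commute)
      qed
      then show ?thesis using 3 lower_vol_bounds[OF B u, of "r * s + c"] vB by simp
    qed (rule onD)
  qed
  then show thesis unfolding k_def by (rule that)
qed

section \<open>Equality in the Brunn--Minkowski inequality\<close>

text \<open>Both push-forwards to the line are finite and agree on all rays \<open>{s<..}\<close>,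
  hence they are equal. The constant \<open>c\<close> still depends on the direction
  \<open>u\<close>.\<close>

lemma BM_equal_marginals:
  fixes A B :: "'a::euclidean_space set"
  assumes eq: "BM_equal r A B" and u: "norm u = 1" and n: "DIM('a) = Suc m" "0 < m"
  obtains c where "\<And>k. continuous_on UNIV k \<Longrightarrow>
     (\<integral>y. indicator B y * k (y \<bullet> u) \<partial>lborel) = (\<integral>x. r ^ DIM('a) * indicator A x * k (r * (x \<bullet> u) + c) \<partial>(lborel :: 'a measure) :: real)"
proof -
  note AB = BM_equalD[OF eq u n]
  note [measurable] = borel_compact[OF AB(1)] borel_compact[OF AB(2)]
  obtain c where c: "\<And>s. lower_vol u B (r * s + c) = r ^ DIM('a) * lower_vol u A s"
    using BM_equal_lower_vol_affine[OF eq u n] by blast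
  define M where "M = distr (density lborel (\<lambda>y. ennreal (indicator B y))) borel (\<lambda>y. y \<bullet> u)"
  define N where "N = distr (density lborel (\<lambda>x. ennreal (r ^ DIM('a) * indicator A x))) borel (\<lambda>x. r * (x \<bullet> u) + c)"
  have upper: "emeasure lborel (D \<inter> {x. s < x \<bullet> u}) = ennreal (measure lborel D - lower_vol u D s)"
    if D: "compact D" for D :: "'a set" and s
  proof -
    have "D \<inter> {x. s < x \<bullet> u} = D - D \<inter> {x. x \<bullet> u \<le> s}" by auto
    then have "emeasure lborel (D \<inter> {x. s < x \<bullet> u}) = emeasure lborel D - emeasure lborel (D \<inter> {x. x \<bullet> u \<le> s})"
      using D compact_halfspaces(2)[OF D, of u s]
      by (simp add: emeasure_Diff borel_compact emeasure_lborel_compact del: Diff_Int)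
    then show ?thesis using D compact_halfspaces(2)[OF D, of u s]
      by (simp add: emeasure_lborel_compact lower_vol_def ennreal_minus)
  qed
  have "M = N"
  proof (rule measure_eqI_lessThan)
    fix s
    have "emeasure M {s<..} = (\<integral>\<^sup>+y. indicator (B \<inter> {y. s < y \<bullet> u}) y \<partial>lborel)"
      unfolding M_def by (subst emeasure_distr, simp, simp, subst emeasure_density)
        (auto intro!: measurable_sets_borel[of _ borel] nn_integral_cong simp: indicator_def simp del: nn_integral_indicator)
    also have "\<dots> = emeasure lborel (B \<inter> {y. s < y \<bullet> u})"
      by (rule nn_integral_indicator) measurable
    finally have M: "emeasure M {s<..} = ennreal (measure lborel B - lower_vol u B s)"
      using upper[OF AB(2)] by simp
    have iff: "s < r * x + c \<longleftrightarrow> (s - c) / r < x" for x using AB(3) by (simp add: field_simps)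
    have "emeasure N {s<..} = (\<integral>\<^sup>+x. ennreal (r ^ DIM('a)) * indicator (A \<inter> {x. (s - c) / r < x \<bullet> u}) x \<partial>lborel)"
      unfolding N_def by (subst emeasure_distr, simp, simp, subst emeasure_density)
        (auto intro!: measurable_sets_borel[of _ borel] nn_integral_cong simp: indicator_def iff simp del: nn_integral_indicator)
    also have "\<dots> = ennreal (r ^ DIM('a)) * emeasure lborel (A \<inter> {x. (s - c) / r < x \<bullet> u})"
      by (simp add: nn_integral_cmult)
    also have "\<dots> = ennreal (measure lborel B - lower_vol u B s)"
    proof -
      have "lower_vol u B s = r ^ DIM('a) * lower_vol u A ((s - c) / r)"
        using c[of "(s - c) / r"] AB(3) by simp
      then show ?thesis using AB(3,5) unfolding upper[OF AB(1)]
        by (simp add: right_diff_distrib flip: ennreal_mult')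
    qed
    finally show "emeasure M {s<..} = emeasure N {s<..}" using M by simp
    show "emeasure M {s<..} < \<infinity>" using M by simp
  qed (simp_all add: M_def N_def)
  have "(\<integral>y. indicator B y * k (y \<bullet> u) \<partial>lborel) = (\<integral>x. r ^ DIM('a) * indicator A x * k (r * (x \<bullet> u) + c) \<partial>lborel)"
    if k: "continuous_on UNIV k" for k :: "real \<Rightarrow> real"
  proof -
    have [measurable]: "k \<in> borel_measurable borel" using k by (rule borel_measurable_continuous_onI)
    have "(\<integral>y. indicator B y * k (y \<bullet> u) \<partial>lborel) = (\<integral>s. k s \<partial>M)"
      unfolding M_def by (subst integral_distr, simp, simp, subst integral_density) auto
    also have "\<dots> = (\<integral>s. k s \<partial>N)" by (simp add: \<open>M = N\<close>)
    also have "\<dots> = (\<integral>x. r ^ DIM('a) * indicator A x * k (r * (x \<bullet> u) + c) \<partial>lborel)"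
      unfolding N_def using AB(3) by (subst integral_distr, simp, simp, subst integral_density) auto
    finally show ?thesis .
  qed
  then show thesis by (rule that)
qed

section \<open>Recovering the set from its marginals\<close>

lemma integrable_indicator_times:
  fixes f :: "'a::euclidean_space \<Rightarrow> real"
  assumes "compact A" "continuous_on UNIV f"
  shows "integrable lborel (\<lambda>x. indicator A x * f x)"
  using borel_integrable_compact[OF assms(1) continuous_on_subset[OF assms(2) subset_UNIV]] by simp

text \<open>Testing the marginals with the identity function expresses \<open>c\<close> through the
  first moments of \<open>A\<close> and \<open>B\<close>, which are linear in \<open>u\<close>.
  Solving for \<open>c\<close> gives the vector \<open>z\<close> with
  \<open>c = z \<bullet> u\<close> in every direction.\<close>

lemma BM_equal_barycentre:
  fixes A B :: "'a::euclidean_space set"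
  assumes eq: "BM_equal r A B" and n: "DIM('a) = Suc m" "0 < m"
  obtains z where "\<And>u k. norm u = 1 \<Longrightarrow> continuous_on UNIV k \<Longrightarrow>
     (\<integral>y. indicator B y * k (y \<bullet> u) \<partial>lborel) = (\<integral>x. r ^ DIM('a) * indicator A x * k ((z + r *\<^sub>R x) \<bullet> u) \<partial>(lborel :: 'a measure) :: real)"
proof -
  have cA: "compact A" and cB: "compact B" and r: "0 < r" and vA: "0 < measure lborel A"
    and vB: "measure lborel B = r ^ DIM('a) * measure lborel A" using eq by (auto simp: BM_equal_def)
  have vB0: "0 < measure lborel B" using r vA vB by simp
  have int: "integrable lborel (\<lambda>x. indicator D x *\<^sub>R x)" if "compact D" for D :: "'a set"
    using borel_integrable_compact[OF that continuous_on_id] .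
  define iA where "iA = (\<integral>x. indicator A x *\<^sub>R x \<partial>lborel)"
  define iB where "iB = (\<integral>x. indicator B x *\<^sub>R x \<partial>lborel)"
  have inner: "(\<integral>x. indicator D x * (x \<bullet> u) \<partial>lborel) = (\<integral>x. indicator D x *\<^sub>R x \<partial>lborel) \<bullet> u"
    if "compact D" for D :: "'a set" and u
    using integral_inner_left[of u lborel "\<lambda>x. indicator D x *\<^sub>R x"] int[OF that] by simp
  define z where "z = (1 / measure lborel B) *\<^sub>R (iB - r ^ Suc (DIM('a)) *\<^sub>R iA)"
  have "(\<integral>y. indicator B y * k (y \<bullet> u) \<partial>lborel) = (\<integral>x. r ^ DIM('a) * indicator A x * k ((z + r *\<^sub>R x) \<bullet> u) \<partial>lborel)"
    if u: "norm u = 1" and k: "continuous_on UNIV k" for u and k :: "real \<Rightarrow> real"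
  proof -
    obtain c where c: "\<And>k. continuous_on UNIV k \<Longrightarrow>
       (\<integral>y. indicator B y * k (y \<bullet> u) \<partial>lborel) = (\<integral>x. r ^ DIM('a) * indicator A x * k (r * (x \<bullet> u) + c) \<partial>lborel)"
      using BM_equal_marginals[OF eq u n] by blast
    have "iB \<bullet> u = (\<integral>x. r ^ DIM('a) * indicator A x * (r * (x \<bullet> u) + c) \<partial>lborel)"
      using c[of "\<lambda>s. s"] inner[OF cB] by (simp add: iB_def continuous_on_id)
    also have "\<dots> = (\<integral>x. r ^ Suc (DIM('a)) * (indicator A x * (x \<bullet> u)) + r ^ DIM('a) * c * indicator A x \<partial>lborel)"
      by (intro Bochner_Integration.integral_cong) (simp_all add: algebra_simps)
    also have "\<dots> = r ^ Suc (DIM('a)) * (iA \<bullet> u) + r ^ DIM('a) * c * measure lborel A"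
    proof (subst Bochner_Integration.integral_add)
      show "integrable lborel (\<lambda>x. r ^ Suc (DIM('a)) * (indicator A x * (x \<bullet> u)))"
        by (intro integrable_mult_right integrable_indicator_times cA continuous_intros)
      show "integrable lborel (\<lambda>x. r ^ DIM('a) * c * indicator A x)"
        using integrable_indicator_times[OF cA, of "\<lambda>_. 1"] by (intro integrable_mult_right) simp
    qed (use inner[OF cA, of u] cA in \<open>simp add: iA_def borel_compact\<close>)
    finally have "iB \<bullet> u = r ^ Suc (DIM('a)) * (iA \<bullet> u) + measure lborel B * c" using vB by simp
    then have "z \<bullet> u = c" using vB0 by (simp add: z_def inner_diff_left)
    then show ?thesis using c[OF k] by (simp add: inner_add_left add.commute)
  qed
  then show thesis using that by blast
qed

text \<open>Sums of exponentials form an algebra, as Stone--Weierstrass needs, and every generator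
  depends on \<open>x\<close> only through one inner product, so its integral is determined by a
  single marginal.\<close>

inductive_set exp_span :: "('a::euclidean_space \<Rightarrow> real) set" where
  exp_span_exp: "(\<lambda>x. c * exp (x \<bullet> w)) \<in> exp_span"
| exp_span_add: "f \<in> exp_span \<Longrightarrow> g \<in> exp_span \<Longrightarrow> (\<lambda>x. f x + g x) \<in> exp_span"

lemma exp_span_continuous: "f \<in> exp_span \<Longrightarrow> continuous_on UNIV f"
  by (induction rule: exp_span.induct) (auto intro!: continuous_intros)

lemma exp_span_mult:
  assumes "f \<in> exp_span" "g \<in> exp_span"
  shows "(\<lambda>x. f x * g x) \<in> exp_span"
  using assms(1)
proof (induction rule: exp_span.induct)
  case (exp_span_exp c w)
  show ?case using assms(2)
  proof (induction rule: exp_span.induct)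
    case (exp_span_exp d v)
    have "(\<lambda>x. c * exp (x \<bullet> w) * (d * exp (x \<bullet> v))) = (\<lambda>x. (c * d) * exp (x \<bullet> (w + v)))"
      by (auto simp: inner_add_right exp_add)
    then show ?case by (simp only: exp_span.exp_span_exp)
  next
    case (exp_span_add f g)
    then show ?case using exp_span.exp_span_add by (simp add: distrib_left)
  qed
next
  case (exp_span_add f g)
  then show ?case using exp_span.exp_span_add by (simp add: distrib_right)
qed

lemma function_ring_exp_span:
  fixes S :: "'a::euclidean_space set"
  assumes "compact S"
  shows "function_ring_on exp_span S"
proof
  show "(\<lambda>_. c) \<in> (exp_span :: ('a \<Rightarrow> real) set)" for c
    using exp_span_exp[of c 0] by simp
  fix x y :: 'a assume "x \<noteq> y"
  \<comment> \<open>The exponent \<open>x - y\<close> itself separates the two points, because the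
    two inner products differ by its squared norm.\<close>
  then have "x \<bullet> (x - y) \<noteq> y \<bullet> (x - y)"
    by (metis inner_diff_left inner_eq_zero_iff right_minus_eq)
  then show "\<exists>f\<in>exp_span. f x \<noteq> f y"
    by (intro bexI[OF _ exp_span_exp[of 1 "x - y"]]) simp
next
  show "continuous_on S f" if "f \<in> exp_span" for f
    using exp_span_continuous[OF that] by (rule continuous_on_subset) simp
qed (fact assms exp_span_add exp_span_mult)+

text \<open>Agreement of the marginals in all directions gives equal Laplace transforms, hence, by
  Stone--Weierstrass, equality almost everywhere.\<close>

lemma BM_equal_AE:
  fixes A B :: "'a::euclidean_space set"
  assumes eq: "BM_equal r A B" and n: "DIM('a) = Suc m" "0 < m"
  obtains z where "AE y in lborel. y \<in> B \<longleftrightarrow> y \<in> (\<lambda>x. z + r *\<^sub>R x) ` A"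
proof -
  have cA: "compact A" and cB: "compact B" and r: "0 < r" and vA: "0 < measure lborel A"
    and vB: "measure lborel B = r ^ DIM('a) * measure lborel A" using eq by (auto simp: BM_equal_def)
  obtain z where z: "\<And>u k. norm u = 1 \<Longrightarrow> continuous_on UNIV k \<Longrightarrow>
     (\<integral>y. indicator B y * k (y \<bullet> u) \<partial>lborel) = (\<integral>x. r ^ DIM('a) * indicator A x * k ((z + r *\<^sub>R x) \<bullet> u) \<partial>lborel)"
    using BM_equal_barycentre[OF eq n] by blast
  define C where "C = (\<lambda>x. z + r *\<^sub>R x) ` A"
  have cC: "compact C" unfolding C_def by (intro compact_continuous_image cA continuous_intros)
  have "A \<noteq> {}" using vA by auto
  then have C_ne: "C \<noteq> {}" by (simp add: C_def)
  have vC: "measure lborel C = measure lborel B"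
    unfolding C_def vB using measure_lborel_affine_image[OF cA, of r z] r by simp
  define IB where "IB h = (\<integral>y. indicator B y * h y \<partial>lborel)" for h :: "'a \<Rightarrow> real"
  define IA where "IA h = (\<integral>x. indicator A x * (r ^ DIM('a) * h (z + r *\<^sub>R x)) \<partial>lborel)" for h :: "'a \<Rightarrow> real"
  have iB: "integrable lborel (\<lambda>y. indicator B y * h y)" if "continuous_on UNIV h" for h :: "'a \<Rightarrow> real"
    by (rule integrable_indicator_times[OF cB that])
  have iA: "integrable lborel (\<lambda>x. indicator A x * (r ^ DIM('a) * h (z + r *\<^sub>R x)))" if "continuous_on UNIV h" for h :: "'a \<Rightarrow> real"
  proof (rule integrable_indicator_times[OF cA])
    have "continuous_on UNIV (\<lambda>x. h (z + r *\<^sub>R x))"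
      by (rule continuous_on_compose2[OF that]) (auto intro!: continuous_intros)
    then show "continuous_on UNIV (\<lambda>x. r ^ DIM('a) * h (z + r *\<^sub>R x))" by (rule continuous_on_mult_left)
  qed
  have "IB h = IA h" if "h \<in> exp_span" for h
    using that
  proof (induction rule: exp_span.induct)
    case (exp_span_exp c w)
    obtain u \<tau> where u: "norm u = 1" "w = \<tau> *\<^sub>R u"
    proof (cases "w = 0")
      case True
      obtain b :: 'a where "b \<in> Basis" using nonempty_Basis by blast
      then show thesis using True that[of b 0] by simp
    next
      case False
      then show thesis using that[of "w /\<^sub>R norm w" "norm w"] by simp
    qed
    have "IB (\<lambda>x. c * exp (x \<bullet> w)) = (\<integral>y. indicator B y * (c * exp (\<tau> * (y \<bullet> u))) \<partial>lborel)"
      by (simp add: IB_def u(2))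
    also have "\<dots> = (\<integral>x. r ^ DIM('a) * indicator A x * (c * exp (\<tau> * ((z + r *\<^sub>R x) \<bullet> u))) \<partial>lborel)"
      by (rule z[OF u(1), of "\<lambda>s. c * exp (\<tau> * s)"]) (intro continuous_intros)
    also have "\<dots> = IA (\<lambda>x. c * exp (x \<bullet> w))"
      unfolding IA_def by (intro Bochner_Integration.integral_cong) (simp_all add: u(2) mult_ac)
    finally show ?case .
  next
    case (exp_span_add f g)
    note f = exp_span_continuous[OF exp_span_add.hyps(1)] and g = exp_span_continuous[OF exp_span_add.hyps(2)]
    have "IB (\<lambda>x. f x + g x) = IB f + IB g"
      unfolding IB_def distrib_left by (rule Bochner_Integration.integral_add[OF iB[OF f] iB[OF g]])
    moreover have "IA (\<lambda>x. f x + g x) = IA f + IA g"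
      unfolding IA_def distrib_left by (rule Bochner_Integration.integral_add[OF iA[OF f] iA[OF g]])
    ultimately show ?case using exp_span_add.IH by simp
  qed
  note IBA = this
  \<comment> \<open>The distance to \<open>C\<close> is continuous and vanishes exactly on
    \<open>C\<close>. Its integral over \<open>C\<close> is zero, so equality of the integrals puts
    almost all of \<open>B\<close> inside \<open>C\<close>.\<close>
  define h where "h y = infdist y C" for y
  have h: "continuous_on UNIV h" unfolding h_def by (intro continuous_intros)
  have IAh: "IA h = 0"
  proof -
    have "indicator A x * (r ^ DIM('a) * h (z + r *\<^sub>R x)) = 0" for x
    proof (cases "x \<in> A")
      case True
      then have "z + r *\<^sub>R x \<in> C" unfolding C_def by (rule imageI)
      then show ?thesis by (simp add: h_def)
    qed simp
    then show ?thesis unfolding IA_def by (simp only: integral_zero)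
  qed
  have "IB h \<le> 0"
  proof (rule field_le_epsilon)
    fix e :: real assume "0 < e"
    \<comment> \<open>Replacing \<open>h\<close> by \<open>g\<close> costs \<open>\<delta>\<close>
      times the volume of \<open>B\<close> twice, once for each of the two integrals.\<close>
    define \<delta> where "\<delta> = e / (2 * measure lborel B)"
    have vB0: "0 < measure lborel B" using r vA vB by simp
    then have \<delta>: "0 < \<delta>" using \<open>0 < e\<close> by (simp add: \<delta>_def)
    have "compact (B \<union> C)" using cB cC by (rule compact_Un)
    then obtain g where g: "g \<in> exp_span" "\<And>x. x \<in> B \<union> C \<Longrightarrow> \<bar>h x - g x\<bar> < \<delta>"
      using function_ring_on.Stone_Weierstrass_basic[OF function_ring_exp_span continuous_on_subset[OF h subset_UNIV] \<delta>] by blast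
    note gc = exp_span_continuous[OF g(1)]
    have gd: "continuous_on UNIV (\<lambda>y. g y + \<delta>)" by (intro continuous_on_add gc continuous_on_const)
    have hd: "continuous_on UNIV (\<lambda>y. h y + \<delta>)" by (intro continuous_on_add h continuous_on_const)
    have "IB h \<le> IB (\<lambda>y. g y + \<delta>)"
      unfolding IB_def
    proof (rule integral_mono)
      show "indicator B y * h y \<le> indicator B y * (g y + \<delta>)" for y
        using g(2)[of y] by (auto simp: indicator_def)
    qed (rule iB[OF h] iB[OF gd])+
    also have "\<dots> = IB g + \<delta> * measure lborel B"
    proof -
      have "IB (\<lambda>y. g y + \<delta>) = IB g + (\<integral>y. indicator B y * \<delta> \<partial>lborel)"
        unfolding IB_def distrib_left
        by (rule Bochner_Integration.integral_add[OF iB[OF gc] iB[OF continuous_on_const]])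
      then show ?thesis using cB by (simp add: borel_compact)
    qed
    also have "IB g = IA g" by (rule IBA[OF g(1)])
    also have "IA g \<le> IA (\<lambda>y. h y + \<delta>)"
      unfolding IA_def
    proof (rule integral_mono)
      fix x
      have "g (z + r *\<^sub>R x) \<le> h (z + r *\<^sub>R x) + \<delta>" if "x \<in> A"
      proof -
        have "z + r *\<^sub>R x \<in> B \<union> C" using that unfolding C_def by (intro UnI2 imageI)
        from g(2)[OF this] show ?thesis by linarith
      qed
      then show "indicator A x * (r ^ DIM('a) * g (z + r *\<^sub>R x)) \<le> indicator A x * (r ^ DIM('a) * (h (z + r *\<^sub>R x) + \<delta>))"
        using r by (auto simp: indicator_def)
    qed (rule iA[OF gc] iA[OF hd])+
    also have "\<dots> = IA h + \<delta> * measure lborel B"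
    proof -
      have "IA (\<lambda>y. h y + \<delta>) = IA h + (\<integral>x. indicator A x * (r ^ DIM('a) * \<delta>) \<partial>lborel)"
        unfolding IA_def distrib_left
        by (rule Bochner_Integration.integral_add[OF iA[OF h] iA[OF continuous_on_const]])
      then show ?thesis using cA vB by (simp add: borel_compact mult_ac)
    qed
    finally have "IB h \<le> 2 * (\<delta> * measure lborel B)" using IAh by simp
    then show "IB h \<le> 0 + e" using vB0 by (simp add: \<delta>_def)
  qed
  moreover have nn: "0 \<le> indicator B y * h y" for y by (simp add: h_def infdist_nonneg)
  then have "0 \<le> IB h" unfolding IB_def by (rule Bochner_Integration.integral_nonneg)
  ultimately have "(\<integral>y. indicator B y * h y \<partial>lborel) = 0" by (simp add: IB_def)
  then have "AE y in lborel. indicator B y * h y = 0"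
    using integral_nonneg_eq_0_iff_AE[OF iB[OF h]] nn by simp
  then have BC: "AE y in lborel. y \<in> B \<longrightarrow> y \<in> C"
  proof eventually_elim
    case (elim y)
    then show ?case using in_closed_iff_infdist_zero[OF compact_imp_closed[OF cC] C_ne, of y]
      by (simp add: h_def indicator_def)
  qed
  \<comment> \<open>The converse inclusion follows from equality of the two volumes.\<close>
  have CB: "AE y in lborel. y \<in> C \<longrightarrow> y \<in> B"
  proof -
    have fm: "B \<in> fmeasurable lborel" "C \<in> fmeasurable lborel" using cB cC by (auto intro: fmeasurable_compact)
    have "measure lborel (C \<inter> B) = measure lborel B"
    proof (rule measure_eq_AE)
      show "AE x in lborel. x \<in> C \<inter> B \<longleftrightarrow> x \<in> B" using BC by eventually_elim blast
    qed (use cB cC in \<open>auto intro: borel_compact\<close>)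
    moreover have "measure lborel (C - B) = measure lborel C - measure lborel (C \<inter> B)"
      using measure_Diff[of lborel C "C \<inter> B"] fmeasurableD2[OF fm(2)] borel_compact[OF cB] borel_compact[OF cC]
      by (simp add: Diff_Int)
    ultimately have "measure lborel (C - B) = 0" using vC by simp
    moreover have "C - B \<in> fmeasurable lborel" using fm by auto
    ultimately have "C - B \<in> null_sets lborel"
      by (intro null_setsI) (auto simp: emeasure_eq_measure2 dest: fmeasurableD)
    then show ?thesis by (rule AE_I') auto
  qed
  have "AE y in lborel. y \<in> B \<longleftrightarrow> y \<in> (\<lambda>x. z + r *\<^sub>R x) ` A"
    using BC CB unfolding C_def by eventually_elim blast
  then show thesis by (rule that)
qed

text \<open>A missing point of a segment lies in a gap between two nearest parameters
  \<open>a < b\<close> of points in \<open>S\<close>. The weighted mean of \<open>a\<close> and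
  \<open>b\<close> lies strictly inside the gap and also belongs to \<open>S\<close>.\<close>

lemma convex_of_closed_ratio:
  fixes S :: "'a::euclidean_space set"
  assumes S: "closed S" and r: "0 < r"
    and ratio: "\<And>x y. x \<in> S \<Longrightarrow> y \<in> S \<Longrightarrow> (1 / (1 + r)) *\<^sub>R (x + r *\<^sub>R y) \<in> S"
  shows "convex S"
  unfolding convex_alt
proof (intro ballI allI impI)
  fix x y and t :: real assume xy: "x \<in> S" "y \<in> S" and "0 \<le> t \<and> t \<le> 1"
  define \<gamma> where "\<gamma> s = (1 - s) *\<^sub>R x + s *\<^sub>R y" for s :: real
  define T where "T = {s\<in>{0..1}. \<gamma> s \<in> S}"
  have \<gamma>: "continuous_on UNIV \<gamma>" unfolding \<gamma>_def by (intro continuous_intros)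
  have T: "compact T"
  proof -
    have "T = {0..1} \<inter> \<gamma> -` S" by (auto simp: T_def)
    moreover have "closed (\<gamma> -` S)" using S \<gamma> by (simp add: continuous_on_closed_vimage)
    ultimately show ?thesis by (simp add: compact_Int_closed)
  qed
  have T01: "0 \<in> T" "1 \<in> T" using xy by (simp_all add: T_def \<gamma>_def)
  have T_ratio: "(a + r * b) / (1 + r) \<in> T" if "a \<in> T" "b \<in> T" for a b
  proof -
    have "(1 / (1 + r)) *\<^sub>R (\<gamma> a + r *\<^sub>R \<gamma> b) = \<gamma> ((a + r * b) / (1 + r))"
    proof -
      define \<rho> where "\<rho> = 1 / (1 + r)"
      have "\<rho> + \<rho> * r = 1" using r by (simp add: \<rho>_def field_simps)
      then have *: "1 - \<rho> * (a + r * b) = \<rho> * (1 - a) + \<rho> * r * (1 - b)" by (simp add: algebra_simps)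
      have "\<rho> *\<^sub>R (\<gamma> a + r *\<^sub>R \<gamma> b) = \<gamma> (\<rho> * (a + r * b))"
        unfolding \<gamma>_def * by (simp add: algebra_simps)
      then show ?thesis by (simp add: \<rho>_def)
    qed
    moreover have "0 \<le> (a + r * b) / (1 + r)" "(a + r * b) / (1 + r) \<le> 1"
    proof -
      have "0 \<le> a" "a \<le> 1" "0 \<le> r * b" "r * b \<le> r"
        using that r mult_left_le[of b r] by (auto simp: T_def)
      then have "0 \<le> a + r * b" "a + r * b \<le> 1 + r" by linarith+
      then show "0 \<le> (a + r * b) / (1 + r)" "(a + r * b) / (1 + r) \<le> 1" using r by (auto simp: divide_le_eq)
    qed
    ultimately show ?thesis using ratio[of "\<gamma> a" "\<gamma> b"] that by (simp add: T_def)
  qed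
  have "t \<in> T"
  proof (rule ccontr)
    assume t: "t \<notin> T"
    have cl: "compact (T \<inter> {..t})" "compact (T \<inter> {t..})" using T by (auto intro: compact_Int_closed)
    have ne: "T \<inter> {..t} \<noteq> {}" "T \<inter> {t..} \<noteq> {}" using T01 \<open>0 \<le> t \<and> t \<le> 1\<close> by auto
    obtain a where a: "a \<in> T" "a \<le> t" "\<And>s. s \<in> T \<Longrightarrow> s \<le> t \<Longrightarrow> s \<le> a"
      using compact_attains_sup[OF cl(1) ne(1)] by auto
    obtain b where b: "b \<in> T" "t \<le> b" "\<And>s. s \<in> T \<Longrightarrow> t \<le> s \<Longrightarrow> b \<le> s"
      using compact_attains_inf[OF cl(2) ne(2)] by auto
    have "a < b" using a b t by (metis order_le_less order_less_le_trans)
    define s where "s = (a + r * b) / (1 + r)"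
    have "s \<in> T" unfolding s_def by (rule T_ratio[OF a(1) b(1)])
    moreover have "a < s" "s < b"
      using \<open>a < b\<close> r by (simp_all add: s_def less_divide_eq divide_less_eq algebra_simps)
    ultimately show False using a(3)[of s] b(3)[of s] by linarith
  qed
  then show "(1 - t) *\<^sub>R x + t *\<^sub>R y \<in> S" by (simp add: T_def \<gamma>_def)
qed

text \<open>If a functional separated \<open>p\<close> from \<open>L\<close>, then at the point of
  \<open>K\<close> where it is minimal the inclusion \<open>p + K \<subseteq> K + L\<close> would
  fail.\<close>

lemma Minkowski_cancel:
  fixes K L :: "'a::euclidean_space set"
  assumes K: "compact K" "K \<noteq> {}" and L: "closed L" "convex L"
    and sub: "\<And>k. k \<in> K \<Longrightarrow> \<exists>k'\<in>K. \<exists>l\<in>L. p + k = k' + l"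
  shows "p \<in> L"
proof (rule ccontr)
  assume "p \<notin> L"
  then obtain a b where ab: "a \<bullet> p < b" "\<And>x. x \<in> L \<Longrightarrow> b < a \<bullet> x"
    using separating_hyperplane_closed_point[OF L(2,1)] by blast
  obtain k where k: "k \<in> K" "\<And>k'. k' \<in> K \<Longrightarrow> a \<bullet> k \<le> a \<bullet> k'"
    using continuous_attains_inf[OF K continuous_on_inner[OF continuous_on_const continuous_on_id], of a] by blast
  obtain k' l where "k' \<in> K" "l \<in> L" "p + k = k' + l" using sub[OF k(1)] by blast
  moreover from this have "a \<bullet> p + a \<bullet> k = a \<bullet> k' + a \<bullet> l" by (metis inner_add_right)
  ultimately show False using ab k(2)[of k'] by force
qed

text \<open>Almost everywhere information becomes exact for sums with an essential summand, one all
  of whose neighbourhoods meet the set in positive measure. This gives convexity of the essential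
  part \<open>A0\<close>, and cancellation then shows that neither \<open>A\<close> nor
  \<open>B\<close> has further points.\<close>

theorem Brunn_Minkowski_equality:
  fixes A B :: "'a::euclidean_space set"
  assumes eq: "BM_equal r A B" and n: "2 \<le> DIM('a)"
  obtains z where "convex A" "convex B" "B = (\<lambda>x. z + r *\<^sub>R x) ` A"
proof -
  obtain m where m: "DIM('a) = Suc m" "0 < m" using n by (cases "DIM('a)") auto
  have cA: "compact A" and cB: "compact B" and r: "0 < r" and vA: "0 < measure lborel A"
    and vB: "measure lborel B = r ^ DIM('a) * measure lborel A"
    and vS: "measure lborel (msum A B) = (1 + r) ^ DIM('a) * measure lborel A"
    using eq by (auto simp: BM_equal_def)
  obtain z where z: "AE y in lborel. y \<in> B \<longleftrightarrow> y \<in> (\<lambda>x. z + r *\<^sub>R x) ` A"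
    using BM_equal_AE[OF eq m] by blast
  have bor: "A \<in> sets borel" "B \<in> sets borel" using cA cB by (auto intro: borel_compact)
  define F where "F = {U. open U \<and> A \<inter> U \<in> null_sets lborel}"
  \<comment> \<open>The support of Lebesgue measure restricted to \<open>A\<close>; by Lindelof the
    removed part is a null set.\<close>
  define A0 where "A0 = A - \<Union>F"
  have "open (\<Union>F)" by (auto simp: F_def)
  then have cA0: "compact A0" unfolding A0_def using cA by (rule compact_diff[rotated])
  have null: "A \<inter> \<Union>F \<in> null_sets lborel"
  proof -
    obtain F' where F': "F' \<subseteq> F" "countable F'" "\<Union>F' = \<Union>F"
      using Lindelof[of F] by (auto simp: F_def)
    have "(\<Union>U\<in>F'. A \<inter> U) \<in> null_sets lborel"
      by (rule null_sets_UN'[OF F'(2)]) (use F' in \<open>auto simp: F_def\<close>)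
    moreover have "(\<Union>U\<in>F'. A \<inter> U) = A \<inter> \<Union>F" using F'(3) by blast
    ultimately show ?thesis by simp
  qed
  have vA0: "measure lborel A0 = measure lborel A"
  proof -
    have "A0 = A - A \<inter> \<Union>F" by (auto simp: A0_def)
    then show ?thesis using null bor by (simp add: measure_Diff_null_set)
  qed
  have essA: "A \<inter> U \<notin> null_sets lborel" if "x \<in> A0" "open U" "x \<in> U" for x U
    using that by (auto simp: A0_def F_def)
  have A0A: "A0 \<subseteq> A" by (auto simp: A0_def)
  have ne: "A0 \<noteq> {}" using vA vA0 by auto
  define T where "T c S = (\<lambda>x. z + c *\<^sub>R x) ` S" for c and S :: "'a set"
  have null_affine: "(\<lambda>x. d + c *\<^sub>R x) ` S \<in> null_sets lborel \<longleftrightarrow> S \<in> null_sets lborel"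
    if "S \<in> sets borel" "c \<noteq> 0" for c d and S :: "'a set"
    using emeasure_lborel_affine_image[OF that, of d] that by (auto simp: null_sets_def)
  \<comment> \<open>The points of \<open>z + r A0\<close> are essential for \<open>B\<close>,
    because \<open>B\<close> and \<open>z + r A\<close> differ by a null set.\<close>
  have essB: "B \<inter> U \<notin> null_sets lborel" if y: "y \<in> T r A0" "open U" "y \<in> U" for y U
  proof
    assume N: "B \<inter> U \<in> null_sets lborel"
    let ?f = "\<lambda>x. z + r *\<^sub>R x"
    have V: "open (?f -` U)" using y(2) by (intro open_vimage continuous_intros)
    have im: "?f ` (A \<inter> ?f -` U) = ?f ` A \<inter> U" by auto
    have AV: "A \<inter> ?f -` U \<in> sets borel" using bor V by auto
    have "?f ` A \<inter> U \<in> null_sets lborel"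
    proof -
      have m': "?f ` A \<inter> U \<in> sets borel" using emeasure_lborel_affine_image(2)[OF AV, of r z] r unfolding im by simp
      have "AE y in lborel. y \<notin> ?f ` A \<inter> U"
        using z AE_not_in[OF N] by eventually_elim auto
      then show ?thesis using m' by (simp add: AE_iff_null_sets)
    qed
    then have "A \<inter> ?f -` U \<in> null_sets lborel" using null_affine[OF AV, of r z] r im by simp
    moreover obtain x where "x \<in> A0" "y = ?f x" using y(1) by (auto simp: T_def)
    ultimately show False using essA[OF _ V, of x] y(3) by simp
  qed
  have cT: "compact (T c A0)" for c unfolding T_def by (intro compact_continuous_image cA0 continuous_intros)
  have TB: "T r A0 \<subseteq> B"
  proof
    fix y assume y: "y \<in> T r A0"
    show "y \<in> B"
    proof (rule ccontr)
      assume "y \<notin> B"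
      then show False using essB[OF y, of "- B"] compact_imp_closed[OF cB] by auto
    qed
  qed
  let ?S = "msum A B" and ?T = "T (1 + r) A0"
  have cS: "compact ?S" by (rule compact_sums[OF cA cB])
  have TS: "?T \<subseteq> ?S"
  proof
    fix y assume "y \<in> ?T"
    then obtain x where x: "x \<in> A0" "y = x + (z + r *\<^sub>R x)" by (auto simp: T_def algebra_simps)
    moreover have "z + r *\<^sub>R x \<in> B" using TB x(1) by (auto simp: T_def)
    ultimately show "y \<in> ?S" using A0A by blast
  qed
  have nullST: "?S - ?T \<in> null_sets lborel"
  proof -
    have fm: "?S \<in> fmeasurable lborel" "?T \<in> fmeasurable lborel" using cS cT by (auto intro: fmeasurable_compact)
    have "measure lborel ?T = measure lborel ?S"
      using measure_lborel_affine_image[OF cA0, of "1 + r" z] r vA0 vS by (simp add: T_def)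
    then have "measure lborel (?S - ?T) = 0"
      using measure_Diff[of lborel ?S ?T] fm(1) borel_compact[OF cS] borel_compact[OF cT] TS
      by (simp add: fmeasurableD2)
    moreover have "?S - ?T \<in> fmeasurable lborel" using fm by auto
    ultimately show ?thesis by (intro null_setsI) (auto simp: emeasure_eq_measure2 dest: fmeasurableD)
  qed
  have openT: "open (- ?T)" using cT by (intro open_Compl compact_imp_closed)
  \<comment> \<open>If such a sum missed the closed set \<open>?T\<close>, moving the essential
    summand in a small neighbourhood would produce a non-null part of
    \<open>?S - ?T\<close>.\<close>
  have sum_in: "x + y \<in> ?T" if xy: "x \<in> A" "y \<in> B" and ess: "x \<in> A0 \<or> y \<in> T r A0" for x y
  proof (rule ccontr)
    assume nT: "x + y \<notin> ?T"
    have *: False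
      if D: "D \<in> sets borel" and w: "\<And>v. v \<in> D \<Longrightarrow> w + v \<in> ?S" and
        e: "\<And>U. open U \<Longrightarrow> v \<in> U \<Longrightarrow> D \<inter> U \<notin> null_sets lborel" and wv: "w + v = x + y" for D w v
    proof -
      let ?U = "(\<lambda>v. w + 1 *\<^sub>R v) -` (- ?T)"
      have U: "open ?U" using openT by (intro open_vimage continuous_on_add continuous_on_scaleR continuous_on_const continuous_on_id)
      then have DU: "D \<inter> ?U \<in> sets borel" using D by (intro sets.Int) auto
      have "(\<lambda>v. w + 1 *\<^sub>R v) ` (D \<inter> ?U) \<subseteq> ?S - ?T" using w by auto
      then have "(\<lambda>v. w + 1 *\<^sub>R v) ` (D \<inter> ?U) \<in> null_sets lborel"
        using emeasure_lborel_affine_image(2)[OF DU, of 1 w] by (intro null_sets_subset[OF nullST]) auto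
      then have "D \<inter> ?U \<in> null_sets lborel" using null_affine[OF DU, of 1 w] by simp
      then show False using e[OF U] wv nT by simp
    qed
    from ess show False
    proof
      assume "x \<in> A0"
      show False by (rule *[of A y x]) (use bor xy essA[OF \<open>x \<in> A0\<close>] in \<open>auto simp: add.commute[of y]\<close>)
    next
      assume "y \<in> T r A0"
      show False by (rule *[of B x y]) (use bor xy essB[OF \<open>y \<in> T r A0\<close>] in auto)
    qed
  qed
  have conv: "convex A0"
  proof (rule convex_of_closed_ratio[OF compact_imp_closed[OF cA0] r])
    fix x y assume xy: "x \<in> A0" "y \<in> A0"
    then have "x + (z + r *\<^sub>R y) \<in> ?T" using A0A TB by (intro sum_in) (auto simp: T_def)
    then obtain w where "w \<in> A0" "x + (z + r *\<^sub>R y) = z + (1 + r) *\<^sub>R w" by (auto simp: T_def)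
    then have "w \<in> A0" "x + r *\<^sub>R y = (1 + r) *\<^sub>R w" by (auto simp: algebra_simps)
    then show "(1 / (1 + r)) *\<^sub>R (x + r *\<^sub>R y) \<in> A0" using r by simp
  qed
  \<comment> \<open>For any \<open>p\<close> in \<open>A\<close> the sums with the essential part of
    \<open>B\<close> give \<open>p + r A0 \<subseteq> r A0 + A0\<close>, and the compact set
    \<open>r A0\<close> is cancelled.\<close>
  have "A \<subseteq> A0"
  proof
    fix p assume p: "p \<in> A"
    let ?K = "(\<lambda>x. r *\<^sub>R x) ` A0"
    show "p \<in> A0"
    proof (rule Minkowski_cancel[of ?K A0])
      fix k assume "k \<in> ?K"
      then obtain x where x: "x \<in> A0" "k = r *\<^sub>R x" by blast
      then have "p + (z + r *\<^sub>R x) \<in> ?T" using p TB by (intro sum_in) (auto simp: T_def)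
      then obtain w where "w \<in> A0" "p + (z + r *\<^sub>R x) = z + (1 + r) *\<^sub>R w" by (auto simp: T_def)
      then have "w \<in> A0" "p + k = r *\<^sub>R w + w" using x by (auto simp: algebra_simps)
      then show "\<exists>k'\<in>?K. \<exists>l\<in>A0. p + k = k' + l" by blast
    qed (use cA0 ne conv in \<open>auto intro!: compact_continuous_image continuous_intros compact_imp_closed\<close>)
  qed
  then have A: "A = A0" using A0A by blast
  have "B \<subseteq> T r A0"
  proof
    fix q assume q: "q \<in> B"
    show "q \<in> T r A0"
    proof (rule Minkowski_cancel[of A0])
      fix x assume x: "x \<in> A0"
      then have "x + q \<in> ?T" using q A0A by (intro sum_in) auto
      then obtain w where w: "w \<in> A0" "x + q = z + (1 + r) *\<^sub>R w" by (auto simp: T_def)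
      then have "q + x = w + (z + r *\<^sub>R w)" by (simp add: algebra_simps)
      moreover have "z + r *\<^sub>R w \<in> T r A0" using w by (auto simp: T_def)
      ultimately show "\<exists>k'\<in>A0. \<exists>l\<in>T r A0. q + x = k' + l" using w by blast
    qed (use cA0 ne conv cT in \<open>auto intro!: compact_imp_closed convex_affinity simp: T_def\<close>)
  qed
  then have B: "B = (\<lambda>x. z + r *\<^sub>R x) ` A" using TB A by (auto simp: T_def)
  moreover have "convex B" unfolding B A using conv by (rule convex_affinity)
  ultimately show thesis using conv A that by blast
qed

section \<open>The polar of the unit body\<close>

lemma orthant_real: "(orthant :: real set) = {0..}"
  by (auto simp: orthant_def)

lemma Pair_in_orthant [simp]: "(a, b) \<in> (orthant :: (real \<times> real) set) \<longleftrightarrow> 0 \<le> a \<and> 0 \<le> b"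
  by (auto simp: orthant_def Basis_prod_def)

lemma PhiD2:
  fixes \<phi> :: "real \<times> real \<Rightarrow> real"
  assumes "\<phi> \<in> Phi"
  shows "convex_on orthant \<phi>" "\<And>z. z \<in> orthant \<Longrightarrow> 0 \<le> \<phi> z" "\<phi> (0, 0) = 0" "\<phi> (1, 0) = 1" "\<phi> (0, 1) = 1"
  using assms by (auto simp: Phi_def Basis_prod_def zero_prod_def)

lemma Phi_mono2:
  fixes \<phi> :: "real \<times> real \<Rightarrow> real"
  assumes \<phi>: "\<phi> \<in> Phi" and "0 \<le> x" "x \<le> x'" "0 \<le> y" "y \<le> y'"
  shows "\<phi> (x, y) \<le> \<phi> (x', y')"
proof -
  have mono: "\<phi> z \<le> \<phi> (z + s *\<^sub>R b)" if "z \<in> orthant" "b \<in> Basis" "0 \<le> s" for z b s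
    using \<phi> that by (auto simp: Phi_def)
  have "\<phi> (x, y) \<le> \<phi> (x', y)"
    using mono[of "(x, y)" "(1, 0)" "x' - x"] assms by (simp add: Basis_prod_def)
  also have "\<dots> \<le> \<phi> (x', y')"
    using mono[of "(x', y)" "(0, 1)" "y' - y"] assms by (simp add: Basis_prod_def)
  finally show ?thesis .
qed

lemma Phi_convex2:
  fixes \<phi> :: "real \<times> real \<Rightarrow> real"
  assumes "\<phi> \<in> Phi" "z \<in> orthant" "w \<in> orthant" "0 \<le> u" "0 \<le> v" "u + v = 1"
  shows "\<phi> (u *\<^sub>R z + v *\<^sub>R w) \<le> u * \<phi> z + v * \<phi> w"
  using PhiD2(1)[OF assms(1)] assms by (auto simp: convex_on_def)

lemma Phi_scale2:
  fixes \<phi> :: "real \<times> real \<Rightarrow> real"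
  assumes "\<phi> \<in> Phi" "z \<in> orthant" "0 \<le> s" "s \<le> 1"
  shows "\<phi> (s *\<^sub>R z) \<le> s * \<phi> z"
  using Phi_convex2[OF assms(1,2), of "(0, 0)" s "1 - s"] assms PhiD2(3)[OF assms(1)]
  by (cases z) simp

text \<open>Convexity and the value zero at the origin give growth at least linear beyond the unit
  vectors, where the value is one; monotonicity reduces both bounds to the axes.\<close>

lemma Phi_le_one_bounds:
  fixes \<phi> :: "real \<times> real \<Rightarrow> real"
  assumes \<phi>: "\<phi> \<in> Phi" and xy: "0 \<le> x" "0 \<le> y" "\<phi> (x, y) \<le> 1"
  shows "x \<le> 1" "y \<le> 1"
proof -
  have *: "s \<le> 1" if "z \<in> orthant" "\<phi> z = 1" "\<phi> (s *\<^sub>R z) \<le> 1" "s *\<^sub>R z \<in> orthant" "0 \<le> s" for s z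
  proof (rule ccontr)
    assume "\<not> s \<le> 1"
    then have "\<phi> ((1 / s) *\<^sub>R (s *\<^sub>R z)) \<le> (1 / s) * \<phi> (s *\<^sub>R z)"
      using that by (intro Phi_scale2[OF \<phi>]) auto
    also have "\<dots> \<le> 1 / s" using that \<open>\<not> s \<le> 1\<close> by (simp add: divide_right_mono)
    also have "\<dots> < 1" using \<open>\<not> s \<le> 1\<close> by simp
    finally show False using that \<open>\<not> s \<le> 1\<close> by simp
  qed
  have "\<phi> (x, 0) \<le> 1" "\<phi> (0, y) \<le> 1"
    using Phi_mono2[OF \<phi>, of x x 0 y] Phi_mono2[OF \<phi>, of 0 x y y] xy by auto
  then show "x \<le> 1" "y \<le> 1"
    using *[of "(1, 0)" x] *[of "(0, 1)" y] xy PhiD2[OF \<phi>] by auto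
qed

abbreviation polar_quadrant :: "(real \<times> real \<Rightarrow> real) \<Rightarrow> (real \<times> real) set" where
  "polar_quadrant \<phi> \<equiv> polar (J_body \<phi>) \<inter> orthant"

text \<open>\<open>J_body\<close> is invariant under sign changes of the coordinates, so the signs
  of \<open>x\<close> and \<open>y\<close> may be chosen to match those of \<open>a\<close> and
  \<open>b\<close>.\<close>

lemma polar_abs:
  fixes \<phi> :: "real \<times> real \<Rightarrow> real"
  assumes \<phi>: "\<phi> \<in> Phi"
  shows "(a, b) \<in> polar (J_body \<phi>) \<longleftrightarrow> (\<forall>x y. 0 \<le> x \<longrightarrow> 0 \<le> y \<longrightarrow> \<phi> (x, y) \<le> 1 \<longrightarrow> \<bar>a\<bar> * x + \<bar>b\<bar> * y \<le> 1)"
proof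
  assume ab: "(a, b) \<in> polar (J_body \<phi>)"
  show "\<forall>x y. 0 \<le> x \<longrightarrow> 0 \<le> y \<longrightarrow> \<phi> (x, y) \<le> 1 \<longrightarrow> \<bar>a\<bar> * x + \<bar>b\<bar> * y \<le> 1"
  proof (intro allI impI)
    fix x y :: real assume xy: "0 \<le> x" "0 \<le> y" "\<phi> (x, y) \<le> 1"
    define x' where "x' = (if 0 \<le> a then x else - x)"
    define y' where "y' = (if 0 \<le> b then y else - y)"
    have "(x', y') \<in> J_body \<phi>"
      using Phi_le_one_bounds[OF \<phi> xy] xy by (simp add: J_body_def x'_def y'_def)
    then have "(a, b) \<bullet> (x', y') \<le> 1" using ab unfolding polar_def by blast
    then show "\<bar>a\<bar> * x + \<bar>b\<bar> * y \<le> 1" by (simp add: x'_def y'_def split: if_splits)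
  qed
next
  assume *: "\<forall>x y. 0 \<le> x \<longrightarrow> 0 \<le> y \<longrightarrow> \<phi> (x, y) \<le> 1 \<longrightarrow> \<bar>a\<bar> * x + \<bar>b\<bar> * y \<le> 1"
  have "(a, b) \<bullet> (x, y) \<le> 1" if "(x, y) \<in> J_body \<phi>" for x y
  proof -
    have "\<bar>a\<bar> * \<bar>x\<bar> + \<bar>b\<bar> * \<bar>y\<bar> \<le> 1" using * that by (simp add: J_body_def)
    moreover have "a * x \<le> \<bar>a\<bar> * \<bar>x\<bar>" "b * y \<le> \<bar>b\<bar> * \<bar>y\<bar>" by (simp_all flip: abs_mult)
    ultimately show ?thesis by simp
  qed
  then show "(a, b) \<in> polar (J_body \<phi>)" unfolding polar_def by auto
qed

lemma polar_quadrantD: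
  assumes "\<phi> \<in> Phi" "(a, b) \<in> polar_quadrant \<phi>"
  shows "0 \<le> a" "0 \<le> b" "\<And>x y. 0 \<le> x \<Longrightarrow> 0 \<le> y \<Longrightarrow> \<phi> (x, y) \<le> 1 \<Longrightarrow> a * x + b * y \<le> 1"
    "a \<le> 1" "b \<le> 1"
proof -
  have ab: "0 \<le> a" "0 \<le> b" using assms by auto
  have *: "a * x + b * y \<le> 1" if "0 \<le> x" "0 \<le> y" "\<phi> (x, y) \<le> 1" for x y
    using assms(2) that ab polar_abs[OF assms(1), of a b] by auto
  from *[of 1 0] *[of 0 1] PhiD2[OF assms(1)] show "a \<le> 1" "b \<le> 1" by auto
  show "0 \<le> a" "0 \<le> b" "\<And>x y. 0 \<le> x \<Longrightarrow> 0 \<le> y \<Longrightarrow> \<phi> (x, y) \<le> 1 \<Longrightarrow> a * x + b * y \<le> 1" by fact+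
qed

lemma polar_quadrantI:
  assumes "\<phi> \<in> Phi" "0 \<le> a" "0 \<le> b" "\<And>x y. 0 \<le> x \<Longrightarrow> 0 \<le> y \<Longrightarrow> \<phi> (x, y) \<le> 1 \<Longrightarrow> a * x + b * y \<le> 1"
  shows "(a, b) \<in> polar_quadrant \<phi>"
  using assms by (simp add: polar_abs)

lemma polar_quadrant_units:
  assumes "\<phi> \<in> Phi"
  shows "(1, 0) \<in> polar_quadrant \<phi>" "(0, 1) \<in> polar_quadrant \<phi>"
  by (rule polar_quadrantI[OF assms]; use Phi_le_one_bounds[OF assms] in auto)+

lemma polar_quadrant_downward:
  assumes \<phi>: "\<phi> \<in> Phi" and ab: "(a, b) \<in> polar_quadrant \<phi>" and "0 \<le> a'" "a' \<le> a" "0 \<le> b'" "b' \<le> b"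
  shows "(a', b') \<in> polar_quadrant \<phi>"
proof (rule polar_quadrantI[OF \<phi>])
  fix x y :: real assume "0 \<le> x" "0 \<le> y" "\<phi> (x, y) \<le> 1"
  moreover from this have "a' * x \<le> a * x" "b' * y \<le> b * y" using assms by (auto intro: mult_right_mono)
  ultimately show "a' * x + b' * y \<le> 1" using polar_quadrantD(3)[OF \<phi> ab] by force
qed (use assms in auto)

text \<open>The polar is symmetric and closed under decreasing coordinates in the quadrant, so its
  corner decides whether it is the whole square.\<close>

lemma polar_square_iff:
  assumes \<phi>: "\<phi> \<in> Phi"
  shows "polar (J_body \<phi>) = {-1..1} \<times> {-1..1} \<longleftrightarrow> (1, 1) \<in> polar_quadrant \<phi>"
proof
  assume "(1, 1) \<in> polar_quadrant \<phi>"
  have abs: "(a, b) \<in> polar (J_body \<phi>) \<longleftrightarrow> (\<bar>a\<bar>, \<bar>b\<bar>) \<in> polar_quadrant \<phi>" for a b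
    by (simp add: polar_abs[OF \<phi>])
  show "polar (J_body \<phi>) = {-1..1} \<times> {-1..1}"
  proof (intro equalityI subrelI)
    fix a b assume "(a, b) \<in> polar (J_body \<phi>)"
    then have "\<bar>a\<bar> \<le> 1" "\<bar>b\<bar> \<le> 1" using polar_quadrantD(4,5)[OF \<phi>] abs by blast+
    then show "(a, b) \<in> {-1..1} \<times> {-1..1}" by auto
  next
    fix a b :: real assume "(a, b) \<in> {-1..1} \<times> {-1..1}"
    then have "\<bar>a\<bar> \<le> 1" "\<bar>b\<bar> \<le> 1" by auto
    then show "(a, b) \<in> polar (J_body \<phi>)"
      unfolding abs using polar_quadrant_downward[OF \<phi> \<open>(1, 1) \<in> _\<close>] by simp
  qed
qed auto

lemma polar_quadrant_closed_convex: "closed (polar_quadrant \<phi>)" "convex (polar_quadrant \<phi>)"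
proof -
  have eq: "polar J = (\<Inter>y\<in>J. {x. y \<bullet> x \<le> 1})" for J :: "(real \<times> real) set"
    unfolding polar_def by (subst inner_commute) blast
  have eq2: "(orthant :: (real \<times> real) set) = {0..} \<times> {0..}" by auto
  show "closed (polar_quadrant \<phi>)" unfolding eq eq2
    by (intro closed_Int closed_INT ballI closed_halfspace_le closed_Times closed_atLeast)
  show "convex (polar_quadrant \<phi>)" unfolding eq eq2
    by (intro convex_Int convex_INT convex_halfspace_le convex_Times convex_real_interval)
qed

text \<open>Continuity of \<open>\<phi>\<close> along rays replaces lower semicontinuity at the boundary of the quadrant.\<close>

lemma Phi_scale_down:
  fixes \<phi> :: "real \<times> real \<Rightarrow> real"
  assumes \<phi>: "\<phi> \<in> Phi" and z: "z \<in> orthant" "1 < \<phi> z"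
  obtains s where "0 < s" "s < 1" "1 < \<phi> (s *\<^sub>R z)"
proof -
  have z2: "2 *\<^sub>R z \<in> orthant" using z by (cases z) auto
  define b where "b = \<phi> (2 *\<^sub>R z)"
  have b: "0 \<le> b" using PhiD2(2)[OF \<phi> z2] by (simp add: b_def)
  \<comment> \<open>\<open>z\<close> is the combination of \<open>(1 - e) z\<close> and
    \<open>2 z\<close> with weights \<open>1 / (1 + e)\<close> and \<open>e / (1 + e)\<close>;
    \<open>e\<close> is so small that the value \<open>b\<close> at \<open>2 z\<close> cannot
    account for the excess of \<open>\<phi> z\<close> over one.\<close>
  define e where "e = min (1 / 2) ((\<phi> z - 1) / (2 * (b + 1)))"
  have e: "0 < e" "e \<le> 1 / 2" using z b unfolding e_def by simp (rule min.cobounded1)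
  have "e * (2 * (b + 1)) \<le> (\<phi> z - 1) / (2 * (b + 1)) * (2 * (b + 1))"
    using b by (intro mult_right_mono) (auto simp: e_def)
  then have eb: "e * (2 * (b + 1)) \<le> \<phi> z - 1" using b by simp
  have "z = (1 / (1 + e)) *\<^sub>R ((1 - e) *\<^sub>R z) + (e / (1 + e)) *\<^sub>R (2 *\<^sub>R z)"
  proof -
    have "(1 / (1 + e)) * (1 - e) + (e / (1 + e)) * 2 = (1 + e) / (1 + e)"
      by (simp add: add_divide_distrib[symmetric] del: add_divide_distrib)
    also have "\<dots> = 1" using e by simp
    finally show ?thesis by (simp flip: scaleR_add_left)
  qed
  moreover have "(1 - e) *\<^sub>R z \<in> orthant" using z e by (cases z) auto
  moreover have "1 / (1 + e) + e / (1 + e) = 1" using e by (simp add: field_simps)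
  ultimately have "\<phi> z \<le> (1 / (1 + e)) * \<phi> ((1 - e) *\<^sub>R z) + (e / (1 + e)) * b"
    using Phi_convex2[OF \<phi>, of "(1 - e) *\<^sub>R z" "2 *\<^sub>R z" "1 / (1 + e)" "e / (1 + e)"] z2 e
    by (simp add: b_def)
  then have "\<phi> z * (1 + e) \<le> ((1 / (1 + e)) * \<phi> ((1 - e) *\<^sub>R z) + (e / (1 + e)) * b) * (1 + e)"
    using e by (intro mult_right_mono) auto
  also have "\<dots> = \<phi> ((1 - e) *\<^sub>R z) + e * b"
    using e by (simp add: distrib_right)
  finally have "\<phi> z + e * \<phi> z - e * b \<le> \<phi> ((1 - e) *\<^sub>R z)" by (simp add: algebra_simps)
  moreover have "0 < e * \<phi> z" "0 \<le> e * b" using e z b by auto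
  moreover have "e * (2 * (b + 1)) = 2 * (e * b) + 2 * e" by (simp add: algebra_simps)
  ultimately have "1 < \<phi> ((1 - e) *\<^sub>R z)" using eb e by linarith
  then show thesis using that[of "1 - e"] e by simp
qed

lemma Phi_scale_up:
  fixes \<phi> :: "real \<times> real \<Rightarrow> real"
  assumes \<phi>: "\<phi> \<in> Phi" and z: "z \<in> orthant" "\<phi> z < 1"
  obtains s where "1 < s" "\<phi> (s *\<^sub>R z) \<le> 1"
proof -
  have z2: "2 *\<^sub>R z \<in> orthant" using z by (cases z) auto
  define b where "b = \<phi> (2 *\<^sub>R z)"
  have b: "0 \<le> b" "0 \<le> \<phi> z" using PhiD2(2)[OF \<phi>] z2 z by (auto simp: b_def)
  \<comment> \<open>Here \<open>(1 + e) z\<close> is the combination of \<open>z\<close> and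
    \<open>2 z\<close> with weights \<open>1 - e\<close> and \<open>e\<close>, and
    \<open>e * b\<close> must fit into the slack \<open>1 - \<phi> z\<close>.\<close>
  define e where "e = min 1 ((1 - \<phi> z) / (b + 1))"
  have e: "0 < e" "e \<le> 1" using z b by (auto simp: e_def)
  have "e * (b + 1) \<le> (1 - \<phi> z) / (b + 1) * (b + 1)"
    using b by (intro mult_right_mono) (auto simp: e_def)
  also have "\<dots> = 1 - \<phi> z" using b by simp
  finally have eb: "e * b + e \<le> 1 - \<phi> z" by (simp add: algebra_simps)
  have "(1 + e) *\<^sub>R z = (1 - e) *\<^sub>R z + e *\<^sub>R (2 *\<^sub>R z)" by (simp flip: scaleR_add_left)
  then have "\<phi> ((1 + e) *\<^sub>R z) \<le> (1 - e) * \<phi> z + e * b"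
    using Phi_convex2[OF \<phi> z(1) z2, of "1 - e" e] e by (simp add: b_def)
  also have "\<dots> \<le> \<phi> z + e * b" using e b by (simp add: mult_left_le_one_le left_diff_distrib)
  also have "\<dots> \<le> 1" using eb e by linarith
  finally show thesis using that[of "1 + e"] e by simp
qed

text \<open>The nontrivial half of the bipolar theorem: a point with value above one is separated
  from the sublevel set \<open>J\<close>, and the normalised normal is an element of the polar that
  violates the assumed bound.\<close>

lemma Phi_le_one_of_polar:
  fixes \<phi> :: "real \<times> real \<Rightarrow> real"
  assumes \<phi>: "\<phi> \<in> Phi" and kl: "0 \<le> k" "0 \<le> l" "0 < v"
    and le: "\<And>a b. (a, b) \<in> polar_quadrant \<phi> \<Longrightarrow> a * k + b * l \<le> v"
  shows "\<phi> (k / v, l / v) \<le> 1"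
proof (rule ccontr)
  assume "\<not> ?thesis"
  \<comment> \<open>The separation obtained below is not strict; the factor \<open>s < 1\<close>
    supplies the slack for the contradiction.\<close>
  then obtain s where s: "0 < s" "s < 1" "1 < \<phi> (s *\<^sub>R (k / v, l / v))"
    using Phi_scale_down[OF \<phi>, of "(k / v, l / v)"] kl by auto
  define x where "x = s * (k / v)"
  define y where "y = s * (l / v)"
  have xy: "0 \<le> x" "0 \<le> y" "1 < \<phi> (x, y)" using s kl by (auto simp: x_def y_def)
  define J where "J = {z \<in> orthant. \<phi> z \<le> 1}"
  \<comment> \<open>The whole quadrant above the point is separated from \<open>J\<close>, which is
    possible by monotonicity. As \<open>Q\<close> is unbounded in both coordinates, the normal has
    nonnegative entries.\<close>
  define Q where "Q = {x..} \<times> {y..}"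
  have "convex J"
    unfolding convex_def
  proof (intro ballI allI impI)
    fix z w :: "real \<times> real" and u v :: real
    assume zw: "z \<in> J" "w \<in> J" and uv: "0 \<le> u" "0 \<le> v" "u + v = 1"
    have "u *\<^sub>R z + v *\<^sub>R w \<in> orthant" using zw uv by (cases z; cases w) (auto simp: J_def)
    moreover have "\<phi> (u *\<^sub>R z + v *\<^sub>R w) \<le> u * \<phi> z + v * \<phi> w"
      using zw uv by (intro Phi_convex2[OF \<phi>]) (auto simp: J_def)
    moreover have "u * \<phi> z + v * \<phi> w \<le> u * 1 + v * 1"
      using zw uv by (intro add_mono mult_left_mono) (auto simp: J_def)
    ultimately show "u *\<^sub>R z + v *\<^sub>R w \<in> J" using uv by (simp add: J_def)
  qed
  moreover have "convex Q" unfolding Q_def by (intro convex_Times convex_real_interval)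
  moreover have J: "(0, 0) \<in> J" "(1, 0) \<in> J" "(0, 1) \<in> J" using PhiD2[OF \<phi>] by (auto simp: J_def)
  moreover have "(x, y) \<in> Q" by (simp add: Q_def)
  moreover have "J \<inter> Q = {}"
  proof -
    have "1 < \<phi> (x', y')" if "x \<le> x'" "y \<le> y'" for x' y'
      using Phi_mono2[OF \<phi> xy(1) that(1) xy(2) that(2)] xy(3) by linarith
    then show ?thesis by (force simp: J_def Q_def)
  qed
  ultimately obtain a c where ac: "a \<noteq> 0" "\<And>z. z \<in> J \<Longrightarrow> a \<bullet> z \<le> c" "\<And>z. z \<in> Q \<Longrightarrow> c \<le> a \<bullet> z"
    using separating_hyperplane_sets[of J Q] by blast
  obtain a1 a2 where a: "a = (a1, a2)" by (cases a)
  have c: "0 \<le> c" "a1 \<le> c" "a2 \<le> c" using ac(2)[OF J(1)] ac(2)[OF J(2)] ac(2)[OF J(3)] by (auto simp: a)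
  have quad: "c \<le> a1 * (x + p) + a2 * (y + q)" if "0 \<le> p" "0 \<le> q" for p q
    using ac(3)[of "(x + p, y + q)"] that by (simp add: Q_def a)
  have nonneg: "0 \<le> \<alpha>" if "\<And>p. 0 \<le> p \<Longrightarrow> c \<le> \<alpha> * p + e" for \<alpha> e
  proof (rule ccontr)
    assume "\<not> 0 \<le> \<alpha>"
    then show False using that[of "(e - c + 1) / (- \<alpha>)"] that[of 0] \<open>0 \<le> c\<close>
      by (auto simp: field_simps split: if_splits)
  qed
  have a0: "0 \<le> a1" "0 \<le> a2"
    using nonneg[of a1 "a1 * x + a2 * y"] nonneg[of a2 "a1 * x + a2 * y"] quad[of _ 0] quad[of 0]
    by (auto simp: algebra_simps)
  \<comment> \<open>The unit vectors lie in \<open>J\<close>, so \<open>c = 0\<close> would force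
    the nonnegative normal to vanish.\<close>
  have "0 < c" using a0 c ac(1) a by (cases "a1 = 0"; cases "a2 = 0") (auto simp: zero_prod_def)
  have "(a1 / c, a2 / c) \<in> polar_quadrant \<phi>"
  proof (rule polar_quadrantI[OF \<phi>])
    fix x y :: real assume "0 \<le> x" "0 \<le> y" "\<phi> (x, y) \<le> 1"
    then have "a1 * x + a2 * y \<le> c" using ac(2)[of "(x, y)"] by (simp add: J_def a)
    then show "a1 / c * x + a2 / c * y \<le> 1" using \<open>0 < c\<close> by (simp flip: add_divide_distrib)
  qed (use a0 c in auto)
  from le[OF this] have "a1 * k + a2 * l \<le> v * c" using \<open>0 < c\<close> by (simp flip: add_divide_distrib add: pos_divide_le_eq)
  moreover have "c * v \<le> s * (a1 * k + a2 * l)"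
    using quad[of 0 0] kl by (simp add: x_def y_def pos_le_divide_eq algebra_simps flip: add_divide_distrib)
  moreover have "0 < c * v" using \<open>0 < c\<close> kl by simp
  moreover have "s * (a1 * k + a2 * l) \<le> s * (v * c)" using calculation(1) s by simp
  moreover have "s * (v * c) < 1 * (v * c)" using calculation(3) s by (intro mult_strict_right_mono) (simp_all add: mult.commute)
  ultimately show False by (simp add: mult.commute)
qed

text \<open>At the midpoint of two contact points \<open>\<phi>\<close> would be less than one, so
  the midpoint could be stretched within the sublevel set, across the supporting line.\<close>

lemma strictly_convex_contact_unique:
  fixes \<phi> :: "real \<times> real \<Rightarrow> real"
  assumes \<phi>: "\<phi> \<in> Phi" and strict: "strictly_convex_on orthant \<phi>" and ab: "(a, b) \<in> polar_quadrant \<phi>"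
    and z: "0 \<le> x" "0 \<le> y" "\<phi> (x, y) \<le> 1" "a * x + b * y = 1"
    and z': "0 \<le> x'" "0 \<le> y'" "\<phi> (x', y') \<le> 1" "a * x' + b * y' = 1"
  shows "(x, y) = (x', y')"
proof (rule ccontr)
  assume "(x, y) \<noteq> (x', y')"
  then have "\<phi> ((1/2) *\<^sub>R (x, y) + (1/2) *\<^sub>R (x', y')) < (1/2) * \<phi> (x, y) + (1/2) * \<phi> (x', y')"
  proof -
    have "(x, y) \<in> (orthant :: (real \<times> real) set)" "(x', y') \<in> (orthant :: (real \<times> real) set)" using z z' by simp_all
    moreover have "(0::real) < 1 / 2" "(1::real) / 2 + 1 / 2 = 1" by simp_all
    ultimately show ?thesis using strict \<open>(x, y) \<noteq> (x', y')\<close> unfolding strictly_convex_on_def by blast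
  qed
  then have "\<phi> ((x + x') / 2, (y + y') / 2) < 1" using z z' by (simp add: add_divide_distrib)
  then obtain s where s: "1 < s" "\<phi> (s *\<^sub>R ((x + x') / 2, (y + y') / 2)) \<le> 1"
    using Phi_scale_up[OF \<phi>, of "((x + x') / 2, (y + y') / 2)"] z z' by auto
  then have "a * (s * ((x + x') / 2)) + b * (s * ((y + y') / 2)) \<le> 1"
    using z z' by (intro polar_quadrantD(3)[OF \<phi> ab]) auto
  also have "a * (s * ((x + x') / 2)) + b * (s * ((y + y') / 2)) = s * ((a * x + b * y) + (a * x' + b * y')) / 2"
    by (simp add: algebra_simps add_divide_distrib)
  finally show False using s z z' by simp
qed

section \<open>The coefficient arc\<close>

lemma PhiD1:
  fixes \<psi> :: "real \<Rightarrow> real"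
  assumes "\<psi> \<in> Phi"
  shows "convex_on {0..} \<psi>" "\<And>x. 0 \<le> x \<Longrightarrow> 0 \<le> \<psi> x" "\<psi> 0 = 0" "\<psi> 1 = 1"
    "\<And>x y. 0 \<le> x \<Longrightarrow> x \<le> y \<Longrightarrow> \<psi> x \<le> \<psi> y"
proof -
  show "convex_on {0..} \<psi>" "\<And>x. 0 \<le> x \<Longrightarrow> 0 \<le> \<psi> x" "\<psi> 0 = 0" "\<psi> 1 = 1"
    using assms by (auto simp: Phi_def orthant_real)
  fix x y :: real assume "0 \<le> x" "x \<le> y"
  moreover have "\<psi> x \<le> \<psi> (x + s)" if "0 \<le> x" "0 \<le> s" for x s
    using assms that by (auto simp: Phi_def orthant_real)
  ultimately show "\<psi> x \<le> \<psi> y" by (metis add.commute diff_add_cancel diff_ge_0_iff_ge)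
qed

lemma Phi_realI:
  fixes \<psi> :: "real \<Rightarrow> real"
  assumes cvx: "convex_on {0..} \<psi>" and nn: "\<And>x. 0 \<le> x \<Longrightarrow> 0 \<le> \<psi> x" and "\<psi> 0 = 0" "\<psi> 1 = 1"
  shows "\<psi> \<in> Phi"
proof -
  have "\<psi> x \<le> \<psi> (x + s)" if "0 \<le> x" "0 \<le> s" for x s
  proof (cases "x + s = 0")
    case True
    then have "s = 0" using that by linarith
    then show ?thesis by simp
  next
    case False
    then have p: "0 < x + s" using that by linarith
    define t where "t = x / (x + s)"
    have t: "0 \<le> t" "t \<le> 1" using that p by (auto simp: t_def)
    have "\<psi> ((1 - t) *\<^sub>R 0 + t *\<^sub>R (x + s)) \<le> (1 - t) * \<psi> 0 + t * \<psi> (x + s)"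
      using that t by (intro convex_onD[OF cvx]) auto
    moreover have "(1 - t) *\<^sub>R 0 + t *\<^sub>R (x + s) = x" using p by (simp add: t_def)
    moreover have "t * \<psi> (x + s) \<le> \<psi> (x + s)" using t nn[of "x + s"] p by (simp add: mult_left_le_one_le)
    ultimately show ?thesis using assms by simp
  qed
  then show ?thesis using assms by (auto simp: Phi_def orthant_real)
qed

text \<open>On the open ray this is continuity of convex functions. At the endpoint zero convexity
  gives \<open>\<psi> t \<le> t\<close>, and the values are squeezed.\<close>

lemma Phi_continuous:
  fixes \<psi> :: "real \<Rightarrow> real"
  assumes \<psi>: "\<psi> \<in> Phi"
  shows "continuous_on {0..1} \<psi>"
proof -
  note \<psi>D = PhiD1[OF \<psi>]
  have le: "\<psi> t \<le> t" if "0 \<le> t" "t \<le> 1" for t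
    using convex_onD[OF \<psi>D(1), of t 0 1] that \<psi>D by simp
  have "continuous_on {0<..} \<psi>"
    by (rule convex_on_continuous) (auto intro: convex_on_subset[OF \<psi>D(1)])
  then have pos: "isCont \<psi> x" if "0 < x" for x
    using that by (simp add: continuous_on_eq_continuous_at)
  have zero: "continuous (at 0 within {0..1}) \<psi>"
    unfolding continuous_within
  proof (rule tendsto_sandwich[where f="\<lambda>_. 0" and h="\<lambda>x. x"])
    show "eventually (\<lambda>x. 0 \<le> \<psi> x) (at 0 within {0..1})" "eventually (\<lambda>x. \<psi> x \<le> x) (at 0 within {0..1})"
      using \<psi>D(2) le by (auto simp: eventually_at_filter)
  qed (auto simp: \<psi>D)
  show ?thesis
    unfolding continuous_on_eq_continuous_within
  proof
    fix x :: real assume "x \<in> {0..1}"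
    then show "continuous (at x within {0..1}) \<psi>"
      using zero pos[of x] by (cases "x = 0") (auto intro: continuous_at_imp_continuous_at_within)
  qed
qed

lemma last_zero_props:
  fixes \<psi> :: "real \<Rightarrow> real"
  assumes \<psi>: "\<psi> \<in> Phi"
  shows "0 \<le> last_zero \<psi>" "last_zero \<psi> < 1" "\<psi> (last_zero \<psi>) = 0" "\<And>t. 0 \<le> t \<Longrightarrow> \<psi> t = 0 \<Longrightarrow> t \<le> last_zero \<psi>"
proof -
  note \<psi>D = PhiD1[OF \<psi>]
  define Z where "Z = {t \<in> {0..1}. \<psi> t = 0}"
  have "closed Z" unfolding Z_def
    using continuous_closed_preimage_constant[OF Phi_continuous[OF \<psi>]] by simp
  moreover have "{0..1} \<inter> Z = Z" by (auto simp: Z_def)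
  ultimately have "compact Z" using compact_Int_closed[of "{0..1}" Z] by simp
  moreover have "0 \<in> Z" by (simp add: Z_def \<psi>D)
  ultimately obtain \<tau> where \<tau>: "\<tau> \<in> Z" "\<And>t. t \<in> Z \<Longrightarrow> t \<le> \<tau>" using compact_attains_sup[of Z] by blast
  have bd: "t \<le> 1" if "0 \<le> t" "\<psi> t = 0" for t
  proof (rule ccontr)
    assume "\<not> t \<le> 1"
    then show False using \<psi>D(5)[of 1 t] \<psi>D(4) that by simp
  qed
  have eq: "last_zero \<psi> = \<tau>"
    unfolding last_zero_def by (rule Greatest_equality) (use \<tau> bd in \<open>auto simp: Z_def\<close>)
  have "\<tau> \<noteq> 1" using \<tau> \<psi>D(4) by (auto simp: Z_def)
  then show "0 \<le> last_zero \<psi>" "last_zero \<psi> < 1" "\<psi> (last_zero \<psi>) = 0" "\<And>t. 0 \<le> t \<Longrightarrow> \<psi> t = 0 \<Longrightarrow> t \<le> last_zero \<psi>"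
    using \<tau> bd by (auto simp: eq Z_def)
qed

text \<open>\<open>a\<close> is a convex combination of the last zero and \<open>b\<close>, with
  weight less than one on \<open>b\<close>, where the value is positive.\<close>

lemma Phi_strict_mono:
  fixes \<psi> :: "real \<Rightarrow> real"
  assumes \<psi>: "\<psi> \<in> Phi" and ab: "last_zero \<psi> \<le> a" "a < b"
  shows "\<psi> a < \<psi> b"
proof -
  note \<psi>D = PhiD1[OF \<psi>] and z = last_zero_props[OF \<psi>]
  have "\<psi> b \<noteq> 0" using z(4)[of b] z(1) ab by linarith
  then have pos: "0 < \<psi> b" using \<psi>D(2)[of b] z(1) ab by simp
  let ?\<tau> = "last_zero \<psi>"
  define t where "t = (a - ?\<tau>) / (b - ?\<tau>)"
  have t: "0 \<le> t" "t < 1" using ab by (auto simp: t_def)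
  have "(1 - t) *\<^sub>R ?\<tau> + t *\<^sub>R b = ?\<tau> + t * (b - ?\<tau>)" by (simp add: algebra_simps)
  also have "\<dots> = a" using ab by (simp add: t_def)
  finally have a: "(1 - t) *\<^sub>R ?\<tau> + t *\<^sub>R b = a" .
  have "\<psi> ((1 - t) *\<^sub>R ?\<tau> + t *\<^sub>R b) \<le> (1 - t) * \<psi> ?\<tau> + t * \<psi> b"
    using t z(1) ab by (intro convex_onD[OF \<psi>D(1)]) auto
  then have "\<psi> a \<le> t * \<psi> b" unfolding a by (simp add: z(3))
  also have "\<dots> < \<psi> b" using t pos by simp
  finally show ?thesis .
qed

lemma hat_inv_props:
  fixes \<psi> :: "real \<Rightarrow> real"
  assumes \<psi>: "\<psi> \<in> Phi"
  shows "\<And>t. 0 \<le> t \<Longrightarrow> t \<le> 1 \<Longrightarrow> hat_inv \<psi> t \<in> {last_zero \<psi>..1} \<and> \<psi> (hat_inv \<psi> t) = t"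
    and "continuous_on {0..1} (hat_inv \<psi>)"
proof -
  note \<psi>D = PhiD1[OF \<psi>] and z = last_zero_props[OF \<psi>]
  let ?I = "{last_zero \<psi>..1}"
  have cont: "continuous_on ?I \<psi>" by (rule continuous_on_subset[OF Phi_continuous[OF \<psi>]]) (use z in auto)
  have img: "\<psi> ` ?I = {0..1}"
  proof
    show "\<psi> ` ?I \<subseteq> {0..1}" 
    proof
      fix t assume "t \<in> \<psi> ` ?I"
      then obtain x where "x \<in> ?I" "t = \<psi> x" by blast
      then show "t \<in> {0..1}" using \<psi>D(2)[of x] \<psi>D(4) \<psi>D(5)[of x 1] z(1) by simp
    qed
    show "{0..1} \<subseteq> \<psi> ` ?I"
    proof
      fix t :: real assume "t \<in> {0..1}"
      then obtain x where "last_zero \<psi> \<le> x" "x \<le> 1" "\<psi> x = t"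
        using IVT'[of \<psi> "last_zero \<psi>" t 1] z(2,3) \<psi>D(4) cont by auto
      then show "t \<in> \<psi> ` ?I" by auto
    qed
  qed
  have inj: "inj_on \<psi> ?I"
  proof (rule inj_onI)
    fix x y assume "x \<in> ?I" "y \<in> ?I" "\<psi> x = \<psi> y"
    then show "x = y" using Phi_strict_mono[OF \<psi>, of x y] Phi_strict_mono[OF \<psi>, of y x] by (cases x y rule: linorder_cases) auto
  qed
  show "hat_inv \<psi> t \<in> ?I \<and> \<psi> (hat_inv \<psi> t) = t" if "0 \<le> t" "t \<le> 1" for t
  proof -
    have "t \<in> \<psi> ` ?I" using that img by simp
    then show ?thesis unfolding hat_inv_def by (intro conjI inv_into_into f_inv_into_f)
  qed
  have "continuous_on (\<psi> ` ?I) (hat_inv \<psi>)"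
    by (rule continuous_on_inv[OF cont]) (auto simp: hat_inv_def inv_into_f_f[OF inj])
  then show "continuous_on {0..1} (hat_inv \<psi>)" by (simp add: img)
qed

text \<open>One of the two functions \<open>\<psi>\<close>: beyond the diagonal point \<open>(d, d)\<close> it is affine, with slope read off
  a supporting line at \<open>(d, d)\<close>; before, it follows the boundary of the region \<open>C\<close>. The affine part
  avoids the possibly vertical tangent of the boundary at \<open>x = 1\<close>.\<close>

lemma represent_half:
  fixes C :: "(real \<times> real) set"
  assumes C: "closed C" "convex C" "C \<subseteq> {0..1} \<times> {0..1}" "(1, 0) \<in> C" "(0, 1) \<in> C"
    and down: "\<And>a b a' b'. (a, b) \<in> C \<Longrightarrow> 0 \<le> a' \<Longrightarrow> a' \<le> a \<Longrightarrow> 0 \<le> b' \<Longrightarrow> b' \<le> b \<Longrightarrow> (a', b') \<in> C"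
    and d: "0 < d" "d < 1" "(d, d) \<in> C" and c: "0 < c" "0 < c'" "(c + c') * (1 - d) = 1"
    and supp: "\<And>x y. (x, y) \<in> C \<Longrightarrow> c * (x - d) + c' * (y - d) \<le> 0"
  obtains \<psi> where "\<psi> \<in> Phi" "\<And>x. d \<le> x \<Longrightarrow> \<psi> x = 1 - c * (1 - x)"
    "\<And>x y. 0 \<le> x \<Longrightarrow> x \<le> d \<Longrightarrow> 0 \<le> y \<Longrightarrow> (x, y) \<in> C \<longleftrightarrow> \<psi> x \<le> c' * (1 - y)"
proof -
  \<comment> \<open>The upper boundary of \<open>C\<close> as a function of the first coordinate;
    convexity of \<open>C\<close> makes it concave.\<close>
  define g where "g x = Sup {y. (x, y) \<in> C}" for x
  have cpt: "compact C"
    using bounded_subset[OF bounded_Times[OF bounded_closed_interval bounded_closed_interval] C(3)] C(1)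
    by (simp add: compact_eq_bounded_closed)
  have g: "(x, y) \<in> C \<longleftrightarrow> y \<le> g x" if "0 \<le> x" "x \<le> 1" "0 \<le> y" for x y
  proof -
    let ?Y = "{y. (x, y) \<in> C}"
    have "?Y = snd ` (C \<inter> {x} \<times> UNIV)" by force
    moreover have "compact (C \<inter> {x} \<times> UNIV)" using cpt by (intro compact_Int_closed closed_Times) auto
    ultimately have "compact ?Y" by (simp only: compact_continuous_image[OF continuous_on_snd[OF continuous_on_id]])
    moreover have "0 \<in> ?Y" using down[OF C(4)] that by simp
    ultimately obtain m where m: "m \<in> ?Y" "\<And>y. y \<in> ?Y \<Longrightarrow> y \<le> m" using compact_attains_sup[of ?Y] by blast
    then have "g x = m" unfolding g_def by (intro cSup_eq_maximum) auto
    then show ?thesis using m down[of x m x y] that by auto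
  qed
  have g0: "0 \<le> g x" "g x \<le> 1" "(x, g x) \<in> C" if "0 \<le> x" "x \<le> 1" for x
  proof -
    show "0 \<le> g x" using g[of x 0] down[OF C(4), of x 0] that by simp
    then show "(x, g x) \<in> C" using g[of x "g x"] that by simp
    then show "g x \<le> 1" using C(3) by auto
  qed
  have g_concave: "u * g x + v * g y \<le> g (u * x + v * y)"
    if "0 \<le> x" "x \<le> 1" "0 \<le> y" "y \<le> 1" "0 \<le> u" "0 \<le> v" "u + v = 1" for x y u v
  proof -
    have "u *\<^sub>R (x, g x) + v *\<^sub>R (y, g y) \<in> C"
      using convexD[OF C(2) g0(3)[of x] g0(3)[of y]] that by simp
    moreover have "0 \<le> u * x" "0 \<le> v * y" "u * x \<le> u" "v * y \<le> v"
      using that by (simp_all add: mult_left_le)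
    then have "0 \<le> u * x + v * y" "u * x + v * y \<le> 1" using that(7) by linarith+
    ultimately show ?thesis using g[of "u * x + v * y" "u * g x + v * g y"] g0(1)[of x] g0(1)[of y] that by simp
  qed
  have "g 0 = 1" using g[of 0 1] C(5) g0(2)[of 0] by simp
  have "g d = d"
  proof (rule antisym)
    have "c' * (g d - d) \<le> 0" using supp[OF g0(3)[of d]] d by simp
    then show "g d \<le> d" using c by (simp add: mult_le_0_iff)
    show "d \<le> g d" using g[of d d] d by simp
  qed
  \<comment> \<open>The slack of the supporting line at the boundary point \<open>(t, g t)\<close>.
    It is nonnegative, convex and zero at \<open>d\<close>, hence decreasing up to
    \<open>d\<close>.\<close>
  define q where "q t = c * (d - t) + c' * (d - g t)" for t
  have q0: "0 \<le> q t" if "0 \<le> t" "t \<le> d" for t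
    using supp[OF g0(3)[of t]] that d by (simp add: q_def algebra_simps)
  have qd: "q d = 0" by (simp add: q_def \<open>g d = d\<close>)
  have q_convex: "q (u * x + v * y) \<le> u * q x + v * q y"
    if "0 \<le> x" "x \<le> d" "0 \<le> y" "y \<le> d" "0 \<le> u" "0 \<le> v" "u + v = 1" for x y u v
  proof -
    have "c' * (u * g x + v * g y) \<le> c' * g (u * x + v * y)"
      using g_concave[of x y u v] that d c by (intro mult_left_mono) auto
    moreover have "u * q x + v * q y = (u + v) * (c * d + c' * d) - c * (u * x + v * y) - c' * (u * g x + v * g y)"
      by (simp add: q_def algebra_simps)
    ultimately show ?thesis using that by (simp add: q_def algebra_simps)
  qed
  have q_anti: "q t \<le> q s" if "0 \<le> s" "s \<le> t" "t \<le> d" for s t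
  proof (cases "s = d")
    case False
    then have sd: "s < d" using that by simp
    define v where "v = (t - s) / (d - s)"
    have v: "0 \<le> v" "v \<le> 1" using that sd by (auto simp: v_def)
    have "(1 - v) * s + v * d = s + v * (d - s)" by (simp add: algebra_simps)
    also have "\<dots> = t" using sd by (simp add: v_def)
    finally have "q t \<le> (1 - v) * q s + v * q d" using q_convex[of s d "1 - v" v] v that by simp
    also have "\<dots> \<le> q s" using v q0[of s] that by (simp add: qd mult_left_le_one_le)
    finally show ?thesis .
  qed (use that in auto)
  \<comment> \<open>The affine function plus the slack, which is frozen at zero beyond
    \<open>d\<close>. By the normalisation of \<open>c\<close> and \<open>c'\<close> it equals
    \<open>c' * (1 - g x)\<close> before \<open>d\<close>.\<close>
  define \<psi> where "\<psi> x = 1 - c * (1 - x) + q (min x d)" for x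
  have low: "\<psi> x = c' * (1 - g x)" if "x \<le> d" for x
  proof -
    have "\<psi> x = 1 - c * (1 - d) - c' * (1 - d) + c' * (1 - g x)"
      using that by (simp add: \<psi>_def q_def algebra_simps)
    also have "1 - c * (1 - d) - c' * (1 - d) = 0" using c(3) by (simp add: algebra_simps)
    finally show ?thesis by simp
  qed
  have high: "\<psi> x = 1 - c * (1 - x)" if "d \<le> x" for x using that by (simp add: \<psi>_def min_def qd)
  \<comment> \<open>A decreasing convex function composed with the concave map
    \<open>min x d\<close> is convex.\<close>
  have "convex_on {0..} \<psi>"
  proof (rule convex_onI)
    fix t x y :: real assume t: "0 < t" "t < 1" and xy: "x \<in> {0..}" "y \<in> {0..}"
    let ?z = "(1 - t) * x + t * y"
    let ?m = "(1 - t) * min x d + t * min y d"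
    have "?m \<le> ?z" "?m \<le> (1 - t) * d + t * d" using t by (intro add_mono mult_left_mono; simp)+
    then have "?m \<le> min ?z d" by (simp add: algebra_simps)
    moreover have "0 \<le> ?m" using t xy d by (intro add_nonneg_nonneg mult_nonneg_nonneg) auto
    ultimately have "q (min ?z d) \<le> q ?m" by (intro q_anti) auto
    also have "\<dots> \<le> (1 - t) * q (min x d) + t * q (min y d)" using t xy d by (intro q_convex) auto
    finally show "\<psi> ((1 - t) *\<^sub>R x + t *\<^sub>R y) \<le> (1 - t) * \<psi> x + t * \<psi> y"
      by (simp add: \<psi>_def algebra_simps)
  qed (rule convex_real_interval)
  moreover have "0 \<le> \<psi> x" if "0 \<le> x" for x
  proof (cases "x \<le> d")
    case True
    then show ?thesis using low[OF True] g0(2)[of x] that d c by simp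
  next
    case False
    have "c * (1 - x) \<le> c * (1 - d)" using False c by simp
    also have "\<dots> \<le> 1"
    proof -
      have "c * (1 - d) + c' * (1 - d) = 1" using c(3) by (simp only: distrib_right)
      moreover have "0 \<le> c' * (1 - d)" using c d by simp
      ultimately show ?thesis by linarith
    qed
    finally show ?thesis using high[of x] False by simp
  qed
  moreover have "\<psi> 0 = 0" using low[of 0] d \<open>g 0 = 1\<close> by simp
  moreover have "\<psi> 1 = 1" using high[of 1] d by simp
  ultimately have "\<psi> \<in> Phi" by (rule Phi_realI)
  moreover have "(x, y) \<in> C \<longleftrightarrow> \<psi> x \<le> c' * (1 - y)" if "0 \<le> x" "x \<le> d" "0 \<le> y" for x y
    using g[of x y] low[OF that(2)] that d c by simp
  ultimately show thesis using high that by blast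
qed

text \<open>The region leaves the diagonal at \<open>(d, d)\<close>, and a supporting line there
  splits the boundary into two graphs. Each function is nonlinear only before \<open>d\<close>,
  where the other one is affine, so on either side of the diagonal point the inequality reproduces
  one graph.\<close>

lemma exists_Phi_representation:
  fixes C :: "(real \<times> real) set"
  assumes C: "closed C" "convex C" "C \<subseteq> {0..1} \<times> {0..1}" "(1, 0) \<in> C" "(0, 1) \<in> C" "(1, 1) \<notin> C"
    and down: "\<And>a b a' b'. (a, b) \<in> C \<Longrightarrow> 0 \<le> a' \<Longrightarrow> a' \<le> a \<Longrightarrow> 0 \<le> b' \<Longrightarrow> b' \<le> b \<Longrightarrow> (a', b') \<in> C"
  obtains \<psi>\<^sub>1 \<psi>\<^sub>2 where "\<psi>\<^sub>1 \<in> Phi" "\<psi>\<^sub>2 \<in> Phi"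
    "C = {(x1, x2). x1 \<in> {0..1} \<and> x2 \<in> {0..1} \<and> \<psi>\<^sub>1 x1 + \<psi>\<^sub>2 x2 \<le> 1}"
proof -
  define D where "D = {t\<in>{0..1}. (t, t) \<in> C}"
  have "D = {0..1} \<inter> (\<lambda>t. (t, t)) -` C" by (auto simp: D_def)
  moreover have "closed ((\<lambda>t::real. (t, t)) -` C)" by (intro closed_vimage C continuous_intros)
  ultimately have "compact D" by (simp add: compact_Int_closed)
  have "(1/2) *\<^sub>R (1, 0) + (1/2) *\<^sub>R (0, 1) \<in> C" by (rule convexD[OF C(2,4,5)]) auto
  then have half: "1/2 \<in> D" by (simp add: D_def)
  then obtain d where d: "d \<in> D" "\<And>t. t \<in> D \<Longrightarrow> t \<le> d" using compact_attains_sup[OF \<open>compact D\<close>] by blast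
  have d01: "0 < d" "d < 1" "(d, d) \<in> C"
    using d half C(6) d(2)[OF half] by (auto simp: D_def order_le_less)
  define Q where "Q = {d<..} \<times> {d<..}"
  have "C \<inter> Q = {}"
  proof (rule ccontr)
    assume "C \<inter> Q \<noteq> {}"
    then obtain x y where xy: "(x, y) \<in> C" "d < x" "d < y" by (auto simp: Q_def)
    then have "(min x y, min x y) \<in> C" using d01 by (intro down[OF xy(1)]) auto
    then have "min x y \<in> D" using xy d01 C(3) by (auto simp: D_def)
    then show False using d(2) xy by fastforce
  qed
  moreover have "convex Q" unfolding Q_def by (intro convex_Times convex_real_interval)
  moreover have "(d + 1, d + 1) \<in> Q" by (simp add: Q_def)
  ultimately obtain a b where ab: "a \<noteq> 0" "\<And>z. z \<in> C \<Longrightarrow> a \<bullet> z \<le> b" "\<And>z. z \<in> Q \<Longrightarrow> b \<le> a \<bullet> z"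
    using separating_hyperplane_sets[of C Q] C(2,4) by blast
  obtain a1 a2 where a: "a = (a1, a2)" by (cases a)
  have quad: "b \<le> a1 * (d + p) + a2 * (d + q)" if "0 < p" "0 < q" for p q
    using ab(3)[of "(d + p, d + q)"] that by (simp add: Q_def a)
  have nonneg: "0 \<le> \<alpha>" if "\<And>p. 0 < p \<Longrightarrow> b \<le> \<alpha> * p + e" for \<alpha> e
  proof (rule ccontr)
    assume "\<not> 0 \<le> \<alpha>"
    define p where "p = (\<bar>e - b\<bar> + 1) / (- \<alpha>)"
    have "0 < p" "\<alpha> * p = - (\<bar>e - b\<bar> + 1)" using \<open>\<not> 0 \<le> \<alpha>\<close> by (auto simp: p_def field_simps)
    then show False using that[of p] by linarith
  qed
  have a0: "0 \<le> a1" "0 \<le> a2"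
  proof -
    show "0 \<le> a1" by (rule nonneg[of _ "a1 * d + a2 * (d + 1)"]) (use quad[of _ 1] in \<open>simp add: algebra_simps\<close>)
    show "0 \<le> a2" by (rule nonneg[of _ "a1 * (d + 1) + a2 * d"]) (use quad[of 1] in \<open>simp add: algebra_simps\<close>)
  qed
  have b_le: "b \<le> (a1 + a2) * d"
  proof (rule field_le_epsilon)
    fix e :: real assume "0 < e"
    have s: "0 < a1 + a2" using a0 ab(1) a by (cases "a1 = 0"; cases "a2 = 0") (auto simp: zero_prod_def)
    have "b \<le> a1 * (d + e / (a1 + a2)) + a2 * (d + e / (a1 + a2))" using s \<open>0 < e\<close> by (intro quad) auto
    also have "\<dots> = (a1 + a2) * d + (a1 + a2) * (e / (a1 + a2))"
      by (simp only: distrib_left distrib_right add_ac)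
    finally show "b \<le> (a1 + a2) * d + e" using s by simp
  qed
  have pt: "a1 * x + a2 * y \<le> (a1 + a2) * d" if "(x, y) \<in> C" for x y
    using ab(2)[OF that] b_le by (simp add: a)
  \<comment> \<open>A vanishing coefficient would make the line horizontal or vertical through
    \<open>(d, d)\<close>, with a unit vector of \<open>C\<close> beyond it.\<close>
  have "0 < a1"
  proof (rule ccontr)
    assume "\<not> 0 < a1"
    then have "a1 = 0" "0 < a2" using a0 ab(1) a by (auto simp: zero_prod_def order_le_less)
    then show False using pt[OF C(5)] d01 by simp
  qed
  have "0 < a2"
  proof (rule ccontr)
    assume "\<not> 0 < a2"
    then have "a2 = 0" using a0 by simp
    then show False using pt[OF C(4)] d01 \<open>0 < a1\<close> by simp
  qed
  \<comment> \<open>The normalisation for which the two affine pieces add up to one at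
    \<open>(d, d)\<close>.\<close>
  define \<sigma> where "\<sigma> = (a1 + a2) * (1 - d)"
  have \<sigma>: "0 < \<sigma>" using \<open>0 < a1\<close> \<open>0 < a2\<close> d01 by (simp add: \<sigma>_def)
  define c where "c = a1 / \<sigma>"
  define c' where "c' = a2 / \<sigma>"
  have c: "0 < c" "0 < c'" using \<sigma> \<open>0 < a1\<close> \<open>0 < a2\<close> by (auto simp: c_def c'_def)
  have cc: "(c + c') * (1 - d) = 1" 
  proof -
    have "(c + c') * (1 - d) = \<sigma> / \<sigma>" unfolding c_def c'_def \<sigma>_def add_divide_distrib[symmetric] times_divide_eq_left ..
    then show ?thesis using \<sigma> by simp
  qed
  have supp: "c * (x - d) + c' * (y - d) \<le> 0" if "(x, y) \<in> C" for x y
  proof -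
    have "c * (x - d) + c' * (y - d) = (a1 * x + a2 * y - (a1 + a2) * d) / \<sigma>"
      by (simp add: c_def c'_def algebra_simps add_divide_distrib diff_divide_distrib)
    then show ?thesis using pt[OF that] \<sigma> by (simp add: divide_nonpos_pos)
  qed
  obtain \<psi>\<^sub>1 where \<psi>1: "\<psi>\<^sub>1 \<in> Phi" "\<And>x. d \<le> x \<Longrightarrow> \<psi>\<^sub>1 x = 1 - c * (1 - x)"
    "\<And>x y. 0 \<le> x \<Longrightarrow> x \<le> d \<Longrightarrow> 0 \<le> y \<Longrightarrow> (x, y) \<in> C \<longleftrightarrow> \<psi>\<^sub>1 x \<le> c' * (1 - y)"
  proof (rule represent_half[of C d c c'])
    show "(a', b') \<in> C" if "(a, b) \<in> C" "0 \<le> a'" "a' \<le> a" "0 \<le> b'" "b' \<le> b" for a b a' b'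
      using that by (rule down)
    show "c * (x - d) + c' * (y - d) \<le> 0" if "(x, y) \<in> C" for x y using that by (rule supp)
  qed (use C d01 c cc in auto)
  let ?C = "prod.swap -` C"
  obtain \<psi>\<^sub>2 where \<psi>2: "\<psi>\<^sub>2 \<in> Phi" "\<And>x. d \<le> x \<Longrightarrow> \<psi>\<^sub>2 x = 1 - c' * (1 - x)"
    "\<And>x y. 0 \<le> x \<Longrightarrow> x \<le> d \<Longrightarrow> 0 \<le> y \<Longrightarrow> (x, y) \<in> ?C \<longleftrightarrow> \<psi>\<^sub>2 x \<le> c * (1 - y)"
  proof (rule represent_half[of ?C d c' c])
    show "closed ?C" using C(1) by (intro closed_vimage continuous_intros) (auto intro: continuous_on_swap)
    have "linear (prod.swap :: real \<times> real \<Rightarrow> _)" by (rule linearI) auto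
    then show "convex ?C" using C(2) by (rule convex_linear_vimage)
    show "?C \<subseteq> {0..1} \<times> {0..1}" using C(3) by auto
    show "(a', b') \<in> ?C" if "(a, b) \<in> ?C" "0 \<le> a'" "a' \<le> a" "0 \<le> b'" "b' \<le> b" for a b a' b'
      using down[of b a b' a'] that by simp
    show "c' * (x - d) + c * (y - d) \<le> 0" if "(x, y) \<in> ?C" for x y using supp[of y x] that by simp
  qed (use C d01 c cc in \<open>auto simp: add.commute\<close>)
  have "(x, y) \<in> C \<longleftrightarrow> \<psi>\<^sub>1 x + \<psi>\<^sub>2 y \<le> 1" if xy: "0 \<le> x" "x \<le> 1" "0 \<le> y" "y \<le> 1" for x y
  proof -
    \<comment> \<open>Where the coordinates lie on different sides of \<open>d\<close>, one function
      is the boundary graph and the other is affine. Below \<open>(d, d)\<close> the point is in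
      \<open>C\<close> and both inequalities hold; above it both fail.\<close>
    consider "x \<le> d" "d \<le> y" | "d \<le> x" "y \<le> d" | "x \<le> d" "y \<le> d" | "d < x" "d < y" by linarith
    then show ?thesis
    proof cases
      case 1
      then show ?thesis using \<psi>1(3)[of x y] \<psi>2(2)[of y] xy by auto
    next
      case 2
      then show ?thesis using \<psi>2(3)[of y x] \<psi>1(2)[of x] xy by auto
    next
      case 3
      then have "(x, y) \<in> C" using down[OF d01(3)] xy by simp
      moreover have "\<psi>\<^sub>1 x \<le> \<psi>\<^sub>1 d" "\<psi>\<^sub>2 y \<le> \<psi>\<^sub>2 d" using PhiD1(5)[OF \<psi>1(1)] PhiD1(5)[OF \<psi>2(1)] 3 xy by auto
      moreover have "\<psi>\<^sub>1 d + \<psi>\<^sub>2 d = 1" using \<psi>1(2)[of d] \<psi>2(2)[of d] cc by (simp add: algebra_simps)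
      ultimately show ?thesis by simp
    next
      case 4
      then have "(x, y) \<notin> C" using \<open>C \<inter> Q = {}\<close> by (auto simp: Q_def)
      moreover have "c * (1 - x) + c' * (1 - y) < c * (1 - d) + c' * (1 - d)" using 4 c by (intro add_strict_mono) auto
      then have "c * (1 - x) + c' * (1 - y) < 1" using cc by (simp add: algebra_simps)
      ultimately show ?thesis using \<psi>1(2)[of x] \<psi>2(2)[of y] 4 by simp
    qed
  qed
  then have "C = {(x1, x2). x1 \<in> {0..1} \<and> x2 \<in> {0..1} \<and> \<psi>\<^sub>1 x1 + \<psi>\<^sub>2 x2 \<le> 1}" using C(3) by auto
  then show thesis using that \<psi>1(1) \<psi>2(1) by blast
qed

text \<open>\<open>A\<close> is an upper boundary arc of the polar, a single point in the Minkowski case.\<close>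

lemma orlicz_sum_coefficients:
  fixes \<phi> :: "real \<times> real \<Rightarrow> real"
  assumes \<phi>: "\<phi> \<in> Phi"
  obtains A where "compact A" "A \<subseteq> polar_quadrant \<phi>"
    "\<And>a b. (a, b) \<in> polar_quadrant \<phi> \<Longrightarrow> \<exists>(a', b')\<in>A. a \<le> a' \<and> b \<le> b'"
    "\<And>K L :: 'a::real_vector set. orlicz_sum \<phi> K L = {a *\<^sub>R x + b *\<^sub>R y |a b x y. (a, b) \<in> A \<and> x \<in> K \<and> y \<in> L}"
proof (cases "(1, 1) \<in> polar_quadrant \<phi>")
  case True
  show thesis
  proof (rule that[of "{(1, 1)}"])
    show "\<exists>(a', b')\<in>{(1, 1)}. a \<le> a' \<and> b \<le> b'" if "(a, b) \<in> polar_quadrant \<phi>" for a b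
      using polar_quadrantD(4,5)[OF \<phi> that] by simp
    have "polar (J_body \<phi>) = {-1..1} \<times> {-1..1}" using polar_square_iff[OF \<phi>] True by simp
    then show "orlicz_sum \<phi> K L = {a *\<^sub>R x + b *\<^sub>R y |a b x y. (a, b) \<in> {(1, 1)} \<and> x \<in> K \<and> y \<in> L}" for K L :: "'a set"
      unfolding orlicz_sum_def by simp
  qed (use True in auto)
next
  case False
  have "\<exists>\<psi>\<^sub>1 \<psi>\<^sub>2. represents_polar \<phi> \<psi>\<^sub>1 \<psi>\<^sub>2"
  proof (rule exists_Phi_representation[of "polar_quadrant \<phi>"])
    show "polar_quadrant \<phi> \<subseteq> {0..1} \<times> {0..1}"
      using polar_quadrantD(1,2,4,5)[OF \<phi>] by (metis SigmaI atLeastAtMost_iff subrelI)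
  qed (use False polar_quadrant_closed_convex polar_quadrant_units[OF \<phi>] polar_quadrant_downward[OF \<phi>]
      in \<open>auto simp: represents_polar_def\<close>)
  \<comment> \<open>Existence is what gives the pair chosen by \<open>SOME\<close> its defining
    property.\<close>
  then have "\<exists>p. case p of (\<psi>\<^sub>1, \<psi>\<^sub>2) \<Rightarrow> represents_polar \<phi> \<psi>\<^sub>1 \<psi>\<^sub>2" by auto
  then have some: "case (SOME (\<psi>\<^sub>1, \<psi>\<^sub>2). represents_polar \<phi> \<psi>\<^sub>1 \<psi>\<^sub>2) of (\<psi>\<^sub>1, \<psi>\<^sub>2) \<Rightarrow> represents_polar \<phi> \<psi>\<^sub>1 \<psi>\<^sub>2"
    by (rule someI_ex)
  obtain \<psi>\<^sub>1 \<psi>\<^sub>2 where \<psi>: "(SOME (\<psi>\<^sub>1, \<psi>\<^sub>2). represents_polar \<phi> \<psi>\<^sub>1 \<psi>\<^sub>2) = (\<psi>\<^sub>1, \<psi>\<^sub>2)" by fastforce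
  then have rep: "\<psi>\<^sub>1 \<in> Phi" "\<psi>\<^sub>2 \<in> Phi"
    "polar_quadrant \<phi> = {(x1, x2). x1 \<in> {0..1} \<and> x2 \<in> {0..1} \<and> \<psi>\<^sub>1 x1 + \<psi>\<^sub>2 x2 \<le> 1}"
    using some by (auto simp: represents_polar_def)
  define A where "A = (\<lambda>t. (hat_inv \<psi>\<^sub>1 (1 - t), hat_inv \<psi>\<^sub>2 t)) ` {0..1}"
  note h1 = hat_inv_props[OF rep(1)] and h2 = hat_inv_props[OF rep(2)]
  note z1 = last_zero_props[OF rep(1)] and z2 = last_zero_props[OF rep(2)]
  show thesis
  proof (rule that[of A])
    have "continuous_on {0..1} (\<lambda>t. hat_inv \<psi>\<^sub>1 (1 - t))"
      by (rule continuous_on_compose2[OF h1(2)]) (auto intro!: continuous_intros)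
    then show "compact A" unfolding A_def
      by (intro compact_continuous_image continuous_on_Pair h2(2)) auto
    show "A \<subseteq> polar_quadrant \<phi>"
    proof
      fix p assume "p \<in> A"
      then obtain t where t: "0 \<le> t" "t \<le> 1" "p = (hat_inv \<psi>\<^sub>1 (1 - t), hat_inv \<psi>\<^sub>2 t)" by (auto simp: A_def)
      then show "p \<in> polar_quadrant \<phi>"
        using h1(1)[of "1 - t"] h2(1)[of t] z1(1) z2(1) unfolding rep(3) by auto
    qed
    fix a b assume ab: "(a, b) \<in> polar_quadrant \<phi>"
    then have ab': "0 \<le> a" "a \<le> 1" "0 \<le> b" "b \<le> 1" "\<psi>\<^sub>1 a + \<psi>\<^sub>2 b \<le> 1" unfolding rep(3) by auto
    \<comment> \<open>The arc parameter that reproduces the value of the second function at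
      \<open>b\<close>; the defining inequality then bounds the first function at \<open>a\<close>
      by \<open>1 - t\<close>, and strict monotonicity compares the points.\<close>
    define t where "t = \<psi>\<^sub>2 b"
    have t: "0 \<le> t" "t \<le> 1" using PhiD1(2)[OF rep(2) ab'(3)] PhiD1(2)[OF rep(1) ab'(1)] ab'(5) by (auto simp: t_def)
    have h1t: "last_zero \<psi>\<^sub>1 \<le> hat_inv \<psi>\<^sub>1 (1 - t)" "\<psi>\<^sub>1 (hat_inv \<psi>\<^sub>1 (1 - t)) = 1 - t" using h1(1)[of "1 - t"] t by auto
    have h2t: "last_zero \<psi>\<^sub>2 \<le> hat_inv \<psi>\<^sub>2 t" "\<psi>\<^sub>2 (hat_inv \<psi>\<^sub>2 t) = t" using h2(1)[of t] t by auto
    have "a \<le> hat_inv \<psi>\<^sub>1 (1 - t)"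
    proof (rule ccontr)
      assume "\<not> ?thesis"
      then have "1 - t < \<psi>\<^sub>1 a" using Phi_strict_mono[OF rep(1) h1t(1)] h1t(2) by simp
      then show False using ab'(5) by (simp add: t_def)
    qed
    moreover have "b \<le> hat_inv \<psi>\<^sub>2 t"
    proof (rule ccontr)
      assume "\<not> ?thesis"
      then have "t < \<psi>\<^sub>2 b" using Phi_strict_mono[OF rep(2) h2t(1)] h2t(2) by simp
      then show False by (simp add: t_def)
    qed
    moreover have "(hat_inv \<psi>\<^sub>1 (1 - t), hat_inv \<psi>\<^sub>2 t) \<in> A" using t by (auto simp: A_def)
    ultimately show "\<exists>(a', b')\<in>A. a \<le> a' \<and> b \<le> b'" by blast
  next
    fix K L :: "'a set"
    have "polar (J_body \<phi>) \<noteq> {-1..1} \<times> {-1..1}" using polar_square_iff[OF \<phi>] False by simp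
    then have "orlicz_sum \<phi> K L = orlicz_comb \<psi>\<^sub>1 \<psi>\<^sub>2 K L" by (simp add: orlicz_sum_def \<psi>)
    moreover have "(\<exists>a b. w = a *\<^sub>R x + b *\<^sub>R y \<and> (a, b) \<in> A)
        \<longleftrightarrow> (\<exists>t. w = hat_inv \<psi>\<^sub>1 (1 - t) *\<^sub>R x + hat_inv \<psi>\<^sub>2 t *\<^sub>R y \<and> 0 \<le> t \<and> t \<le> 1)" for w x y :: 'a
      unfolding A_def image_iff Bex_def atLeastAtMost_iff prod.inject by blast
    ultimately show "orlicz_sum \<phi> K L = {a *\<^sub>R x + b *\<^sub>R y |a b x y. (a, b) \<in> A \<and> x \<in> K \<and> y \<in> L}"
      unfolding orlicz_comb_def by blast
  qed
qed

section \<open>The Orlicz sum\<close>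

lemma measure_lborel_scaleR:
  fixes K :: "'a::euclidean_space set"
  assumes "compact K" "K \<noteq> {}" "0 \<le> a"
  shows "measure lborel ((\<lambda>x. a *\<^sub>R x) ` K) = a ^ DIM('a) * measure lborel K"
proof (cases "a = 0")
  case True
  then have "(\<lambda>x. a *\<^sub>R x) ` K = {0}" using assms by auto
  then show ?thesis using True by simp
next
  case False
  then show ?thesis using measure_lborel_affine_image[OF assms(1), of a 0] assms(3) by simp
qed

lemma real_power_le_imp_le:
  fixes x y :: real
  assumes "x ^ n \<le> y ^ n" "0 \<le> y" "0 < n"
  shows "x \<le> y"
proof (rule ccontr)
  assume "\<not> x \<le> y"
  then have "y ^ n < x ^ n" using assms by (intro power_strict_mono) auto
  then show False using assms(1) by simp
qed

lemma convex_zero_combination: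
  assumes S: "convex S" "0 \<in> S" and "x \<in> S" "y \<in> S" and cd: "0 \<le> c" "0 \<le> d" "c + d \<le> 1"
  shows "c *\<^sub>R x + d *\<^sub>R y \<in> S"
proof (cases "c + d = 0")
  case True
  then have "c = 0" "d = 0" using cd by linarith+
  then show ?thesis using S by simp
next
  case False
  then have pos: "0 < c + d" using cd by simp
  have "(c / (c + d)) *\<^sub>R x + (d / (c + d)) *\<^sub>R y \<in> S"
    using assms pos by (intro convexD[OF S(1)]) (auto simp flip: add_divide_distrib)
  from convexD[OF S(1) this S(2), of "c + d" "1 - (c + d)"]
  have "(c + d) *\<^sub>R ((c / (c + d)) *\<^sub>R x + (d / (c + d)) *\<^sub>R y) + (1 - (c + d)) *\<^sub>R 0 \<in> S"
    using cd by simp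
  then show ?thesis using pos by (simp add: scaleR_add_right)
qed

lemma interior_nonempty_of_measure_pos:
  fixes K :: "'a::euclidean_space set"
  assumes "compact K" "convex K" "0 < measure lborel K"
  shows "interior K \<noteq> {}"
proof
  assume "interior K = {}"
  then have "negligible K" using assms(2) by (simp add: negligible_convex_interior)
  then have "measure lebesgue K = 0" by (simp add: negligible_iff_measure)
  then show False using assms by (simp add: borel_compact)
qed

text \<open>A convex body is the closure of its interior, so one image point outside the closed set
  \<open>N\<close> would bring along an open set of such points, whose image would lie in the null
  set \<open>Z\<close>.\<close>

lemma convex_body_subset_of_null:
  fixes K N :: "'a::euclidean_space set"
  assumes K: "compact K" "convex K" "0 < measure lborel K" and N: "closed N" and s: "0 < s"
    and null: "Z \<in> null_sets lborel" and sub: "\<And>x. x \<in> K \<Longrightarrow> w + s *\<^sub>R x \<notin> N \<Longrightarrow> w + s *\<^sub>R x \<in> Z"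
    and x: "x \<in> K"
  shows "w + s *\<^sub>R x \<in> N"
proof (rule ccontr)
  assume "w + s *\<^sub>R x \<notin> N"
  let ?f = "\<lambda>x. w + s *\<^sub>R x"
  have O: "open (?f -` (- N))" using N by (intro open_vimage continuous_intros) auto
  have cl: "closure (interior K) = K"
    using convex_closure_interior[OF K(2) interior_nonempty_of_measure_pos[OF K]] compact_imp_closed[OF K(1)] by simp
  have "?f -` (- N) \<inter> closure (interior K) \<noteq> {}" using x \<open>?f x \<notin> N\<close> unfolding cl by blast
  then obtain y where y: "y \<in> interior K" "?f y \<notin> N"
    unfolding open_Int_closure_eq_empty[OF O] by blast
  let ?W = "interior K \<inter> ?f -` (- N)"
  have W: "open ?W" "y \<in> ?W" using O y by auto
  have B: "?W \<in> sets borel" using W by simp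
  have "?f ` ?W \<subseteq> Z" using sub interior_subset by fast
  then have "?f ` ?W \<in> null_sets lborel"
    using emeasure_lborel_affine_image(2)[OF B, of s w] s by (intro null_sets_subset[OF null]) auto
  then have "?W \<in> null_sets lborel"
    using emeasure_lborel_affine_image(1)[OF B, of s w] s B by (auto simp: null_sets_def)
  then have "negligible ?W" by (simp add: negligible_iff_null_sets null_sets_completion_iff B)
  then show False using open_not_negligible[OF W(1)] W(2) by blast
qed

context
  fixes \<phi> :: "real \<times> real \<Rightarrow> real" and K L :: "'a::euclidean_space set" and A and k l v :: real
  assumes \<phi>: "\<phi> \<in> Phi" and n: "2 \<le> DIM('a)" and K: "compact K" and L: "compact L"
    and k: "0 < k" "measure lborel K = k ^ DIM('a)" and l: "0 < l" "measure lborel L = l ^ DIM('a)"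
    and v: "0 \<le> v" "measure lborel (orlicz_sum \<phi> K L) = v ^ DIM('a)"
    and A: "compact A" "A \<subseteq> polar_quadrant \<phi>" "\<And>a b. (a, b) \<in> polar_quadrant \<phi> \<Longrightarrow> \<exists>(a', b')\<in>A. a \<le> a' \<and> b \<le> b'"
    and M: "orlicz_sum \<phi> K L = {a *\<^sub>R x + b *\<^sub>R y |a b x y. (a, b) \<in> A \<and> x \<in> K \<and> y \<in> L}"
begin

abbreviation (input) "\<M> \<equiv> orlicz_sum \<phi> K L"

lemma KL_nonempty: "K \<noteq> {}" "L \<noteq> {}"
  using k l n by auto

lemma compact_orlicz: "compact \<M>"
proof -
  have "\<M> = (\<lambda>(p, x, y). fst p *\<^sub>R x + snd p *\<^sub>R y) ` (A \<times> K \<times> L)"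
  proof (intro equalityI subsetI)
    fix w assume "w \<in> \<M>"
    then obtain a b x y where "w = a *\<^sub>R x + b *\<^sub>R y" "((a, b), x, y) \<in> A \<times> K \<times> L" unfolding M by blast
    then show "w \<in> (\<lambda>(p, x, y). fst p *\<^sub>R x + snd p *\<^sub>R y) ` (A \<times> K \<times> L)"
      by (intro image_eqI[of _ _ "((a, b), x, y)"]) simp_all
  next
    fix w assume "w \<in> (\<lambda>(p, x, y). fst p *\<^sub>R x + snd p *\<^sub>R y) ` (A \<times> K \<times> L)"
    then obtain a b x y where "w = a *\<^sub>R x + b *\<^sub>R y" "(a, b) \<in> A" "x \<in> K" "y \<in> L" by auto
    then show "w \<in> \<M>" unfolding M by blast
  qed
  moreover have "compact (A \<times> K \<times> L)" using A K L by (intro compact_Times)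
  moreover have "continuous_on (A \<times> K \<times> L) (\<lambda>(p, x, y). fst p *\<^sub>R x + snd p *\<^sub>R y)"
    unfolding case_prod_beta by (intro continuous_intros)
  ultimately show ?thesis by (simp add: compact_continuous_image)
qed

lemma orlicz_coefficient_le:
  assumes ab: "(a, b) \<in> A"
  shows "a * k + b * l \<le> v"
proof -
  have ab0: "0 \<le> a" "0 \<le> b" using ab A(2) by auto
  have "(a * k + b * l) ^ DIM('a) \<le> measure lborel \<M>"
  proof (rule Brunn_Minkowski[of "(\<lambda>x. a *\<^sub>R x) ` K" "(\<lambda>x. b *\<^sub>R x) ` L"])
    show "x + y \<in> \<M>" if "x \<in> (\<lambda>x. a *\<^sub>R x) ` K" "y \<in> (\<lambda>x. b *\<^sub>R x) ` L" for x y
      using that ab unfolding M by blast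
    show "compact ((\<lambda>x. a *\<^sub>R x) ` K)" "compact ((\<lambda>x. b *\<^sub>R x) ` L)"
      by (intro compact_continuous_image continuous_intros K L)+
    show "measure lborel ((\<lambda>x. a *\<^sub>R x) ` K) = (a * k) ^ DIM('a)"
      unfolding measure_lborel_scaleR[OF K KL_nonempty(1) ab0(1)] k(2) power_mult_distrib ..
    show "measure lborel ((\<lambda>x. b *\<^sub>R x) ` L) = (b * l) ^ DIM('a)"
      unfolding measure_lborel_scaleR[OF L KL_nonempty(2) ab0(2)] l(2) power_mult_distrib ..
    show "0 \<le> a * k" "0 \<le> b * l" using ab0 k(1) l(1) by simp_all
  qed (simp_all add: KL_nonempty compact_orlicz)
  then have "(a * k + b * l) ^ DIM('a) \<le> v ^ DIM('a)" using v by simp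
  then show ?thesis using v(1) by (rule real_power_le_imp_le) simp
qed

lemma polar_coefficient_le:
  assumes ab: "(a, b) \<in> polar_quadrant \<phi>"
  shows "a * k + b * l \<le> v"
proof -
  obtain a' b' where ab': "(a', b') \<in> A" "a \<le> a'" "b \<le> b'" using A(3)[OF ab] by blast
  then have "a * k + b * l \<le> a' * k + b' * l" using k l by (intro add_mono mult_right_mono) auto
  then show ?thesis using orlicz_coefficient_le[OF ab'(1)] by linarith
qed

lemma orlicz_v_pos: "0 < v"
  using polar_coefficient_le[OF polar_quadrant_units(1)[OF \<phi>]] k by simp

lemma orlicz_inequality: "\<phi> (k / v, l / v) \<le> 1"
  by (rule Phi_le_one_of_polar[OF \<phi>]) (use k l orlicz_v_pos polar_coefficient_le in auto)

text \<open>In nonnegative directions the compact arc attains the maximum over the whole quadrant of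
  the polar, since it dominates each of its points.\<close>

lemma A_maximum:
  assumes "0 \<le> p" "0 \<le> q"
  obtains a b where "(a, b) \<in> A" "\<And>a' b'. (a', b') \<in> polar_quadrant \<phi> \<Longrightarrow> a' * p + b' * q \<le> a * p + b * q"
proof -
  have "A \<noteq> {}" using A(3)[OF polar_quadrant_units(1)[OF \<phi>]] by auto
  moreover have "continuous_on A (\<lambda>z. fst z * p + snd z * q)" by (intro continuous_intros)
  ultimately obtain z where z: "z \<in> A" "\<And>w. w \<in> A \<Longrightarrow> fst w * p + snd w * q \<le> fst z * p + snd z * q"
    using continuous_attains_sup[OF A(1)] by blast
  have "a' * p + b' * q \<le> fst z * p + snd z * q" if P: "(a', b') \<in> polar_quadrant \<phi>" for a' b'
  proof -
    obtain a'' b'' where ab: "(a'', b'') \<in> A" "a' \<le> a''" "b' \<le> b''" using A(3)[OF P] by blast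
    then have "a' * p + b' * q \<le> a'' * p + b'' * q" using assms by (intro add_mono mult_right_mono) auto
    then show ?thesis using z(2)[OF ab(1)] by simp
  qed
  then show thesis using that[of "fst z" "snd z"] z(1) by simp
qed

text \<open>Convexity and the origin place every contribution to the sum inside one dilatate
  \<open>h K\<close>, and the maximising coefficients give the matching lower bound. Hence
  \<open>v = h * k\<close>, and the point \<open>(k / v, l / v)\<close> pairs to one with an element
  of the polar, which excludes a value below one.\<close>

lemma orlicz_equality_of_dilatates:
  assumes conv: "convex K" "0 \<in> K" and t: "0 < t" "L = (\<lambda>x. t *\<^sub>R x) ` K"
  shows "\<phi> (k / v, l / v) = 1"
proof -
  have lt: "l = t * k"
  proof -
    have "l ^ DIM('a) = (t * k) ^ DIM('a)"
      using measure_lborel_scaleR[OF K KL_nonempty(1), of t] t k(2) l(2) by (simp add: power_mult_distrib)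
    then show ?thesis using l k t by (simp add: power_eq_iff_eq_base)
  qed
  obtain a b where ab: "(a, b) \<in> A" "\<And>a' b'. (a', b') \<in> polar_quadrant \<phi> \<Longrightarrow> a' * 1 + b' * t \<le> a * 1 + b * t"
    using A_maximum[of 1 t] t by auto
  \<comment> \<open>The support function of the polar in direction \<open>(1, t)\<close>.\<close>
  define h where "h = a + b * t"
  have h1: "1 \<le> h" using ab(2)[OF polar_quadrant_units(1)[OF \<phi>]] by (simp add: h_def)
  have "\<M> \<subseteq> (\<lambda>x. h *\<^sub>R x) ` K"
  proof
    fix w assume "w \<in> \<M>"
    then obtain a' b' x y' where "(a', b') \<in> A" "x \<in> K" "y' \<in> L" "w = a' *\<^sub>R x + b' *\<^sub>R y'"
      unfolding M by blast
    moreover from \<open>y' \<in> L\<close> obtain y where "y \<in> K" "y' = t *\<^sub>R y" unfolding t(2) by blast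
    ultimately have w: "(a', b') \<in> A" "x \<in> K" "y \<in> K" "w = a' *\<^sub>R x + b' *\<^sub>R (t *\<^sub>R y)" by simp_all
    have ab': "0 \<le> a'" "0 \<le> b'" "(a', b') \<in> polar_quadrant \<phi>" using w(1) A(2) by auto
    have h': "a' + b' * t \<le> h" using ab(2)[OF ab'(3)] by (simp add: h_def)
    have "(a' / h) *\<^sub>R x + (b' * t / h) *\<^sub>R y \<in> K"
      using conv w(2,3) ab' t h1 h' by (intro convex_zero_combination) (auto simp flip: add_divide_distrib)
    then have "h *\<^sub>R ((a' / h) *\<^sub>R x + (b' * t / h) *\<^sub>R y) \<in> (\<lambda>x. h *\<^sub>R x) ` K" by (rule imageI)
    moreover have "h *\<^sub>R ((a' / h) *\<^sub>R x + (b' * t / h) *\<^sub>R y) = w" using w(4) h1 by (simp add: scaleR_add_right)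
    ultimately show "w \<in> (\<lambda>x. h *\<^sub>R x) ` K" by simp
  qed
  then have "measure lborel \<M> \<le> measure lborel ((\<lambda>x. h *\<^sub>R x) ` K)"
    by (intro measure_lborel_mono compact_orlicz compact_continuous_image K continuous_intros)
  then have "v ^ DIM('a) \<le> (h * k) ^ DIM('a)"
    using measure_lborel_scaleR[OF K KL_nonempty(1), of h] h1 k v by (simp add: power_mult_distrib)
  then have "v \<le> h * k"
    by (rule real_power_le_imp_le) (use h1 k in simp_all)
  moreover have "h * k \<le> v" using orlicz_coefficient_le[OF ab(1)] by (simp add: h_def lt algebra_simps)
  ultimately have vh: "v = h * k" by simp
  have "\<not> \<phi> (k / v, l / v) < 1"
  proof
    assume "\<phi> (k / v, l / v) < 1"
    then obtain s where s: "1 < s" "\<phi> (s *\<^sub>R (k / v, l / v)) \<le> 1"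
      using Phi_scale_up[OF \<phi>, of "(k / v, l / v)"] k l v by auto
    have "(a, b) \<in> polar_quadrant \<phi>" using ab A by blast
    then have "a * (s * (k / v)) + b * (s * (l / v)) \<le> 1"
      using s k l v by (intro polar_quadrantD(3)[OF \<phi>]) auto
    moreover have "a * (s * (k / v)) + b * (s * (l / v)) = s * (h * k) / v"
      by (simp add: h_def lt algebra_simps add_divide_distrib)
    moreover have "s * (h * k) / v = s" unfolding vh[symmetric] using orlicz_v_pos by simp
    ultimately show False using s by simp
  qed
  then show ?thesis using orlicz_inequality by simp
qed

text \<open>The maximising coefficients give an equality case of Brunn--Minkowski, so \<open>K\<close> and \<open>L\<close> are
  homothetic convex bodies. Strict convexity of \<open>\<phi>\<close> makes the polar smooth at the maximising point; a
  nonzero translation would produce a second supporting direction there.\<close>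

lemma orlicz_equality_imp:
  assumes strict: "strictly_convex_on orthant \<phi>" and eq: "\<phi> (k / v, l / v) = 1"
  shows "convex K \<and> convex L \<and> 0 \<in> K \<and> 0 \<in> L \<and> dilatates K L"
proof -
  have v0: "0 < v" by (rule orlicz_v_pos)
  define \<kappa> where "\<kappa> = k / v"
  define \<rho> where "\<rho> = l / v"
  have kl: "0 < \<kappa>" "0 < \<rho>" using k l v0 by (auto simp: \<kappa>_def \<rho>_def)
  have eq1: "\<phi> (\<kappa>, \<rho>) = 1" using eq by (simp add: \<kappa>_def \<rho>_def)
  obtain a b where ab: "(a, b) \<in> A" "\<And>a' b'. (a', b') \<in> polar_quadrant \<phi> \<Longrightarrow> a' * k + b' * l \<le> a * k + b * l"
    using A_maximum[of k l] k l by auto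
  have abP: "(a, b) \<in> polar_quadrant \<phi>" using ab A by blast
  have ab0: "0 \<le> a" "0 \<le> b" "a \<le> 1" "b \<le> 1" using polar_quadrantD[OF \<phi> abP] by auto
  \<comment> \<open>If the maximum \<open>w\<close> were smaller than \<open>v\<close>, the polar
    bound would hold with \<open>w\<close> in place of \<open>v\<close>, and scaling by
    \<open>w / v\<close> would push the value at \<open>(k / v, l / v)\<close> below one.\<close>
  have abv: "a * k + b * l = v"
  proof (rule ccontr)
    define w where "w = a * k + b * l"
    assume "a * k + b * l \<noteq> v"
    then have w: "w < v" using orlicz_coefficient_le[OF ab(1)] by (simp add: w_def)
    have "0 < w" using ab(2)[OF polar_quadrant_units(1)[OF \<phi>]] k by (simp add: w_def)
    have "\<phi> (k / w, l / w) \<le> 1"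
      by (rule Phi_le_one_of_polar[OF \<phi>]) (use k l \<open>0 < w\<close> ab(2) in \<open>auto simp: w_def\<close>)
    moreover have "\<phi> ((w / v) *\<^sub>R (k / w, l / w)) \<le> (w / v) * \<phi> (k / w, l / w)"
      using \<open>0 < w\<close> w k l v0 by (intro Phi_scale2[OF \<phi>]) auto
    moreover have "(w / v) *\<^sub>R (k / w, l / w) = (k / v, l / v)" using \<open>0 < w\<close> by simp
    moreover have "(w / v) * \<phi> (k / w, l / w) \<le> w / v"
      using mult_left_mono[OF calculation(1), of "w / v"] \<open>0 < w\<close> v0 by simp
    moreover have "w / v < 1" using w v0 by simp
    ultimately show False using eq by simp
  qed
  then have contact: "a * \<kappa> + b * \<rho> = 1" using v0 by (simp add: \<kappa>_def \<rho>_def flip: add_divide_distrib)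
  have unique: "(x, y) = (\<kappa>, \<rho>)"
    if "(a', b') \<in> polar_quadrant \<phi>" "a' * \<kappa> + b' * \<rho> = 1"
      "0 \<le> x" "0 \<le> y" "\<phi> (x, y) \<le> 1" "a' * x + b' * y = 1" for a' b' x y
    by (rule strictly_convex_contact_unique[OF \<phi> strict that(1,3-6)]) (use that(2) kl eq1 in simp_all)
  \<comment> \<open>A zero coefficient would force the other one to be one, and a unit vector would
    be a second contact point.\<close>
  have a_pos: "0 < a" and b_pos: "0 < b"
  proof -
    have le1: "\<kappa> \<le> 1" "\<rho> \<le> 1" using Phi_le_one_bounds[OF \<phi>, of \<kappa> \<rho>] kl eq1 by auto
    have one: "x = 1" if "x * y = 1" "0 \<le> x" "x \<le> 1" "0 \<le> y" "y \<le> 1" for x y :: real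
      using mult_left_le[of y x] that by linarith
    show "0 < a"
    proof (rule ccontr)
      assume "\<not> 0 < a"
      then have "a = 0" using ab0 by simp
      then have "b = 1" using one[of b \<rho>] contact ab0 kl le1 by simp
      then show False using unique[OF abP contact, of 0 1] \<open>a = 0\<close> kl PhiD2(5)[OF \<phi>] by simp
    qed
    show "0 < b"
    proof (rule ccontr)
      assume "\<not> 0 < b"
      then have "b = 0" using ab0 by simp
      then have "a = 1" using one[of a \<kappa>] contact ab0 kl le1 by simp
      then show False using unique[OF abP contact, of 1 0] \<open>b = 0\<close> kl PhiD2(4)[OF \<phi>] by simp
    qed
  qed
  let ?K = "(\<lambda>x. a *\<^sub>R x) ` K" and ?L = "(\<lambda>x. b *\<^sub>R x) ` L"
  define r where "r = (b * l) / (a * k)"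
  have r: "0 < r" "r * (a * k) = b * l" using a_pos b_pos k l by (simp_all add: r_def)
  have cK: "compact ?K" and cL: "compact ?L" using K L by (auto intro!: compact_continuous_image continuous_intros)
  have vK: "measure lborel ?K = (a * k) ^ DIM('a)"
    using measure_lborel_scaleR[OF K KL_nonempty(1) ab0(1)] k by (simp add: power_mult_distrib)
  have vL: "measure lborel ?L = r ^ DIM('a) * measure lborel ?K"
    using measure_lborel_scaleR[OF L KL_nonempty(2) ab0(2)] l vK r(2) by (simp flip: power_mult_distrib)
  have sub: "msum ?K ?L \<subseteq> \<M>" using ab(1) unfolding M by blast
  have vsum: "(1 + r) ^ DIM('a) * measure lborel ?K = measure lborel \<M>"
  proof -
    have "(1 + r) * (a * k) = v" using r(2) abv by (simp add: algebra_simps)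
    then show ?thesis using v by (simp add: vK flip: power_mult_distrib)
  qed
  have vS: "measure lborel (msum ?K ?L) = (1 + r) ^ DIM('a) * measure lborel ?K"
  proof (rule antisym)
    show "measure lborel (msum ?K ?L) \<le> (1 + r) ^ DIM('a) * measure lborel ?K"
      unfolding vsum by (rule measure_lborel_mono[OF compact_sums[OF cK cL] compact_orlicz sub])
    show "(1 + r) ^ DIM('a) * measure lborel ?K \<le> measure lborel (msum ?K ?L)"
      by (rule Brunn_Minkowski_ratio[OF cK cL compact_sums[OF cK cL] r(1) vL order_refl])
  qed
  have "BM_equal r ?K ?L"
    unfolding BM_equal_def using cK cL r(1) vL vS vK a_pos k by simp
  then obtain z0 where z0: "convex ?K" "convex ?L" "?L = (\<lambda>x. z0 + r *\<^sub>R x) ` ?K"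
    using Brunn_Minkowski_equality[OF _ n] by blast
  have unscale: "convex S" if "convex ((\<lambda>x. c *\<^sub>R x) ` S)" "0 < c" for c and S :: "'a set"
  proof -
    have "(\<lambda>x. (1 / c) *\<^sub>R x) ` (\<lambda>x. c *\<^sub>R x) ` S = S" using that(2) by (auto simp: image_image)
    then show ?thesis using convex_scaling[OF that(1), of "1 / c"] by simp
  qed
  have convK: "convex K" and convL: "convex L" using z0 unscale a_pos b_pos by blast+
  define t where "t = l / k"
  have t: "0 < t" "l = t * k" using k l by (simp_all add: t_def)
  define z where "z = (1 / b) *\<^sub>R z0"
  have Lz: "L = (\<lambda>x. z + t *\<^sub>R x) ` K"
  proof -
    have "L = (\<lambda>x. (1 / b) *\<^sub>R x) ` ?L" using b_pos by (auto simp: image_image)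
    also have "\<dots> = (\<lambda>x. z + (r * a / b) *\<^sub>R x) ` K" unfolding z0(3) by (simp add: image_image z_def scaleR_add_right)
    also have "r * a / b = t" using a_pos b_pos k by (simp add: r_def t_def)
    finally show ?thesis .
  qed
  define s where "s = a + b * t"
  have s: "0 < s" "s * k = v" using a_pos b_pos t abv by (auto simp: s_def algebra_simps add_pos_pos)
  have y_eq: "\<kappa> = 1 / s" "\<rho> = t / s" using s t k by (simp_all add: \<kappa>_def \<rho>_def s(2)[symmetric])
  \<comment> \<open>The contribution of the maximising pair, written as a single homothet of
    \<open>K\<close>. It has the full volume of the sum, so every other contribution lies in
    it.\<close>
  let ?N = "(\<lambda>x. b *\<^sub>R z + s *\<^sub>R x) ` K"
  have cN: "compact ?N" by (intro compact_continuous_image K continuous_intros)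
  have NM: "?N \<subseteq> \<M>"
  proof
    fix w assume "w \<in> ?N"
    then obtain x where x: "x \<in> K" "w = b *\<^sub>R z + s *\<^sub>R x" by blast
    then have "w = a *\<^sub>R x + b *\<^sub>R (z + t *\<^sub>R x)" by (simp add: s_def algebra_simps)
    moreover have "z + t *\<^sub>R x \<in> L" using x(1) unfolding Lz by blast
    ultimately show "w \<in> \<M>" unfolding M using ab(1) x(1) by blast
  qed
  have null: "\<M> - ?N \<in> null_sets lborel"
  proof -
    have fm: "\<M> \<in> fmeasurable lborel" "?N \<in> fmeasurable lborel" using cN compact_orlicz by (auto intro: fmeasurable_compact)
    have "measure lborel ?N = measure lborel \<M>"
      using measure_lborel_affine_image[OF K, of s "b *\<^sub>R z"] s k v by (simp flip: power_mult_distrib)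
    then have "measure lborel (\<M> - ?N) = 0"
      using measure_Diff[of lborel \<M> ?N] fm(1) borel_compact[OF compact_orlicz] borel_compact[OF cN] NM
      by (simp add: fmeasurableD2)
    moreover have "\<M> - ?N \<in> fmeasurable lborel" using fm by auto
    ultimately show ?thesis by (intro null_setsI) (auto simp: emeasure_eq_measure2 dest: fmeasurableD)
  qed
  have vK0: "0 < measure lborel K" using k by simp
  \<comment> \<open>The support functions of the contribution of \<open>(a', b')\<close> and of
    \<open>?N\<close> are compared in direction \<open>w\<close>.\<close>
  have key: "(s - (a' + b' * t)) * (w \<bullet> x0) \<ge> (b' - b) * (w \<bullet> z)"
    if ab': "(a', b') \<in> A" and x0: "x0 \<in> K" "\<And>x. x \<in> K \<Longrightarrow> w \<bullet> x \<le> w \<bullet> x0" and pos: "0 < a' + b' * t" for a' b' w x0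
  proof -
    have "b' *\<^sub>R z + (a' + b' * t) *\<^sub>R x0 \<in> ?N"
    proof (rule convex_body_subset_of_null[OF K convK vK0 compact_imp_closed[OF cN] pos null _ x0(1)])
      fix x assume x: "x \<in> K" and nN: "b' *\<^sub>R z + (a' + b' * t) *\<^sub>R x \<notin> ?N"
      have "b' *\<^sub>R z + (a' + b' * t) *\<^sub>R x = a' *\<^sub>R x + b' *\<^sub>R (z + t *\<^sub>R x)" by (simp add: algebra_simps)
      moreover have "z + t *\<^sub>R x \<in> L" using x unfolding Lz by blast
      ultimately have "b' *\<^sub>R z + (a' + b' * t) *\<^sub>R x \<in> \<M>" unfolding M using ab' x by blast
      then show "b' *\<^sub>R z + (a' + b' * t) *\<^sub>R x \<in> \<M> - ?N" using nN by blast
    qed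
    then obtain x where x: "x \<in> K" "b' *\<^sub>R z + (a' + b' * t) *\<^sub>R x0 = b *\<^sub>R z + s *\<^sub>R x" by blast
    have "b' * (w \<bullet> z) + (a' + b' * t) * (w \<bullet> x0) = b * (w \<bullet> z) + s * (w \<bullet> x)"
      using arg_cong[OF x(2), of "inner w"] by (simp add: inner_add_right)
    moreover have "s * (w \<bullet> x) \<le> s * (w \<bullet> x0)" using x0(2)[OF x(1)] s(1) by simp
    ultimately show ?thesis by (simp add: algebra_simps)
  qed
  have maxK: "\<exists>x0\<in>K. \<forall>x\<in>K. w \<bullet> x \<le> w \<bullet> x0" for w
    by (rule continuous_attains_sup[OF K KL_nonempty(1)]) (intro continuous_intros)
  have s_le: "a' + b' * t \<le> s" if "(a', b') \<in> polar_quadrant \<phi>" for a' b'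
  proof -
    have "(a' + b' * t) * k \<le> s * k" using ab(2)[OF that] abv s t by (simp add: algebra_simps)
    then show ?thesis using k by simp
  qed
  have "z = 0"
  proof (rule ccontr)
    assume "z \<noteq> 0"
    then have zz: "0 < z \<bullet> z" by simp
    obtain x0 where x0: "x0 \<in> K" "\<And>x. x \<in> K \<Longrightarrow> z \<bullet> x \<le> z \<bullet> x0" using maxK[of z] by blast
    define H where "H = max 1 (z \<bullet> x0)"
    \<comment> \<open>\<open>H\<close> is a positive upper bound for the support value of
      \<open>K\<close> in direction \<open>z\<close>. With this \<open>e\<close> the support
      inequality says that \<open>(a, b)\<close> still maximises when the direction
      \<open>(1, t)\<close> is tilted to \<open>(1, t + e)\<close>.\<close>
    define e where "e = (z \<bullet> z) / H"
    have H: "0 < H" "z \<bullet> x0 \<le> H" by (auto simp: H_def)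
    have e: "0 < e" using zz H by (simp add: e_def)
    have perturbed: "a' + b' * (t + e) \<le> a + b * (t + e)" if ab': "(a', b') \<in> A" for a' b'
    proof (cases "0 < a' + b' * t")
      case True
      have P: "(a', b') \<in> polar_quadrant \<phi>" using ab' A(2) by blast
      have "(b' - b) * (z \<bullet> z) \<le> (s - (a' + b' * t)) * (z \<bullet> x0)" by (rule key[OF ab' x0 True])
      also have "\<dots> \<le> (s - (a' + b' * t)) * H" using s_le[OF P] H by (intro mult_left_mono) auto
      finally have "(b' - b) * e \<le> s - (a' + b' * t)" using H by (simp add: e_def pos_divide_le_eq)
      then show ?thesis by (simp add: s_def algebra_simps)
    next
      case False
      have "0 \<le> a'" "0 \<le> b'" using ab' A(2) by auto
      moreover have "0 \<le> b' * t" using \<open>0 \<le> b'\<close> t by simp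
      ultimately have "a' = 0" "b' * t = 0" using False by linarith+
      then have "a' = 0" "b' = 0" using t by auto
      then show ?thesis using ab0 t e by simp
    qed
    define w where "w = a + b * (t + e)"
    have w: "0 < w" using a_pos b_pos t e by (simp add: w_def add_pos_pos)
    have "\<phi> (1 / w, (t + e) / w) \<le> 1"
    proof (rule Phi_le_one_of_polar[OF \<phi>])
      fix a' b' assume "(a', b') \<in> polar_quadrant \<phi>"
      then obtain a'' b'' where ab'': "(a'', b'') \<in> A" "a' \<le> a''" "b' \<le> b''" using A(3) by blast
      then have "a' * 1 + b' * (t + e) \<le> a'' * 1 + b'' * (t + e)" using t e by (intro add_mono mult_right_mono) auto
      then show "a' * 1 + b' * (t + e) \<le> w" using perturbed[OF ab''(1)] by (simp add: w_def)
    qed (use t e w in auto)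
    moreover have "a * (1 / w) + b * ((t + e) / w) = 1"
      using w by (simp add: w_def flip: add_divide_distrib)
    ultimately have "(1 / w, (t + e) / w) = (\<kappa>, \<rho>)"
      using unique[OF abP contact, of "1 / w" "(t + e) / w"] w t e by simp
    then have ws: "1 / w = 1 / s" and te: "(t + e) / w = t / s" unfolding y_eq prod.inject by blast+
    from ws have "w = s" using w s by simp
    from te have "t + e = t" unfolding \<open>w = s\<close> using s(1) by (metis divide_cancel_right less_irrefl)
    then show False using e by simp
  qed
  have "0 \<in> K"
  proof (rule ccontr)
    assume "0 \<notin> K"
    then obtain w c where w: "w \<bullet> 0 < c" "\<And>x. x \<in> K \<Longrightarrow> c < w \<bullet> x"
      using separating_hyperplane_closed_point[OF convK compact_imp_closed[OF K]] by blast
    obtain x0 where x0: "x0 \<in> K" "\<And>x. x \<in> K \<Longrightarrow> (- w) \<bullet> x \<le> (- w) \<bullet> x0" using maxK[of "- w"] by blast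
    have neg: "(- w) \<bullet> x0 < 0" using w(1) w(2)[OF x0(1)] by simp
    \<comment> \<open>An arc point above \<open>(1, 0)\<close>. If \<open>K\<close> misses the
      origin, its support value in direction \<open>- w\<close> is negative, so a smaller homothet
      does not fit into \<open>?N\<close>. The arc point must then be maximising too, and
      \<open>(1, 0)\<close> becomes a contact point.\<close>
    obtain a' b' where ab': "(a', b') \<in> A" "1 \<le> a'" "0 \<le> b'" using A(3)[OF polar_quadrant_units(1)[OF \<phi>]] by blast
    have P: "(a', b') \<in> polar_quadrant \<phi>" using ab' A(2) by blast
    have "a' = 1" using polar_quadrantD(4)[OF \<phi> P] ab'(2) by simp
    have pos: "0 < a' + b' * t" using ab' t by (simp add: add_pos_nonneg)
    have "0 \<le> (s - (a' + b' * t)) * ((- w) \<bullet> x0)" using key[OF ab'(1) x0 pos] \<open>z = 0\<close> by simp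
    then have "\<not> 0 < s - (a' + b' * t)" using mult_pos_neg[OF _ neg, of "s - (a' + b' * t)"] by linarith
    then have "a' + b' * t = s" using s_le[OF P] by simp
    then have "a' * \<kappa> + b' * \<rho> = 1" using y_eq s by (simp flip: add_divide_distrib)
    then have "(1, 0) = (\<kappa>, \<rho>)" using \<open>a' = 1\<close> PhiD2(4)[OF \<phi>] by (intro unique[OF P]) simp_all
    then show False using kl by simp
  qed
  have "L = (\<lambda>x. t *\<^sub>R x) ` K" using Lz \<open>z = 0\<close> by simp
  moreover from this have "0 \<in> L" using \<open>0 \<in> K\<close> by force
  ultimately show ?thesis using convK convL \<open>0 \<in> K\<close> t(1) by (auto simp: dilatates_def)
qed

end

theorem corollary7p5:
  fixes \<phi> :: "real \<times> real \<Rightarrow> real"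
    and K L :: "(real ^ 'n) set"
  defines "V \<equiv> measure (lebesgue :: (real ^ 'n) measure)"
  assumes "CARD('n) \<ge> 2"
    and "\<phi> \<in> Phi"
    and "compact K" and "compact L"
    and "V K * V L > 0"
  shows "1 \<ge> \<phi> ((V K / V (orlicz_sum \<phi> K L)) powr (1 / real CARD('n)),
                 (V L / V (orlicz_sum \<phi> K L)) powr (1 / real CARD('n)))
       \<and> (strictly_convex_on orthant \<phi> \<longrightarrow>
          (1 = \<phi> ((V K / V (orlicz_sum \<phi> K L)) powr (1 / real CARD('n)),
                  (V L / V (orlicz_sum \<phi> K L)) powr (1 / real CARD('n)))
           \<longleftrightarrow> convex K \<and> convex L \<and> 0 \<in> K \<and> 0 \<in> L \<and> dilatates K L))"
proof -
  have dim: "DIM(real ^ 'n) = CARD('n)" by simp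
  have n: "0 < CARD('n)" "2 \<le> DIM(real ^ 'n)" using assms(2) by auto
  have V: "V S = measure lborel S" if "compact S" for S
    using that by (simp add: V_def borel_compact)
  obtain A where A: "compact A" "A \<subseteq> polar_quadrant \<phi>"
    "\<And>a b. (a, b) \<in> polar_quadrant \<phi> \<Longrightarrow> \<exists>(a', b')\<in>A. a \<le> a' \<and> b \<le> b'"
    and M: "\<And>K L :: (real ^ 'n) set. orlicz_sum \<phi> K L = {a *\<^sub>R x + b *\<^sub>R y |a b x y. (a, b) \<in> A \<and> x \<in> K \<and> y \<in> L}"
    by (rule orlicz_sum_coefficients[OF assms(3), where ?'a = "real ^ 'n"]) (rule that; assumption)
  let ?M = "orlicz_sum \<phi> K L"
  define k where "k = root CARD('n) (V K)"
  define l where "l = root CARD('n) (V L)"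
  define v where "v = root CARD('n) (measure lborel ?M)"
  have VKL: "0 < V K" "0 < V L"
    using assms(6) measure_nonneg[of lebesgue K] measure_nonneg[of lebesgue L]
    unfolding V_def zero_less_mult_iff by linarith+
  have k: "0 < k" "measure lborel K = k ^ DIM(real ^ 'n)"
    and l: "0 < l" "measure lborel L = l ^ DIM(real ^ 'n)"
    and v: "0 \<le> v" "measure lborel ?M = v ^ DIM(real ^ 'n)"
    unfolding dim k_def l_def v_def V[OF assms(4), symmetric] V[OF assms(5), symmetric]
    using VKL n(1) by (simp_all add: real_root_pow_pos2)
  note ctx = assms(3) n(2) assms(4,5) k l v A M
  have VM: "V ?M = measure lborel ?M" by (rule V[OF compact_orlicz[OF ctx]])
  have v0: "0 < v" by (rule orlicz_v_pos[OF ctx])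
  \<comment> \<open>With volumes written as \<open>n\<close>-th powers, the real power of their
    quotient is the quotient of the roots.\<close>
  have "(x ^ CARD('n) / v ^ CARD('n)) powr (1 / real CARD('n)) = x / v" if "0 < x" for x
  proof -
    have "(x ^ CARD('n) / v ^ CARD('n)) powr (1 / real CARD('n)) = root CARD('n) ((x / v) ^ CARD('n))"
      using that v0 n(1) by (simp add: root_powr_inverse power_divide)
    then show ?thesis using that v0 n(1) by (simp add: real_root_power_cancel)
  qed
  then have powr: "(V K / V ?M) powr (1 / real CARD('n)) = k / v" "(V L / V ?M) powr (1 / real CARD('n)) = l / v"
    using k l v V[OF assms(4)] V[OF assms(5)] VM by (simp_all only: dim)
  have "1 = \<phi> (k / v, l / v) \<longleftrightarrow> convex K \<and> convex L \<and> 0 \<in> K \<and> 0 \<in> L \<and> dilatates K L"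
    if strict: "strictly_convex_on orthant \<phi>"
  proof
    assume "1 = \<phi> (k / v, l / v)"
    then show "convex K \<and> convex L \<and> 0 \<in> K \<and> 0 \<in> L \<and> dilatates K L"
      using orlicz_equality_imp[OF ctx strict] by simp
  next
    assume "convex K \<and> convex L \<and> 0 \<in> K \<and> 0 \<in> L \<and> dilatates K L"
    then obtain t where "convex K" "0 \<in> K" "0 < t" "L = (\<lambda>x. t *\<^sub>R x) ` K" by (auto simp: dilatates_def)
    then show "1 = \<phi> (k / v, l / v)" using orlicz_equality_of_dilatates[OF ctx] by simp
  qed
  then show ?thesis unfolding powr using orlicz_inequality[OF ctx] by blast
qed

end
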